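(* Let $E$ be a directed graph and $K$ a field. Assume that $L_K(E)$ has the property that every Lie ideal of $L_K(E)$ is an ideal of $L_K(E)$. Then $\operatorname{char}(K)=p>0$, and $E$ satisfies one of the following conditions: (1) $E$ is a $p$-commutator graph; (2) $E$ is a disjoint union of a $p$-commutator graph $F$ and an isolated vertex $v$; (3) $E^0=H\sqcup\{v\}$, where $H$ is a non-empty hereditary and saturated subset of $E^0$ such that the porcupine graph $P_H$ is a $p$-commutator graph, and $v$ is the unique infinite emitter of $E$ and is a source in $E$. Furthermore, $L_K(E)^-$ is a locally finite, infinite-dimensional Lie algebra over $K$. Moreover, the following assertions hold: (i) If $E$ satisfies (1) or (3), then the locally solvable radical of $L_K(E)^-$ is $0$. (ii) If $E$ satisfies (2), then the locally solvable radical of $L_K(E)^-$ is isomorphic to $K$ (the one-dimensional abelian Lie algebra).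
   Context: A directed graph $E=(E^0,E^1,r,s)$ consists of sets $E^0$ (vertices), $E^1$ (edges), of arbitrary cardinality, and maps $r,s:E^1\to E^0$ (range, source). A vertex $v$ is a sink if $s^{-1}(v)=\varnothing$, a source if $r^{-1}(v)=\varnothing$, an infinite emitter if $s^{-1}(v)$ is infinite, isolated if $r^{-1}(v)=s^{-1}(v)=\varnothing$, and regular if it is neither a sink nor an infinite emitter; $\mathrm{Reg}(E)$ is the set of regular vertices. A path of length $n\ge 1$ is a sequence $\mu=e_1\cdots e_n$ of edges with $r(e_i)=s(e_{i+1})$, $s(\mu)=s(e_1)$, $r(\mu)=r(e_n)$; vertices are regarded as paths of length $0$. $\mathrm{Path}(E)$ is the set of finite paths. $E$ is acyclic if there is no path $\mu$ of length $\ge1$ with $s(\mu)=r(\mu)$. The Leavitt path algebra $L_K(E)$ is the associative (not necessarily unital) $K$-algebra generated by $E^0\cup E^1\cup\{e^*: e\in E^1\}$ subject to: $vv'=\delta_{v,v'}v$ for $v,v'\in E^0$; $s(e)e=er(e)=e$ and $r(e)e^*=e^*s(e)=e^*$ for $e\in E^1$; $e^*f=\delta_{e,f}r(e)$ for $e,f\in E^1$; $v=\sum_{s(e)=v}ee^*$ for $v\in\mathrm{Reg}(E)$. "Ideal" of an associative algebra means two-sided ring-theoretic ideal. For an associative $K$-algebra $A$, $A^-$ is the Lie algebra on $A$ with $[a,b]=ab-ba$. A Lie ideal of $A$ is a $K$-subspace $U$ with $[U,A]\subseteq U$. A Lie algebra $L$ is locally finite if every finite subset lies in a finite-dimensional Lie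 subalgebra. A Lie subalgebra $L'$ of a locally finite Lie algebra is locally solvable if every finite-dimensional Lie subalgebra of $L'$ is solvable. The locally solvable radical of a locally finite Lie algebra $L$ is its unique maximal locally solvable ideal, which equals the sum of all locally solvable ideals of $L$. A subset $H\subseteq E^0$ is hereditary if whenever $u\in H$ and there is a path from $u$ to $v$ then $v\in H$; it is saturated if for every regular vertex $v$, $r(s^{-1}(v))\subseteq H$ implies $v\in H$. For $u,v\in E^0$, $d(u,v)$ is the length of a shortest path from $u$ to $v$ (so $d(u,u)=0$), and $d(u,v)=\infty$ if there is none. For $m\in\mathbb N=\{0,1,2,\dots\}$, $D(u,m)=\{v\in E^0: d(u,v)\le m\}$. For a prime $p$, $E$ is a $p$-commutator graph if: (a) $E$ is acyclic; (b) every vertex of $E$ is regular; (c) for each $u\in E^0$ there is $m\in\mathbb N$ such that for all $w\in E^0$ with $d(u,w)=m+1$, the number of paths $q=e_1\cdots e_k\in\mathrm{Path}(E)$ with $s(q)=u$, $r(q)=w$ and $s(e_2),\dots,s(e_k)\in D(u,m)$ is a multiple of $p$. Porcupine graph: in the situation of (3) (where $E^0=H\sqcup\{v\}$, $H$ is hereditary and saturated, and $v$ is a source), the porcupine graph $P_H$ (of the admissible pair $(H,\varnothing)$) has vertex set $H\cup\{w^e: e\in s^{-1}(v)\}$ and edge set $\{e\in E^1: s(e)\in H\}\cup\{f^e: e\in s^{-1}(v)\}$, where $w^e$ and $f^e$ are new distinct symbols; the range and source maps agree with those of $E$ on edges $e$ with $s(e)\in H$, and $f^e$ has source $w^e$ and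 range $r(e)$.
   Formalization: E is assumed to have at least one edge or at least two vertices; this excludes only the empty graph (L_K(E)=0) and a single vertex without edges (L_K(E)=K), where every Lie ideal is an ideal over any field but L_K(E) is finite-dimensional, so the claim fails. *)

theory Defs
  imports
    "HOL-Library.Poly_Mapping"
    "HOL-Library.Extended_Nat"
    "Graph_Theory.Arc_Walk"
begin

section \<open>Algebras over a field, given by a carrier set\<close>

text \<open>
  Neither a unit nor associativity is built in. The same record serves for associative algebras
  and for Lie algebras, whose \<open>alg_mult\<close> is the bracket.
\<close>

record ('k, 'a) kalgebra =
  alg_carrier :: "'a set"
  alg_zero :: "'a"
  alg_add :: "'a \<Rightarrow> 'a \<Rightarrow> 'a"
  alg_smult :: "'k \<Rightarrow> 'a \<Rightarrow> 'a"
  alg_mult :: "'a \<Rightarrow> 'a \<Rightarrow> 'a"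

definition alg_diff :: "('k::field, 'a) kalgebra \<Rightarrow> 'a \<Rightarrow> 'a \<Rightarrow> 'a" where
  "alg_diff A x y = alg_add A x (alg_smult A (- 1) y)"

definition alg_subspace :: "('k::field, 'a) kalgebra \<Rightarrow> 'a set \<Rightarrow> bool" where
  "alg_subspace A U \<longleftrightarrow>
     U \<subseteq> alg_carrier A \<and> alg_zero A \<in> U \<and>
     (\<forall>x\<in>U. \<forall>y\<in>U. alg_add A x y \<in> U) \<and>
     (\<forall>c. \<forall>x\<in>U. alg_smult A c x \<in> U)"

definition alg_span :: "('k::field, 'a) kalgebra \<Rightarrow> 'a set \<Rightarrow> 'a set" where
  "alg_span A B = \<Inter>{U. alg_subspace A U \<and> B \<subseteq> U}"

definition alg_fin_dim :: "('k::field, 'a) kalgebra \<Rightarrow> 'a set \<Rightarrow> bool" where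
  "alg_fin_dim A U \<longleftrightarrow> (\<exists>B. finite B \<and> B \<subseteq> U \<and> alg_span A B = U)"

text \<open>Two-sided ideals in the sense of ring theory: no closure under scalars is required.\<close>

definition ring_ideal :: "('k::field, 'a) kalgebra \<Rightarrow> 'a set \<Rightarrow> bool" where
  "ring_ideal A I \<longleftrightarrow>
     I \<subseteq> alg_carrier A \<and> alg_zero A \<in> I \<and>
     (\<forall>x\<in>I. \<forall>y\<in>I. alg_diff A x y \<in> I) \<and>
     (\<forall>a\<in>alg_carrier A. \<forall>x\<in>I. alg_mult A a x \<in> I \<and> alg_mult A x a \<in> I)"

definition generated_alg_ideal :: "('k::field, 'a) kalgebra \<Rightarrow> 'a set \<Rightarrow> 'a set" where
  "generated_alg_ideal A R = \<Inter>{I. ring_ideal A I \<and> alg_subspace A I \<and> R \<subseteq> I}"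

definition alg_congruence :: "('k::field, 'a) kalgebra \<Rightarrow> 'a set \<Rightarrow> ('a \<times> 'a) set" where
  "alg_congruence A I =
     {(x, y). x \<in> alg_carrier A \<and> y \<in> alg_carrier A \<and> alg_diff A x y \<in> I}"

definition quotient_alg ::
  "('k::field, 'a) kalgebra \<Rightarrow> 'a set \<Rightarrow> ('k, 'a set) kalgebra" where
  "quotient_alg A I = (let r = alg_congruence A I in
     \<lparr>alg_carrier = alg_carrier A // r,
      alg_zero = r `` {alg_zero A},
      alg_add = (\<lambda>X Y. \<Union>x\<in>X. \<Union>y\<in>Y. r `` {alg_add A x y}),
      alg_smult = (\<lambda>c X. \<Union>x\<in>X. r `` {alg_smult A c x}),
      alg_mult = (\<lambda>X Y. \<Union>x\<in>X. \<Union>y\<in>Y. r `` {alg_mult A x y})\<rparr>)"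

definition alg_isomorphic ::
  "('k::field, 'a) kalgebra \<Rightarrow> ('k, 'b) kalgebra \<Rightarrow> bool" where
  "alg_isomorphic A B \<longleftrightarrow> (\<exists>\<phi>. bij_betw \<phi> (alg_carrier A) (alg_carrier B) \<and>
     (\<forall>x\<in>alg_carrier A. \<forall>y\<in>alg_carrier A.
        \<phi> (alg_add A x y) = alg_add B (\<phi> x) (\<phi> y) \<and>
        \<phi> (alg_mult A x y) = alg_mult B (\<phi> x) (\<phi> y)) \<and>
     (\<forall>c. \<forall>x\<in>alg_carrier A. \<phi> (alg_smult A c x) = alg_smult B c (\<phi> x)))"

section \<open>Free non-unital algebras\<close>

datatype 'x free_mon = Free_Mon (letters: "'x list")

text \<open>
  Words form a monoid, written additively because the convolution product on
  \<^typ>\<open>'w \<Rightarrow>\<^sub>0 'k\<close> requires this: \<open>0\<close> is the empty word and \<open>+\<close> is concatenation.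
  Thus \<^typ>\<open>'x free_mon \<Rightarrow>\<^sub>0 'k\<close> is the free unital algebra on \<open>'x\<close>.
\<close>

instantiation free_mon :: (type) monoid_add
begin

definition zero_free_mon :: "'a free_mon" where
  "0 = Free_Mon []"

definition plus_free_mon :: "'a free_mon \<Rightarrow> 'a free_mon \<Rightarrow> 'a free_mon" where
  "u + w = Free_Mon (letters u @ letters w)"

instance
  by standard (simp_all add: zero_free_mon_def plus_free_mon_def)

end

text \<open>
  The free non-unital associative algebra on a set of generators consists of the combinations of
  non-empty words. Multiplication by \<open>Poly_Mapping.single 0 c\<close> is multiplication by the scalar
  \<open>c\<close>.
\<close>

definition free_alg :: "'x set \<Rightarrow> ('k::field, 'x free_mon \<Rightarrow>\<^sub>0 'k) kalgebra" where
  "free_alg X =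
     \<lparr>alg_carrier = {f. \<forall>w\<in>Poly_Mapping.keys f. w \<noteq> 0 \<and> set (letters w) \<subseteq> X},
      alg_zero = 0,
      alg_add = (+),
      alg_smult = (\<lambda>c f. Poly_Mapping.single 0 c * f),
      alg_mult = (*)\<rparr>"

definition free_gen :: "'x \<Rightarrow> 'x free_mon \<Rightarrow>\<^sub>0 'k::field" where
  "free_gen x = Poly_Mapping.single (Free_Mon [x]) 1"

section \<open>Lie algebras\<close>

definition lie_algebra :: "('k::field, 'a) kalgebra \<Rightarrow> bool" where
  "lie_algebra L \<longleftrightarrow>
     alg_subspace L (alg_carrier L) \<and>
     (\<forall>x\<in>alg_carrier L. \<forall>y\<in>alg_carrier L. alg_mult L x y \<in> alg_carrier L) \<and>
     (\<forall>x\<in>alg_carrier L. \<forall>y\<in>alg_carrier L. \<forall>z\<in>alg_carrier L.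
        alg_add L (alg_add L x y) z = alg_add L x (alg_add L y z) \<and>
        alg_mult L (alg_add L x y) z = alg_add L (alg_mult L x z) (alg_mult L y z) \<and>
        alg_mult L z (alg_add L x y) = alg_add L (alg_mult L z x) (alg_mult L z y) \<and>
        alg_add L (alg_mult L x (alg_mult L y z))
          (alg_add L (alg_mult L y (alg_mult L z x)) (alg_mult L z (alg_mult L x y)))
        = alg_zero L) \<and>
     (\<forall>x\<in>alg_carrier L. \<forall>y\<in>alg_carrier L. alg_add L x y = alg_add L y x) \<and>
     (\<forall>x\<in>alg_carrier L. alg_add L (alg_zero L) x = x \<and> alg_diff L x x = alg_zero L \<and>
        alg_smult L 1 x = x \<and> alg_mult L x x = alg_zero L) \<and>
     (\<forall>c d. \<forall>x\<in>alg_carrier L.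
        alg_smult L (c + d) x = alg_add L (alg_smult L c x) (alg_smult L d x) \<and>
        alg_smult L (c * d) x = alg_smult L c (alg_smult L d x)) \<and>
     (\<forall>c. \<forall>x\<in>alg_carrier L. \<forall>y\<in>alg_carrier L.
        alg_smult L c (alg_add L x y) = alg_add L (alg_smult L c x) (alg_smult L c y) \<and>
        alg_mult L (alg_smult L c x) y = alg_smult L c (alg_mult L x y) \<and>
        alg_mult L x (alg_smult L c y) = alg_smult L c (alg_mult L x y))"

text \<open>The Lie algebra \<open>A\<^sup>-\<close> with bracket \<open>ab - ba\<close>.\<close>

definition minus_lie :: "('k::field, 'a) kalgebra \<Rightarrow> ('k, 'a) kalgebra" where
  "minus_lie A = A\<lparr>alg_mult := (\<lambda>a b. alg_diff A (alg_mult A a b) (alg_mult A b a))\<rparr>"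

definition lie_subalgebra :: "('k::field, 'a) kalgebra \<Rightarrow> 'a set \<Rightarrow> bool" where
  "lie_subalgebra L S \<longleftrightarrow> alg_subspace L S \<and> (\<forall>x\<in>S. \<forall>y\<in>S. alg_mult L x y \<in> S)"

text \<open>A Lie ideal of an associative algebra \<open>A\<close> is a \<open>lie_ideal\<close> of \<open>minus_lie A\<close>.\<close>

definition lie_ideal :: "('k::field, 'a) kalgebra \<Rightarrow> 'a set \<Rightarrow> bool" where
  "lie_ideal L U \<longleftrightarrow>
     alg_subspace L U \<and> (\<forall>u\<in>U. \<forall>x\<in>alg_carrier L. alg_mult L u x \<in> U)"

definition lie_derived :: "('k::field, 'a) kalgebra \<Rightarrow> 'a set \<Rightarrow> 'a set" where
  "lie_derived L S = alg_span L {alg_mult L x y |x y. x \<in> S \<and> y \<in> S}"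

definition lie_solvable :: "('k::field, 'a) kalgebra \<Rightarrow> 'a set \<Rightarrow> bool" where
  "lie_solvable L S \<longleftrightarrow> (\<exists>n. (lie_derived L ^^ n) S = {alg_zero L})"

definition lie_locally_finite :: "('k::field, 'a) kalgebra \<Rightarrow> bool" where
  "lie_locally_finite L \<longleftrightarrow>
     (\<forall>X. finite X \<and> X \<subseteq> alg_carrier L \<longrightarrow>
        (\<exists>S. lie_subalgebra L S \<and> alg_fin_dim L S \<and> X \<subseteq> S))"

definition lie_locally_solvable :: "('k::field, 'a) kalgebra \<Rightarrow> 'a set \<Rightarrow> bool" where
  "lie_locally_solvable L S \<longleftrightarrow>
     (\<forall>T. lie_subalgebra L T \<and> alg_fin_dim L T \<and> T \<subseteq> S \<longrightarrow> lie_solvable L T)"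

text \<open>
  The sum of all locally solvable ideals. In a locally finite Lie algebra it is the unique maximal
  locally solvable ideal.
\<close>

definition locally_solvable_radical :: "('k::field, 'a) kalgebra \<Rightarrow> 'a set" where
  "locally_solvable_radical L = alg_span L (\<Union>{J. lie_ideal L J \<and> lie_locally_solvable L J})"

definition one_dim_abelian_lie :: "('k::field, 'k) kalgebra" where
  "one_dim_abelian_lie =
     \<lparr>alg_carrier = UNIV, alg_zero = 0, alg_add = (+), alg_smult = (*), alg_mult = (\<lambda>_ _. 0)\<rparr>"

section \<open>Directed graphs\<close>

text \<open>
  Vertices and edges are \<open>verts\<close> and \<open>arcs\<close>, the source and range maps are \<open>tail\<close> and \<open>head\<close>.
  Paths from \<open>u\<close> to \<open>v\<close> are the lists \<open>p\<close> with \<open>awalk u p v\<close>, where the empty list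
  stands for the path of length 0 at \<open>u = v\<close>.
\<close>

definition infinite_emitter :: "('v, 'e) pre_digraph \<Rightarrow> 'v \<Rightarrow> bool" where
  "infinite_emitter G v \<longleftrightarrow> infinite (out_arcs G v)"

definition source_vertex :: "('v, 'e) pre_digraph \<Rightarrow> 'v \<Rightarrow> bool" where
  "source_vertex G v \<longleftrightarrow> in_arcs G v = {}"

definition isolated_vertex :: "('v, 'e) pre_digraph \<Rightarrow> 'v \<Rightarrow> bool" where
  "isolated_vertex G v \<longleftrightarrow> in_arcs G v = {} \<and> out_arcs G v = {}"

definition regular_verts :: "('v, 'e) pre_digraph \<Rightarrow> 'v set" where
  "regular_verts G = {v \<in> verts G. out_arcs G v \<noteq> {} \<and> \<not> infinite_emitter G v}"

definition acyclic_graph :: "('v, 'e) pre_digraph \<Rightarrow> bool" where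
  "acyclic_graph G \<longleftrightarrow> \<not> (\<exists>u p. pre_digraph.awalk G u p u \<and> length p \<ge> 1)"

definition hereditary :: "('v, 'e) pre_digraph \<Rightarrow> 'v set \<Rightarrow> bool" where
  "hereditary G H \<longleftrightarrow>
     H \<subseteq> verts G \<and> (\<forall>u\<in>H. \<forall>v p. pre_digraph.awalk G u p v \<longrightarrow> v \<in> H)"

definition saturated :: "('v, 'e) pre_digraph \<Rightarrow> 'v set \<Rightarrow> bool" where
  "saturated G H \<longleftrightarrow> (\<forall>v\<in>regular_verts G. head G ` out_arcs G v \<subseteq> H \<longrightarrow> v \<in> H)"

definition path_dist :: "('v, 'e) pre_digraph \<Rightarrow> 'v \<Rightarrow> 'v \<Rightarrow> enat" where
  "path_dist G u v = (INF p\<in>{p. pre_digraph.awalk G u p v}. enat (length p))"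

definition dist_ball :: "('v, 'e) pre_digraph \<Rightarrow> 'v \<Rightarrow> nat \<Rightarrow> 'v set" where
  "dist_ball G u m = {v \<in> verts G. path_dist G u v \<le> enat m}"

definition inner_paths :: "('v, 'e) pre_digraph \<Rightarrow> 'v \<Rightarrow> nat \<Rightarrow> 'v \<Rightarrow> 'e list set" where
  "inner_paths G u m w =
     {q. pre_digraph.awalk G u q w \<and> (\<forall>e\<in>set (tl q). tail G e \<in> dist_ball G u m)}"

text \<open>
  Conditions (a) and (b) already force \<open>inner_paths G u m w\<close> to be finite. Finiteness is stated
  because \<open>card\<close> is 0 on infinite sets.
\<close>

definition p_commutator_graph :: "nat \<Rightarrow> ('v, 'e) pre_digraph \<Rightarrow> bool" where
  "p_commutator_graph p G \<longleftrightarrow>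
     acyclic_graph G \<and>
     verts G \<subseteq> regular_verts G \<and>
     (\<forall>u\<in>verts G. \<exists>m. \<forall>w\<in>verts G. path_dist G u w = enat (m + 1) \<longrightarrow>
        finite (inner_paths G u m w) \<and> p dvd card (inner_paths G u m w))"

text \<open>
  The porcupine graph \<open>P\<^sub>H\<close> for \<open>E\<^sup>0 = H \<squnion> {v}\<close>. The left summands are the vertices and edges
  inherited from \<open>E\<close>. For an edge \<open>e\<close> starting at \<open>v\<close>, the new vertex \<open>w\<^sup>e\<close> and the new edge
  \<open>f\<^sup>e\<close> are both represented by \<open>Inr e\<close>.
\<close>

definition porcupine ::
  "('v, 'e) pre_digraph \<Rightarrow> 'v set \<Rightarrow> 'v \<Rightarrow> ('v + 'e, 'e + 'e) pre_digraph" where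
  "porcupine E H v =
     \<lparr>verts = Inl ` H \<union> Inr ` out_arcs E v,
      arcs = Inl ` {e \<in> arcs E. tail E e \<in> H} \<union> Inr ` out_arcs E v,
      tail = case_sum (\<lambda>e. Inl (tail E e)) Inr,
      head = case_sum (\<lambda>e. Inl (head E e)) (\<lambda>e. Inl (head E e))\<rparr>"

section \<open>Leavitt path algebras\<close>

datatype ('v, 'e) lpa_gen = Vertex 'v | Edge 'e | Ghost 'e

definition lpa_gens :: "('v, 'e) pre_digraph \<Rightarrow> ('v, 'e) lpa_gen set" where
  "lpa_gens E = Vertex ` verts E \<union> Edge ` arcs E \<union> Ghost ` arcs E"

text \<open>Each relation \<open>x = y\<close> is encoded as the element \<open>x - y\<close> of the free algebra.\<close>

definition lpa_relations ::
  "('v, 'e) pre_digraph \<Rightarrow> (('v, 'e) lpa_gen free_mon \<Rightarrow>\<^sub>0 'k::field) set" where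
  "lpa_relations E = (let V = (\<lambda>v. free_gen (Vertex v)); X = (\<lambda>e. free_gen (Edge e));
       Y = (\<lambda>e. free_gen (Ghost e)); s = tail E; r = head E in
     {V v * V v' - (if v = v' then V v else 0) |v v'. v \<in> verts E \<and> v' \<in> verts E} \<union>
     {V (s e) * X e - X e |e. e \<in> arcs E} \<union>
     {X e * V (r e) - X e |e. e \<in> arcs E} \<union>
     {V (r e) * Y e - Y e |e. e \<in> arcs E} \<union>
     {Y e * V (s e) - Y e |e. e \<in> arcs E} \<union>
     {Y e * X f - (if e = f then V (r e) else 0) |e f. e \<in> arcs E \<and> f \<in> arcs E} \<union>
     {V v - (\<Sum>e\<in>out_arcs E v. X e * Y e) |v. v \<in> regular_verts E})"

type_synonym ('v, 'e, 'k) lpa = "('k, (('v, 'e) lpa_gen free_mon \<Rightarrow>\<^sub>0 'k) set) kalgebra"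

definition leavitt_path_algebra :: "('v, 'e) pre_digraph \<Rightarrow> ('v, 'e, 'k::field) lpa" where
  "leavitt_path_algebra E = quotient_alg (free_alg (lpa_gens E))
     (generated_alg_ideal (free_alg (lpa_gens E)) (lpa_relations E))"

section \<open>The three types of graphs in the classification\<close>

definition graph_type1 :: "nat \<Rightarrow> ('v, 'e) pre_digraph \<Rightarrow> bool" where
  "graph_type1 p E \<longleftrightarrow> p_commutator_graph p E"

definition graph_type2 :: "nat \<Rightarrow> ('v, 'e) pre_digraph \<Rightarrow> bool" where
  "graph_type2 p E \<longleftrightarrow>
     (\<exists>v\<in>verts E. isolated_vertex E v \<and> p_commutator_graph p (pre_digraph.del_vert E v))"

definition graph_type3 :: "nat \<Rightarrow> ('v, 'e) pre_digraph \<Rightarrow> bool" where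
  "graph_type3 p E \<longleftrightarrow>
     (\<exists>H v. verts E = H \<union> {v} \<and> v \<notin> H \<and> H \<noteq> {} \<and> hereditary E H \<and> saturated E H \<and>
        p_commutator_graph p (porcupine E H v) \<and>
        infinite_emitter E v \<and> (\<forall>u\<in>verts E. infinite_emitter E u \<longrightarrow> u = v) \<and>
        source_vertex E v)"

end

theory Submission
  imports Defs
begin

text \<open>
  Write \<open>L\<close> for the Leavitt path algebra. Every subspace between \<open>[L, L]\<close> and \<open>L\<close> is a Lie ideal, hence
  an ideal. As the vertices are orthogonal idempotents, this forces all but at most one vertex to lie
  in \<open>[L, L]\<close>, which then has codimension at most one. The trace \<open>qtq\<^sup>* \<mapsto> t\<close>, where \<open>t\<close> is a closed path,
  shows first that \<open>E\<close> is acyclic, and then that each vertex \<open>u \<in> [L, L]\<close> satisfies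
  \<open>\<epsilon>\<^sub>u = \<Sum> c\<^sub>v B\<^sub>v\<close> for finitely many regular \<open>v\<close>, with \<open>B\<^sub>v\<close> encoding the relation
  \<open>v = \<Sum> ee\<^sup>*\<close>. The coefficients \<open>-c\<^sub>v\<close> are the numbers of paths from \<open>u\<close> to \<open>v\<close> modulo the
  characteristic, so that the path counts outside a large ball around \<open>u\<close> vanish; this is the condition on
  a \<open>p\<close>-commutator graph. A vertex outside \<open>[L, L]\<close> is a source and not regular, so it is isolated or
  an infinite emitter, and only the vertices in \<open>[L, L]\<close> matter for the porcupine graph.

  For the radical, a nonzero Lie ideal is an ideal; unless it is spanned by an isolated vertex, it contains
  a regular vertex \<open>u\<close>. There are three distinct paths from \<open>u\<close> to a common vertex, and they yield a
  perfect Lie algebra of \<open>3 \<times> 3\<close> matrices inside the ideal.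
\<close>

section \<open>Counting paths in acyclic graphs\<close>

text \<open>The relation \<open>v = \<Sum> ee^*\<close> destroys the uniqueness of the monomials
  \<open>pq^*\<close>, and no basis of \<open>L\<close> is used. Computations are made with words in
  the free algebra, and elements are shown to be nonzero by linear functionals on words that respect
  the relations: the trace, well defined modulo the span of the vectors \<open>B_v\<close>, and the
  matrix entries of the action on infinite paths. The two complement each other, since infinite
  paths detect the regular vertices, whereas an isolated vertex is detected by the trace. Matrices
  of size three are chosen because in characteristic 2 the Lie algebra of matrices of size two is
  solvable. An infinite emitter satisfies no sum relation, so the induction that shortens the ghost
  parts of elements of an ideal cannot pass through it. It is treated with the elements
  \<open>v - \<Sum> ee^*\<close> over growing finite sets of edges.\<close>

text \<open>
  The span of the vectors \<open>B\<^sub>v = (\<Sum>e\<in>s\<^sup>-\<^sup>1(v). \<epsilon>\<^bsub>r(e)\<^esub>) - \<epsilon>\<^sub>v\<close> for regular \<open>v\<close>. Modulo this span the map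
  \<open>pq\<^sup>* \<mapsto> \<delta>\<^sub>p\<^sub>q \<epsilon>\<^bsub>r(p)\<^esub>\<close> is a well-defined trace on the Leavitt path algebra.
\<close>

definition cuntz_krieger_span :: "('v, 'e) pre_digraph \<Rightarrow> ('v \<Rightarrow> 'k::field) set" where
  "cuntz_krieger_span G = {h. \<exists>S c. finite S \<and> S \<subseteq> regular_verts G \<and> (\<forall>v. v \<notin> S \<longrightarrow> c v = 0) \<and>
     (\<forall>x. h x = (\<Sum>e\<in>{e \<in> arcs G. tail G e \<in> S \<and> head G e = x}. c (tail G e)) - c x)}"

abbreviation unit_fun :: "'v \<Rightarrow> 'v \<Rightarrow> 'k::field" where
  "unit_fun u \<equiv> (\<lambda>x. if x = u then 1 else 0)"

lemma regular_finite_out_arcs: "v \<in> regular_verts G \<Longrightarrow> finite (out_arcs G v)"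
  by (simp add: regular_verts_def infinite_emitter_def)

lemma finite_arcs_from:
  assumes "finite S" "S \<inter> verts G \<subseteq> regular_verts G" "wf_digraph G"
  shows "finite {e \<in> arcs G. tail G e \<in> S}"
proof -
  interpret wf_digraph G by fact
  have "{e \<in> arcs G. tail G e \<in> S} = (\<Union>v\<in>S \<inter> verts G. out_arcs G v)"
    by (auto simp: out_arcs_def)
  moreover have "finite (\<Union>v\<in>S \<inter> verts G. out_arcs G v)"
    using assms by (auto intro!: finite_UN_I regular_finite_out_arcs)
  ultimately show ?thesis by simp
qed

text \<open>Brings two representations to the common support \<open>S \<union> S'\<close>, on which
  they can be added termwise.\<close>

lemma cuntz_krieger_span_subset_sum:
  assumes "wf_digraph G" "finite S'" "S \<subseteq> S'" "S' \<subseteq> regular_verts G" "\<forall>v. v \<notin> S \<longrightarrow> c v = (0::'k::field)"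
  shows "(\<Sum>e\<in>{e \<in> arcs G. tail G e \<in> S' \<and> head G e = x}. c (tail G e)) =
    (\<Sum>e\<in>{e \<in> arcs G. tail G e \<in> S \<and> head G e = x}. c (tail G e))"
proof (rule sum.mono_neutral_right)
  show "finite {e \<in> arcs G. tail G e \<in> S' \<and> head G e = x}"
    by (rule finite_subset[OF _ finite_arcs_from[of S' G]]) (use assms in auto)
qed (use assms in auto)

lemma cuntz_krieger_span_add:
  assumes "wf_digraph G" "f \<in> cuntz_krieger_span G" "g \<in> cuntz_krieger_span G"
  shows "(\<lambda>x. f x + g x) \<in> (cuntz_krieger_span G :: ('v \<Rightarrow> 'k::field) set)"
proof -
  obtain S c where 1: "finite S" "S \<subseteq> regular_verts G" "\<forall>v. v \<notin> S \<longrightarrow> c v = 0"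
    "\<And>x. f x = (\<Sum>e\<in>{e \<in> arcs G. tail G e \<in> S \<and> head G e = x}. c (tail G e)) - c x"
    using assms(2) unfolding cuntz_krieger_span_def by blast
  obtain S' c' where 2: "finite S'" "S' \<subseteq> regular_verts G" "\<forall>v. v \<notin> S' \<longrightarrow> c' v = 0"
    "\<And>x. g x = (\<Sum>e\<in>{e \<in> arcs G. tail G e \<in> S' \<and> head G e = x}. c' (tail G e)) - c' x"
    using assms(3) unfolding cuntz_krieger_span_def by blast
  have "f x + g x = (\<Sum>e\<in>{e \<in> arcs G. tail G e \<in> S \<union> S' \<and> head G e = x}. c (tail G e) + c' (tail G e)) - (c x + c' x)" for x
    using cuntz_krieger_span_subset_sum[OF assms(1), of "S \<union> S'" S c x]
      cuntz_krieger_span_subset_sum[OF assms(1), of "S \<union> S'" S' c' x] 1 2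
    by (simp add: sum.distrib del: Un_iff)
  then show ?thesis unfolding cuntz_krieger_span_def
    using 1 2 by (auto intro!: exI[of _ "S \<union> S'"] exI[of _ "\<lambda>x. c x + c' x"])
qed

lemma cuntz_krieger_span_scale:
  assumes "f \<in> cuntz_krieger_span G"
  shows "(\<lambda>x. k * f x) \<in> (cuntz_krieger_span G :: ('v \<Rightarrow> 'k::field) set)"
proof -
  obtain S c where 1: "finite S" "S \<subseteq> regular_verts G" "\<forall>v. v \<notin> S \<longrightarrow> c v = 0"
    "\<And>x. f x = (\<Sum>e\<in>{e \<in> arcs G. tail G e \<in> S \<and> head G e = x}. c (tail G e)) - c x"
    using assms unfolding cuntz_krieger_span_def by blast
  then show ?thesis unfolding cuntz_krieger_span_def
    by (auto intro!: exI[of _ S] exI[of _ "\<lambda>x. k * c x"] simp: right_diff_distrib sum_distrib_left)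
qed

lemma cuntz_krieger_span_zero: "(\<lambda>x. 0) \<in> cuntz_krieger_span G"
  unfolding cuntz_krieger_span_def by (auto intro!: exI[of _ "{}"] exI[of _ "\<lambda>x. 0"])

lemma cuntz_krieger_span_generator:
  fixes G :: "('v, 'e) pre_digraph"
  assumes "v \<in> regular_verts G"
  shows "(\<lambda>x. unit_fun v x - (\<Sum>e\<in>out_arcs G v. unit_fun (head G e) x)) \<in> (cuntz_krieger_span G :: ('v \<Rightarrow> 'k::field) set)"
proof -
  have *: "{e \<in> arcs G. tail G e \<in> {v} \<and> head G e = x} = {e \<in> out_arcs G v. x = head G e}" for x
    by (auto simp: out_arcs_def)
  have "(\<Sum>e\<in>out_arcs G v. unit_fun (head G e) x) =
     (\<Sum>e\<in>{e \<in> out_arcs G v. x = head G e}. (1::'k))" for x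
    using regular_finite_out_arcs[OF assms] by (rule sum.inter_filter[symmetric])
  moreover have "(\<Sum>e\<in>{e \<in> arcs G. tail G e \<in> {v} \<and> head G e = x}. (if tail G e = v then - 1 else 0)) =
      - (\<Sum>e\<in>{e \<in> out_arcs G v. x = head G e}. (1::'k))" for x
    unfolding * sum_negf[symmetric] by (rule sum.cong) auto
  \<comment> \<open>The vector in the statement is \<open>-B_v\<close>, hence the coefficient
    \<open>-1\<close> on the support \<open>{v}\<close>.\<close>
  ultimately show ?thesis unfolding cuntz_krieger_span_def
    by (intro CollectI exI[of _ "{v}"] exI[of _ "\<lambda>x. if x = v then - 1 else 0"])
      (use assms in \<open>simp only: finite.intros, auto\<close>)
qed

section \<open>Acyclic graphs: descent along edges and recursions for path counts\<close>

context wf_digraph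
begin

lemma awalk_append_ex: "awalk u (p @ q) w \<longleftrightarrow> (\<exists>v. awalk u p v \<and> awalk v q w)"
  by (metis awalk_append_iff awalk_appendI)

declare awalk_append_iff [simp del] awalkE' [rule del]

lemma awalk_target_unique: "awalk u p v \<Longrightarrow> awalk u p w \<Longrightarrow> v = w"
  using awalk_ends by blast

text \<open>Makes the well-foundedness of finite acyclic relations available, and lets acyclicity be
  transferred to the graphs obtained by deletion and by the porcupine construction.\<close>

lemma acyclic_graph_iff: "acyclic_graph G \<longleftrightarrow> acyclic (arcs_ends G)"
  unfolding acyclic_graph_def acyclic_def
  by (metis One_nat_def Suc_leI length_greater_0_conv less_eq_Suc_le reachable1_awalk)

lemma acyclic_closed_awalk: "acyclic_graph G \<Longrightarrow> awalk u p u \<Longrightarrow> p = []"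
  unfolding acyclic_graph_def by (cases p) fastforce+

lemma acyclic_awalk_distinct:
  assumes "acyclic_graph G" "awalk u p v"
  shows "distinct p"
  using assms(2)
proof (induction p arbitrary: u)
  case (Cons e es)
  have "e \<notin> set es"
  proof
    assume "e \<in> set es"
    then obtain xs ys where "es = xs @ e # ys" by (meson split_list)
    then have "awalk (tail G e) (e # xs) (tail G e)"
      using Cons.prems by (auto simp: awalk_Cons_iff awalk_append_ex)
    then show False using acyclic_closed_awalk assms(1) by blast
  qed
  then show ?case using Cons by (auto simp: awalk_Cons_iff)
qed auto

lemma acyclic_finite_awalks:
  assumes "acyclic_graph G" "finite A"
  shows "finite {p. set p \<subseteq> A \<and> (\<exists>u v. awalk u p v)}"
  by (rule finite_subset[OF _ finite_subset_distinct[OF assms(2)]])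
    (use acyclic_awalk_distinct[OF assms(1)] in auto)

text \<open>The edges of \<open>A\<close> form a finite acyclic, hence well-founded relation, and a
  minimal element of \<open>Z\<close> would have no predecessor in \<open>Z\<close>. Typically
  \<open>Z\<close> is the set where a solution of a recursion over the last edge does not
  vanish.\<close>

lemma acyclic_backward_empty:
  assumes "acyclic_graph G" "finite A" "A \<subseteq> arcs G" "\<And>w. w \<in> Z \<Longrightarrow> \<exists>e\<in>A. head G e = w \<and> tail G e \<in> Z"
  shows "Z = {}"
proof (rule ccontr)
  assume "Z \<noteq> {}"
  let ?r = "(\<lambda>e. (tail G e, head G e)) ` A"
  have "?r \<subseteq> arcs_ends G" using assms(3) by (auto simp: arcs_ends_def arc_to_ends_def)
  then have "wf ?r"
    using assms acyclic_graph_iff by (intro finite_acyclic_wf) (auto intro: acyclic_subset)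
  moreover obtain z0 where "z0 \<in> Z" using \<open>Z \<noteq> {}\<close> by blast
  ultimately obtain z where "z \<in> Z" "\<And>y. (y, z) \<in> ?r \<Longrightarrow> y \<notin> Z" by (rule wfE_min) blast
  then show False using assms(4)[of z] by force
qed

text \<open>The same argument for the converse relation. It yields a vertex of a finite ball from
  which every edge leaves the ball.\<close>

lemma acyclic_forward_empty:
  assumes "acyclic_graph G" "finite A" "A \<subseteq> arcs G" "\<And>w. w \<in> Z \<Longrightarrow> \<exists>e\<in>A. tail G e = w \<and> head G e \<in> Z"
  shows "Z = {}"
proof (rule ccontr)
  assume "Z \<noteq> {}"
  let ?r = "(\<lambda>e. (tail G e, head G e)) ` A"
  have "?r \<subseteq> arcs_ends G" using assms(3) by (auto simp: arcs_ends_def arc_to_ends_def)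
  then have "wf (?r\<inverse>)"
    using assms acyclic_graph_iff by (intro finite_acyclic_wf_converse) (auto intro: acyclic_subset)
  moreover obtain z0 where "z0 \<in> Z" using \<open>Z \<noteq> {}\<close> by blast
  ultimately obtain z where "z \<in> Z" "\<And>y. (y, z) \<in> ?r\<inverse> \<Longrightarrow> y \<notin> Z" by (rule wfE_min) blast
  then show False using assms(4)[of z] by force
qed

text \<open>\<open>t\<close> is a closed path at \<open>w\<close>. Thus distinct parallel paths are
  never prefixes of each other, which later makes their monomials orthogonal.\<close>

lemma acyclic_parallel_awalks:
  assumes "acyclic_graph G" "awalk u p w" "awalk u (p @ t) w"
  shows "t = []"
  using assms awalk_append_ex awalk_target_unique acyclic_closed_awalk by metis

text \<open>Unlike in \<open>inner_paths\<close>, the source of the first edge is restricted too.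
  This makes the recursion over the last edge uniform and changes nothing when \<open>u\<close> lies
  in \<open>D\<close>.\<close>

definition paths_within :: "'a set \<Rightarrow> 'a \<Rightarrow> 'a \<Rightarrow> 'b list set" where
  "paths_within D u w = {q. awalk u q w \<and> (\<forall>e\<in>set q. tail G e \<in> D)}"

lemma paths_within_rec:
  assumes "u \<in> verts G"
  shows "paths_within D u w = (if w = u then {[]} else {}) \<union>
    (\<Union>e\<in>{e \<in> arcs G. tail G e \<in> D \<and> head G e = w}. (\<lambda>q. q @ [e]) ` paths_within D u (tail G e))"
    (is "?L = ?R")
proof
  show "?L \<subseteq> ?R"
  proof
    fix q assume "q \<in> ?L"
    then show "q \<in> ?R"
      by (cases q rule: rev_cases)
        (auto simp: paths_within_def awalk_append_ex awalk_simps)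
  qed
  show "?R \<subseteq> ?L" using assms
    by (auto simp: paths_within_def awalk_append_ex awalk_simps split: if_splits)
qed

lemma finite_paths_within:
  assumes "acyclic_graph G" "finite {e \<in> arcs G. tail G e \<in> D}"
  shows "finite (paths_within D u w)"
  by (rule finite_subset[OF _ acyclic_finite_awalks[OF assms]])
    (auto simp: paths_within_def awalk_def)

lemma card_paths_within_rec:
  assumes "acyclic_graph G" "finite {e \<in> arcs G. tail G e \<in> D}" "u \<in> verts G"
  shows "card (paths_within D u w) = (if w = u then 1 else 0) +
    (\<Sum>e\<in>{e \<in> arcs G. tail G e \<in> D \<and> head G e = w}. card (paths_within D u (tail G e)))"
proof -
  let ?A = "{e \<in> arcs G. tail G e \<in> D \<and> head G e = w}"
  let ?X = "(\<Union>e\<in>?A. (\<lambda>q. q @ [e]) ` paths_within D u (tail G e))"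
  have fin: "finite ?A" using assms(2) by (rule rev_finite_subset) auto
  have "card ?X = (\<Sum>e\<in>?A. card ((\<lambda>q. q @ [e]) ` paths_within D u (tail G e)))"
    using fin finite_paths_within[OF assms(1,2)] by (intro card_UN_disjoint) auto
  also have "\<dots> = (\<Sum>e\<in>?A. card (paths_within D u (tail G e)))"
    by (intro sum.cong refl card_image) (auto simp: inj_on_def)
  finally have X: "card ?X = \<dots>" .
  have "finite ?X" using fin finite_paths_within[OF assms(1,2)] by auto
  then have "card ((if w = u then {[]} else {}) \<union> ?X) = card (if w = u then {[]::'b list} else {}) + card ?X"
    by (intro card_Un_disjoint) auto
  then show ?thesis using X paths_within_rec[OF assms(3), of D w] by simp
qed

text \<open>Both the path counts and the negated coefficients of a representation of \<open>\<epsilon>\<^sub>u\<close> satisfy the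
  recursion over the last edge, whose solution is unique.\<close>

lemma of_nat_card_paths_within:
  fixes c :: "'a \<Rightarrow> 'k::field"
  assumes ac: "acyclic_graph G" and u: "u \<in> verts G"
    and S: "S \<subseteq> regular_verts G" "finite S" "\<forall>v. v \<notin> S \<longrightarrow> c v = 0"
    and c: "\<And>x. unit_fun u x = (\<Sum>e\<in>{e \<in> arcs G. tail G e \<in> S \<and> head G e = x}. c (tail G e)) - c x"
    and D: "finite {e \<in> arcs G. tail G e \<in> D}" "{v \<in> S. c v \<noteq> 0} \<subseteq> D"
  shows "of_nat (card (paths_within D u w)) = - c w"
proof -
  \<comment> \<open>The terms \<open>unit_fun u\<close> of the two recursions cancel in the sum, so
    \<open>d\<close> satisfies the homogeneous recursion, and a vertex where \<open>d\<close> does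
    not vanish has a predecessor of the same kind.\<close>
  define d where "d w = of_nat (card (paths_within D u w)) + c w" for w
  let ?A = "{e \<in> arcs G. tail G e \<in> D}"
  have rec: "d w = (\<Sum>e\<in>{e \<in> ?A. head G e = w}. d (tail G e))" for w
  proof -
    \<comment> \<open>\<open>S\<close> and \<open>D\<close> are related only through the support of
      \<open>c\<close>, so the index set is changed in two stages: it is shrunk to the support, then
      enlarged to \<open>D\<close>.\<close>
    have "(\<Sum>e\<in>{e \<in> arcs G. tail G e \<in> S \<and> head G e = w}. c (tail G e)) =
        (\<Sum>e\<in>{e \<in> arcs G. tail G e \<in> {v \<in> S. c v \<noteq> 0} \<and> head G e = w}. c (tail G e))"
    proof (rule sum.mono_neutral_right)
      show "finite {e \<in> arcs G. tail G e \<in> S \<and> head G e = w}"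
        by (rule rev_finite_subset[OF finite_arcs_from[of S G]]) (use S wf_digraph_axioms in auto)
    qed auto
    also have "\<dots> = (\<Sum>e\<in>{e \<in> ?A. head G e = w}. c (tail G e))"
    proof (rule sum.mono_neutral_left)
      show "finite {e \<in> ?A. head G e = w}" using D(1) by (rule rev_finite_subset) auto
    qed (use D S in auto)
    finally have "c w = (\<Sum>e\<in>{e \<in> ?A. head G e = w}. c (tail G e)) - unit_fun u w"
      using c[of w] by simp
    then show ?thesis unfolding d_def
      by (subst card_paths_within_rec[OF ac D(1) u])
        (auto simp: sum.distrib conj_assoc)
  qed
  have "{w. d w \<noteq> 0} = {}"
  proof (rule acyclic_backward_empty[OF ac D(1)])
    fix w assume "w \<in> {w. d w \<noteq> 0}"
    then have "(\<Sum>e\<in>{e \<in> ?A. head G e = w}. d (tail G e)) \<noteq> 0" using rec[of w] by simp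
    then obtain e where "e \<in> {e \<in> ?A. head G e = w}" "d (tail G e) \<noteq> 0" by (meson sum.neutral)
    then show "\<exists>e\<in>?A. head G e = w \<and> tail G e \<in> {w. d w \<noteq> 0}" by auto
  qed auto
  then have "d w = 0" by blast
  then show ?thesis by (simp add: d_def eq_neg_iff_add_eq_0)
qed

section \<open>Distance balls and unit functions in the span of the vectors
  \<open>B_v\<close>\<close>

lemma path_dist_le_iff: "path_dist G u v \<le> enat m \<longleftrightarrow> (\<exists>p. awalk u p v \<and> length p \<le> m)"
proof
  assume *: "path_dist G u v \<le> enat m"
  show "\<exists>p. awalk u p v \<and> length p \<le> m"
  proof (rule ccontr)
    assume "\<not> ?thesis"
    then have "enat (Suc m) \<le> path_dist G u v"
      unfolding path_dist_def by (intro INF_greatest) (auto simp: not_le Suc_le_eq)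
    with * have "enat (Suc m) \<le> enat m" by (rule order_trans[rotated])
    then show False by simp
  qed
next
  assume "\<exists>p. awalk u p v \<and> length p \<le> m"
  then obtain p where "awalk u p v" "length p \<le> m" by blast
  then show "path_dist G u v \<le> enat m"
    unfolding path_dist_def by (intro INF_lower2[of p]) auto
qed

lemma dist_ball_iff: "v \<in> dist_ball G u m \<longleftrightarrow> (\<exists>p. awalk u p v \<and> length p \<le> m)"
  unfolding dist_ball_def using path_dist_le_iff by (auto elim: awalkE')

lemma finite_dist_ball:
  assumes reg: "\<And>p w. awalk u p w \<Longrightarrow> w \<in> regular_verts G"
  shows "finite (dist_ball G u m)"
proof -
  have "finite {v. \<exists>p. awalk u p v \<and> length p = n}" for n
  proof (induction n)
    case 0
    show ?case by (rule finite_subset[of _ "{u}"]) (auto simp: awalk_simps)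
  next
    case (Suc n)
    have "{v. \<exists>p. awalk u p v \<and> length p = Suc n} \<subseteq>
      (\<Union>v\<in>{v. \<exists>p. awalk u p v \<and> length p = n}. head G ` out_arcs G v)"
    proof
      fix v assume "v \<in> {v. \<exists>p. awalk u p v \<and> length p = Suc n}"
      then obtain p where p: "awalk u p v" "length p = Suc n" by blast
      then obtain q e where "p = q @ [e]" by (cases p rule: rev_cases) auto
      with p show "v \<in> (\<Union>v\<in>{v. \<exists>p. awalk u p v \<and> length p = n}. head G ` out_arcs G v)"
        by (auto simp: awalk_append_ex awalk_simps out_arcs_def)
    qed
    then show ?case
      by (rule finite_subset) (auto intro!: finite_UN_I Suc regular_finite_out_arcs reg)
  qed
  then have "finite (\<Union>n\<le>m. {v. \<exists>p. awalk u p v \<and> length p = n})" by blast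
  moreover have "dist_ball G u m \<subseteq> (\<Union>n\<le>m. {v. \<exists>p. awalk u p v \<and> length p = n})"
    unfolding subset_iff dist_ball_iff by blast
  ultimately show ?thesis by (rule rev_finite_subset)
qed

lemma inner_paths_eq: "u \<in> verts G \<Longrightarrow> inner_paths G u m w = paths_within (dist_ball G u m) u w"
proof -
  assume "u \<in> verts G"
  then have "u \<in> dist_ball G u m" by (auto simp: dist_ball_iff awalk_Nil_iff intro!: exI[of _ "[]"])
  then show ?thesis
    unfolding inner_paths_def paths_within_def
  proof (intro Collect_cong conj_cong refl iffI subsetI ballI)
    fix q x assume q: "awalk u q w" "\<forall>e\<in>set (tl q). tail G e \<in> dist_ball G u m" "x \<in> set q"
    then show "tail G x \<in> dist_ball G u m"
      using \<open>u \<in> dist_ball G u m\<close> by (cases q) (auto simp: awalk_Cons_iff)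
  next
    fix q e assume "\<forall>e\<in>set q. tail G e \<in> dist_ball G u m" "e \<in> set (tl q)"
    then show "tail G e \<in> dist_ball G u m" by (cases q) auto
  qed
qed

text \<open>The equation at \<open>x \<noteq> u\<close> gives every such \<open>x\<close> in the
  support of \<open>c\<close> an incoming edge from the support; by descent the support is reachable
  from \<open>u\<close>. If \<open>u\<close> is not regular, then \<open>c u = 0\<close>, and the
  equation at \<open>u\<close> yields an edge from the support into \<open>u\<close>, hence a closed
  path. A ball containing the support has the path counts \<open>- c\<close>, which vanish outside
  it.\<close>

lemma unit_fun_span_regular:
  assumes ac: "acyclic_graph G" and u: "u \<in> verts G"
    and span: "(unit_fun u :: 'a \<Rightarrow> 'k::field) \<in> cuntz_krieger_span G"
  shows "u \<in> regular_verts G"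
    and "\<forall>p w. awalk u p w \<longrightarrow> w \<in> regular_verts G \<Longrightarrow>
      \<exists>m. \<forall>w. w \<notin> dist_ball G u m \<longrightarrow> finite (inner_paths G u m w) \<and>
        (of_nat (card (inner_paths G u m w)) :: 'k) = 0"
proof -
  obtain S and c :: "'a \<Rightarrow> 'k" where S: "finite S" "S \<subseteq> regular_verts G" "\<forall>v. v \<notin> S \<longrightarrow> c v = 0"
    and c: "\<And>x. unit_fun u x = (\<Sum>e\<in>{e \<in> arcs G. tail G e \<in> S \<and> head G e = x}. c (tail G e)) - c x"
    using span unfolding cuntz_krieger_span_def by blast
  let ?A = "{e \<in> arcs G. tail G e \<in> S}"
  have finA: "finite ?A" by (rule finite_arcs_from) (use S wf_digraph_axioms in auto)
  have step: "\<exists>e\<in>?A. head G e = x \<and> c (tail G e) \<noteq> 0" if "unit_fun u x + c x \<noteq> 0" for x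
  proof -
    have "(\<Sum>e\<in>{e \<in> arcs G. tail G e \<in> S \<and> head G e = x}. c (tail G e)) \<noteq> 0"
      using c[of x] that by simp
    then obtain e where "e \<in> {e \<in> arcs G. tail G e \<in> S \<and> head G e = x}" "c (tail G e) \<noteq> 0"
      by (meson sum.neutral)
    then show ?thesis by auto
  qed
  have "{v. c v \<noteq> 0 \<and> (\<nexists>p. awalk u p v)} = {}"
  proof (rule acyclic_backward_empty[OF ac finA])
    fix x assume x: "x \<in> {v. c v \<noteq> 0 \<and> (\<nexists>p. awalk u p v)}"
    then have "x \<noteq> u" using u by (auto simp: awalk_Nil_iff dest: spec[of _ "[]"])
    then obtain e where e: "e \<in> ?A" "head G e = x" "c (tail G e) \<noteq> 0" using step[of x] x by auto
    have "\<nexists>p. awalk u p (tail G e)"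
      using x e awalk_append_ex[of u _ "[e]" x] by (auto simp: awalk_simps)
    then show "\<exists>e\<in>?A. head G e = x \<and> tail G e \<in> {v. c v \<noteq> 0 \<and> (\<nexists>p. awalk u p v)}"
      using e by blast
  qed auto
  then have reach: "\<exists>p. awalk u p v" if "c v \<noteq> 0" for v using that by blast
  show "u \<in> regular_verts G"
  proof (rule ccontr)
    assume "u \<notin> regular_verts G"
    then have "c u = 0" using S by blast
    then obtain e where e: "e \<in> ?A" "head G e = u" "c (tail G e) \<noteq> 0" using step[of u] by auto
    then obtain p where "awalk u p (tail G e)" using reach by blast
    then have "awalk u (p @ [e]) u" using e by (auto simp: awalk_append_ex awalk_simps)
    then show False using acyclic_closed_awalk[OF ac] by blast
  qed
  assume "\<forall>p w. awalk u p w \<longrightarrow> w \<in> regular_verts G"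
  then have reg: "\<And>p w. awalk u p w \<Longrightarrow> w \<in> regular_verts G" by blast
  let ?T = "{v \<in> S. c v \<noteq> 0}"
  obtain P where P: "\<And>v. c v \<noteq> 0 \<Longrightarrow> awalk u (P v) v" using reach by metis
  \<comment> \<open>The ball of radius \<open>m\<close> contains the support;
    \<open>insert 0\<close> gives \<open>Max\<close> a nonempty set without further
    argument.\<close>
  define m where "m = Max (insert 0 ((\<lambda>v. length (P v)) ` ?T))"
  have T: "?T \<subseteq> dist_ball G u m"
  proof
    fix v assume v: "v \<in> ?T"
    then have "length (P v) \<le> m" unfolding m_def using S(1) by (intro Max_ge) auto
    then show "v \<in> dist_ball G u m" using P v by (auto simp: dist_ball_iff)
  qed
  have "dist_ball G u m \<subseteq> regular_verts G" using reg by (auto simp: dist_ball_iff)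
  then have D: "finite {e \<in> arcs G. tail G e \<in> dist_ball G u m}"
    by (intro finite_arcs_from finite_dist_ball reg) (auto intro: wf_digraph_axioms)
  have "finite (inner_paths G u m w) \<and> (of_nat (card (inner_paths G u m w)) :: 'k) = 0"
    if "w \<notin> dist_ball G u m" for w
  proof -
    have "c w = 0" using that T S(3) by blast
    then show ?thesis
      using of_nat_card_paths_within[OF ac u S(2,1,3) c D T, of w] finite_paths_within[OF ac D]
      by (simp add: inner_paths_eq[OF u])
  qed
  then show "\<exists>m. \<forall>w. w \<notin> dist_ball G u m \<longrightarrow> finite (inner_paths G u m w) \<and>
        (of_nat (card (inner_paths G u m w)) :: 'k) = 0" by blast
qed

text \<open>The finite ball contains a vertex \<open>w\<close> all of whose edges leave it. A path
  of length at most \<open>m\<close> to \<open>w\<close> stays in the ball, so appending an edge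
  gives an inner path to a vertex outside, where the number of inner paths is \<open>0\<close> in
  the field. This number is positive, hence so is the characteristic, which divides it; as the
  characteristic is not \<open>1\<close>, there are at least two such paths.\<close>

lemma unit_fun_span_two_awalks:
  assumes ac: "acyclic_graph G" and u: "u \<in> verts G"
    and span: "(unit_fun u :: 'a \<Rightarrow> 'k::field) \<in> cuntz_krieger_span G"
    and reg: "\<And>p w. awalk u p w \<Longrightarrow> w \<in> regular_verts G"
  shows "CHAR('k) > 0" and "\<exists>w p q. awalk u p w \<and> awalk u q w \<and> p \<noteq> q"
proof -
  have "\<forall>p w. awalk u p w \<longrightarrow> w \<in> regular_verts G" using reg by blast
  from unit_fun_span_regular(2)[OF ac u span this]
  obtain m where m: "\<And>w. w \<notin> dist_ball G u m \<Longrightarrow> finite (inner_paths G u m w) \<and>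
        (of_nat (card (inner_paths G u m w)) :: 'k) = 0"
    by blast
  let ?D = "dist_ball G u m"
  have Dreg: "?D \<subseteq> regular_verts G" using reg by (auto simp: dist_ball_iff)
  have fin: "finite {e \<in> arcs G. tail G e \<in> ?D}"
    by (intro finite_arcs_from finite_dist_ball reg) (use Dreg in \<open>auto intro: wf_digraph_axioms\<close>)
  have "u \<in> ?D" using u by (auto simp: dist_ball_iff awalk_Nil_iff intro!: exI[of _ "[]"])
  then have "\<not> (\<forall>w\<in>?D. \<exists>e\<in>{e \<in> arcs G. tail G e \<in> ?D}. tail G e = w \<and> head G e \<in> ?D)"
    using acyclic_forward_empty[OF ac fin, of ?D] by blast
  then obtain w where w: "w \<in> ?D" "\<And>e. e \<in> arcs G \<Longrightarrow> tail G e = w \<Longrightarrow> head G e \<notin> ?D" by auto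
  then have "w \<in> regular_verts G" using Dreg by auto
  then obtain e where e: "e \<in> arcs G" "tail G e = w" by (auto simp: regular_verts_def out_arcs_def)
  obtain p where p: "awalk u p w" "length p \<le> m" using w by (auto simp: dist_ball_iff)
  have "\<forall>e\<in>set p. tail G e \<in> ?D"
  proof
    fix a assume "a \<in> set p"
    then obtain xs ys where xs: "p = xs @ a # ys" by (meson split_list)
    then have "awalk u xs (tail G a)" "length xs \<le> m"
      using p by (auto simp: awalk_append_ex awalk_simps)
    then show "tail G a \<in> ?D" by (auto simp: dist_ball_iff)
  qed
  then have q: "p @ [e] \<in> inner_paths G u m (head G e)"
    using p e w(1) by (auto simp: inner_paths_eq[OF u] paths_within_def awalk_append_ex awalk_simps)
  let ?P = "inner_paths G u m (head G e)"
  have 0: "finite ?P" "(of_nat (card ?P) :: 'k) = 0" using m[of "head G e"] w e by auto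
  then have "card ?P > 0" using q card_gt_0_iff by blast
  moreover have dvd: "CHAR('k) dvd card ?P" using 0 of_nat_eq_0_iff_char_dvd by blast
  ultimately show "CHAR('k) > 0" by (metis dvd_0_left_iff gr_zeroI)
  moreover have "CHAR('k) \<noteq> 1" using CHAR_not_1 by auto
  ultimately have "card ?P \<ge> 2"
    using dvd \<open>card ?P > 0\<close> by (metis One_nat_def Suc_1 Suc_leI dvd_1_iff_1 le_antisym not_less_eq_eq)
  then obtain q' where "q' \<in> ?P" "q' \<noteq> p @ [e]"
    by (metis card_2_iff' card_le_Suc0_iff_eq 0(1) One_nat_def Suc_1 not_less_eq_eq)
  then show "\<exists>w p q. awalk u p w \<and> awalk u q w \<and> p \<noteq> q"
    using q by (auto simp: inner_paths_def)
qed

text \<open>A vertex at distance \<open>m + 1\<close> lies outside the ball, where the path count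
  vanishes in the field.\<close>

lemma p_commutator_graphI:
  assumes ac: "acyclic_graph G"
    and span: "\<And>u. u \<in> verts G \<Longrightarrow> (unit_fun u :: 'a \<Rightarrow> 'k::field) \<in> cuntz_krieger_span G"
  shows "p_commutator_graph CHAR('k) G"
proof -
  have reg: "verts G \<subseteq> regular_verts G" by (blast intro: unit_fun_span_regular(1)[OF ac _ span])
  have "\<exists>m. \<forall>w\<in>verts G. path_dist G u w = enat (m + 1) \<longrightarrow>
        finite (inner_paths G u m w) \<and> CHAR('k) dvd card (inner_paths G u m w)"
    if u: "u \<in> verts G" for u
  proof -
    have "\<forall>p w. awalk u p w \<longrightarrow> w \<in> regular_verts G" using reg awalk_last_in_verts by blast
    from unit_fun_span_regular(2)[OF ac u span[OF u] this]
    obtain m where m: "\<And>w. w \<notin> dist_ball G u m \<Longrightarrow> finite (inner_paths G u m w) \<and>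
        (of_nat (card (inner_paths G u m w)) :: 'k) = 0" by blast
    have "w \<notin> dist_ball G u m" if "path_dist G u w = enat (m + 1)" for w
      using that by (auto simp: dist_ball_def)
    then show ?thesis using m of_nat_eq_0_iff_char_dvd by blast
  qed
  then show ?thesis unfolding p_commutator_graph_def using ac reg by blast
qed

end

section \<open>Linear algebra in free algebras\<close>

lemma lookup_scalar_mult [simp]:
  fixes f :: "'w::monoid_add \<Rightarrow>\<^sub>0 'k::field"
  shows "Poly_Mapping.lookup (Poly_Mapping.single 0 c * f) w = c * Poly_Mapping.lookup f w"
  unfolding mult_map_scale_conv_mult[symmetric] by (simp add: Poly_Mapping.map.rep_eq when_def)

interpretation fa: vector_space "\<lambda>(c::'k::field) (f::'w::monoid_add \<Rightarrow>\<^sub>0 'k). Poly_Mapping.single 0 c * f"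
  by standard (simp_all add: distrib_left distrib_right single_add mult.assoc[symmetric] mult_single)

lemma poly_mapping_sum_single:
  "(\<Sum>w\<in>Poly_Mapping.keys f. Poly_Mapping.single w (Poly_Mapping.lookup f w)) = f"
proof (rule poly_mapping_eqI)
  fix w
  show "Poly_Mapping.lookup (\<Sum>w\<in>Poly_Mapping.keys f. Poly_Mapping.single w (Poly_Mapping.lookup f w)) w = Poly_Mapping.lookup f w"
    by (cases "w \<in> Poly_Mapping.keys f")
      (auto simp: lookup_sum lookup_single when_def sum.delta in_keys_iff)
qed

text \<open>Scalars are multiples of the empty word, which is neutral for concatenation.\<close>

lemma scalar_mult_commute:
  fixes f :: "'w::monoid_add \<Rightarrow>\<^sub>0 'k::field"
  shows "f * Poly_Mapping.single 0 c = Poly_Mapping.single 0 c * f"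
proof -
  have "(\<Sum>w\<in>Poly_Mapping.keys f. Poly_Mapping.single w (Poly_Mapping.lookup f w)) * Poly_Mapping.single 0 c
      = Poly_Mapping.single 0 c * (\<Sum>w\<in>Poly_Mapping.keys f. Poly_Mapping.single w (Poly_Mapping.lookup f w))"
    by (simp add: sum_distrib_left sum_distrib_right mult_single mult.commute)
  then show ?thesis by (simp only: poly_mapping_sum_single)
qed

lemma mult_scalar_left:
  fixes f :: "'w::monoid_add \<Rightarrow>\<^sub>0 'k::field"
  shows "f * (Poly_Mapping.single 0 c * g) = Poly_Mapping.single 0 c * (f * g)"
  by (metis mult.assoc scalar_mult_commute)

text \<open>Functionals on the free algebra are given by their values on words. The trace and the
  matrix entries of the action on infinite paths both arise in this way.\<close>

definition lin :: "('w \<Rightarrow> 'k) \<Rightarrow> ('w::monoid_add \<Rightarrow>\<^sub>0 'k::field) \<Rightarrow> 'k" where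
  "lin t f = (\<Sum>w\<in>Poly_Mapping.keys f. Poly_Mapping.lookup f w * t w)"

lemma lin_superset:
  assumes "finite S" "Poly_Mapping.keys f \<subseteq> S"
  shows "lin t f = (\<Sum>w\<in>S. Poly_Mapping.lookup f w * t w)"
  unfolding lin_def by (rule sum.mono_neutral_left) (use assms in \<open>auto simp: in_keys_iff\<close>)

lemma lin_add: "lin t (f + g) = lin t f + lin t g"
proof -
  let ?S = "Poly_Mapping.keys f \<union> Poly_Mapping.keys g"
  have "lin t (f + g) = (\<Sum>w\<in>?S. Poly_Mapping.lookup (f + g) w * t w)"
    by (rule lin_superset) (auto simp: in_keys_iff lookup_add)
  moreover have "lin t f = (\<Sum>w\<in>?S. Poly_Mapping.lookup f w * t w)" by (rule lin_superset) auto
  moreover have "lin t g = (\<Sum>w\<in>?S. Poly_Mapping.lookup g w * t w)" by (rule lin_superset) auto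
  ultimately show ?thesis by (simp add: lookup_add distrib_right sum.distrib)
qed

lemma lin_scale: "lin t (Poly_Mapping.single 0 c * f) = c * lin t f"
proof -
  have "lin t (Poly_Mapping.single 0 c * f) =
      (\<Sum>w\<in>Poly_Mapping.keys f. Poly_Mapping.lookup (Poly_Mapping.single 0 c * f) w * t w)"
    by (rule lin_superset) (auto simp: in_keys_iff)
  then show ?thesis by (simp add: lin_def sum_distrib_left mult.assoc)
qed

lemma lin_zero [simp]: "lin t 0 = 0"
  by (simp add: lin_def)

lemma lin_single [simp]: "lin t (Poly_Mapping.single w c) = c * t w"
  by (simp add: lin_def)

lemma lin_sum: "lin t (sum f A) = (\<Sum>a\<in>A. lin t (f a))"
  by (induction A rule: infinite_finite_induct) (auto simp: lin_add)

lemma lin_diff: "lin t (f - g) = lin t f - lin t g"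
proof -
  have "lin t (f - g) + lin t g = lin t f" by (simp flip: lin_add)
  then show ?thesis by (simp add: algebra_simps)
qed

lemma lin_mult_single: "lin t (f * Poly_Mapping.single b 1) = lin (\<lambda>w. t (w + b)) f"
proof -
  have "lin t ((\<Sum>w\<in>Poly_Mapping.keys f. Poly_Mapping.single w (Poly_Mapping.lookup f w)) * Poly_Mapping.single b 1)
     = (\<Sum>w\<in>Poly_Mapping.keys f. Poly_Mapping.lookup f w * t (w + b))"
    by (simp add: sum_distrib_right lin_sum mult_single)
  then show ?thesis by (simp only: poly_mapping_sum_single lin_def)
qed

lemma lin_single_mult: "lin t (Poly_Mapping.single b 1 * f) = lin (\<lambda>w. t (b + w)) f"
proof -
  have "lin t (Poly_Mapping.single b 1 * (\<Sum>w\<in>Poly_Mapping.keys f. Poly_Mapping.single w (Poly_Mapping.lookup f w)))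
     = (\<Sum>w\<in>Poly_Mapping.keys f. Poly_Mapping.lookup f w * t (b + w))"
    by (simp add: sum_distrib_left lin_sum mult_single)
  then show ?thesis by (simp only: poly_mapping_sum_single lin_def)
qed

section \<open>Leavitt path algebras as quotients\<close>

definition word :: "'x list \<Rightarrow> 'x free_mon \<Rightarrow>\<^sub>0 'k::field" where
  "word xs = Poly_Mapping.single (Free_Mon xs) 1"

lemma word_mult: "word xs * word ys = word (xs @ ys)"
  by (simp add: word_def mult_single plus_free_mon_def)

lemma free_gen_word: "free_gen x = word [x]"
  by (simp add: free_gen_def word_def)

text \<open>\<open>K\<close> carries the type of the scalars, which the graph does not
  determine.\<close>

locale leavitt = wf_digraph G for G :: "('v, 'e) pre_digraph" +
  fixes K :: "'k::field itself"
begin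

abbreviation A :: "('k, ('v, 'e) lpa_gen free_mon \<Rightarrow>\<^sub>0 'k) kalgebra" where
  "A \<equiv> free_alg (lpa_gens G)"

abbreviation L :: "('v, 'e, 'k) lpa" where
  "L \<equiv> leavitt_path_algebra G"

abbreviation sc :: "'k \<Rightarrow> (('v, 'e) lpa_gen free_mon \<Rightarrow>\<^sub>0 'k) \<Rightarrow> ('v, 'e) lpa_gen free_mon \<Rightarrow>\<^sub>0 'k" where
  "sc c f \<equiv> Poly_Mapping.single 0 c * f"

abbreviation V :: "'v \<Rightarrow> ('v, 'e) lpa_gen free_mon \<Rightarrow>\<^sub>0 'k" where "V v \<equiv> free_gen (Vertex v)"
abbreviation X :: "'e \<Rightarrow> ('v, 'e) lpa_gen free_mon \<Rightarrow>\<^sub>0 'k" where "X e \<equiv> free_gen (Edge e)"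
abbreviation Y :: "'e \<Rightarrow> ('v, 'e) lpa_gen free_mon \<Rightarrow>\<^sub>0 'k" where "Y e \<equiv> free_gen (Ghost e)"

definition Fr :: "(('v, 'e) lpa_gen free_mon \<Rightarrow>\<^sub>0 'k) set" where
  "Fr = alg_carrier A"

definition rel_ideal :: "(('v, 'e) lpa_gen free_mon \<Rightarrow>\<^sub>0 'k) set" where
  "rel_ideal = generated_alg_ideal A (lpa_relations G)"

lemma Fr_eq: "Fr = {f. \<forall>w\<in>Poly_Mapping.keys f. w \<noteq> 0 \<and> set (letters w) \<subseteq> lpa_gens G}"
  by (simp add: Fr_def free_alg_def)

lemma Fr_zero [simp]: "0 \<in> Fr"
  by (simp add: Fr_eq)

lemma Fr_add [simp]: "f \<in> Fr \<Longrightarrow> g \<in> Fr \<Longrightarrow> f + g \<in> Fr"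
  using keys_add[of f g] by (auto simp: Fr_eq)

lemma Fr_scale [simp]: "f \<in> Fr \<Longrightarrow> sc c f \<in> Fr"
  by (auto simp: Fr_eq in_keys_iff)

lemma Fr_subspace: "fa.subspace Fr"
  by (auto intro!: fa.subspaceI)

lemma Fr_uminus [simp]: "f \<in> Fr \<Longrightarrow> - f \<in> Fr"
  using Fr_subspace fa.subspace_neg by blast

lemma Fr_diff [simp]: "f \<in> Fr \<Longrightarrow> g \<in> Fr \<Longrightarrow> f - g \<in> Fr"
  using Fr_subspace fa.subspace_diff by blast

lemma Fr_sum [simp]: "(\<And>a. a \<in> B \<Longrightarrow> f a \<in> Fr) \<Longrightarrow> sum f B \<in> Fr"
  using Fr_subspace fa.subspace_sum by blast

lemma Fr_mult [simp]:
  assumes "f \<in> Fr" "g \<in> Fr"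
  shows "f * g \<in> Fr"
  unfolding Fr_eq
proof (intro CollectI ballI)
  fix w assume "w \<in> Poly_Mapping.keys (f * g)"
  then obtain a b where ab: "a \<in> Poly_Mapping.keys f" "b \<in> Poly_Mapping.keys g" "w = a + b"
    using keys_mult[of f g] by auto
  then have "a \<noteq> 0" "set (letters a) \<subseteq> lpa_gens G" "set (letters b) \<subseteq> lpa_gens G"
    using assms by (auto simp: Fr_eq)
  then show "w \<noteq> 0 \<and> set (letters w) \<subseteq> lpa_gens G"
    using ab by (cases a) (auto simp: plus_free_mon_def zero_free_mon_def)
qed

lemma Fr_word [simp]: "word xs \<in> Fr \<longleftrightarrow> xs \<noteq> [] \<and> set xs \<subseteq> lpa_gens G"
  by (auto simp: word_def Fr_eq zero_free_mon_def)

lemma Fr_gens [simp]: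
  "V v \<in> Fr \<longleftrightarrow> v \<in> verts G" "X e \<in> Fr \<longleftrightarrow> e \<in> arcs G" "Y e \<in> Fr \<longleftrightarrow> e \<in> arcs G"
  by (auto simp: free_gen_word lpa_gens_def)

lemma Fr_span_words: "Fr = fa.span {word xs |xs. xs \<noteq> [] \<and> set xs \<subseteq> lpa_gens G}"
proof
  show "Fr \<subseteq> fa.span {word xs |xs. xs \<noteq> [] \<and> set xs \<subseteq> lpa_gens G}"
  proof
    fix f assume "f \<in> Fr"
    have "(\<Sum>w\<in>Poly_Mapping.keys f. Poly_Mapping.single w (Poly_Mapping.lookup f w)) \<in>
      fa.span {word xs |xs. xs \<noteq> [] \<and> set xs \<subseteq> lpa_gens G}"
    proof (rule fa.span_sum)
      fix w assume w: "w \<in> Poly_Mapping.keys f"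
      obtain xs where xs: "w = Free_Mon xs" by (cases w) auto
      then have "xs \<noteq> []" "set xs \<subseteq> lpa_gens G"
        using w \<open>f \<in> Fr\<close> by (force simp: Fr_eq zero_free_mon_def)+
      then have "sc (Poly_Mapping.lookup f w) (word xs) \<in> fa.span {word xs |xs. xs \<noteq> [] \<and> set xs \<subseteq> lpa_gens G}"
        by (intro fa.span_scale fa.span_base) auto
      then show "Poly_Mapping.single w (Poly_Mapping.lookup f w) \<in> fa.span {word xs |xs. xs \<noteq> [] \<and> set xs \<subseteq> lpa_gens G}"
        by (simp add: word_def mult_single xs)
    qed
    then show "f \<in> fa.span {word xs |xs. xs \<noteq> [] \<and> set xs \<subseteq> lpa_gens G}"
      by (simp only: poly_mapping_sum_single)
  qed
  show "fa.span {word xs |xs. xs \<noteq> [] \<and> set xs \<subseteq> lpa_gens G} \<subseteq> Fr"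
    by (rule fa.span_minimal[OF _ Fr_subspace]) auto
qed

lemma Fr_subset_subspace:
  assumes "fa.subspace U" "\<And>xs. xs \<noteq> [] \<Longrightarrow> set xs \<subseteq> lpa_gens G \<Longrightarrow> word xs \<in> U"
  shows "Fr \<subseteq> U"
  unfolding Fr_span_words by (rule fa.span_minimal) (use assms in auto)

text \<open>Serves as induction principle for properties of elements that are stable under linear
  combinations and products.\<close>

lemma Fr_subset_subalgebra:
  assumes "fa.subspace U" "\<And>f g. f \<in> U \<Longrightarrow> g \<in> U \<Longrightarrow> f * g \<in> U" "\<And>x. x \<in> lpa_gens G \<Longrightarrow> free_gen x \<in> U"
  shows "Fr \<subseteq> U"
proof (rule Fr_subset_subspace[OF assms(1)])
  fix xs :: "('v, 'e) lpa_gen list" assume "xs \<noteq> []" "set xs \<subseteq> lpa_gens G"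
  then show "word xs \<in> U"
  proof (induction xs rule: list_nonempty_induct)
    case (single x)
    then show ?case using assms(3) by (simp add: free_gen_word)
  next
    case (cons x xs)
    then have "word [x] * word xs \<in> U" using assms(2,3) by (simp add: free_gen_word)
    then show ?case by (simp add: word_mult)
  qed
qed

lemma alg_A_simps [simp]:
  "alg_carrier A = Fr" "alg_zero A = 0" "alg_add A = (+)" "alg_smult A = sc" "alg_mult A = (*)"
  by (simp_all add: Fr_def free_alg_def)

lemma alg_diff_A [simp]: "alg_diff A f g = f - g"
proof -
  have "sc (- 1) g = - g" by (simp add: single_uminus)
  then show ?thesis by (simp add: alg_diff_def)
qed

lemma relations_subset: "lpa_relations G \<subseteq> Fr"
proof -
  have "V v - (\<Sum>e\<in>out_arcs G v. X e * Y e) \<in> Fr" if "v \<in> regular_verts G" for v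
    using that by (intro Fr_diff Fr_sum Fr_mult) (auto simp: regular_verts_def)
  then show ?thesis unfolding lpa_relations_def Let_def by auto
qed

lemma rel_ideal_subset: "rel_ideal \<subseteq> Fr"
  unfolding rel_ideal_def generated_alg_ideal_def using relations_subset
  by (intro Inter_lower) (auto simp: ring_ideal_def alg_subspace_def)

lemma rel_ideal_minimal:
  assumes "N \<subseteq> Fr" "fa.subspace N" "\<And>a f. a \<in> Fr \<Longrightarrow> f \<in> N \<Longrightarrow> a * f \<in> N"
    "\<And>a f. a \<in> Fr \<Longrightarrow> f \<in> N \<Longrightarrow> f * a \<in> N" "lpa_relations G \<subseteq> N"
  shows "rel_ideal \<subseteq> N"
  unfolding rel_ideal_def generated_alg_ideal_def
  using assms fa.subspace_0 fa.subspace_add fa.subspace_diff fa.subspace_scale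
  by (intro Inter_lower) (auto simp: ring_ideal_def alg_subspace_def)

lemma rel_ideal_Fr [simp]: "f \<in> rel_ideal \<Longrightarrow> f \<in> Fr"
  using rel_ideal_subset by auto

lemma relations_in_rel_ideal: "lpa_relations G \<subseteq> rel_ideal"
  unfolding rel_ideal_def generated_alg_ideal_def by auto

lemma rel_ideal_zero [simp]: "0 \<in> rel_ideal"
  and rel_ideal_add [simp]: "f \<in> rel_ideal \<Longrightarrow> g \<in> rel_ideal \<Longrightarrow> f + g \<in> rel_ideal"
  and rel_ideal_scale [simp]: "f \<in> rel_ideal \<Longrightarrow> sc c f \<in> rel_ideal"
  and rel_ideal_mult_left [simp]: "a \<in> Fr \<Longrightarrow> f \<in> rel_ideal \<Longrightarrow> a * f \<in> rel_ideal"
  and rel_ideal_mult_right [simp]: "a \<in> Fr \<Longrightarrow> f \<in> rel_ideal \<Longrightarrow> f * a \<in> rel_ideal"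
  unfolding rel_ideal_def generated_alg_ideal_def ring_ideal_def alg_subspace_def by auto

lemma rel_ideal_subspace: "fa.subspace rel_ideal"
  by (auto intro!: fa.subspaceI)

lemma rel_ideal_uminus [simp]: "f \<in> rel_ideal \<Longrightarrow> - f \<in> rel_ideal"
  using rel_ideal_subspace fa.subspace_neg by blast

lemma rel_ideal_diff [simp]: "f \<in> rel_ideal \<Longrightarrow> g \<in> rel_ideal \<Longrightarrow> f - g \<in> rel_ideal"
  using rel_ideal_subspace fa.subspace_diff by blast

text \<open>Equality in the Leavitt path algebra, expressed on representatives. The computations
  below take place in the free algebra modulo this relation.\<close>

definition eqv (infix "\<approx>" 50) where "f \<approx> g \<longleftrightarrow> f - g \<in> rel_ideal"

lemma eqv_refl [simp, intro!]: "f \<approx> f"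
  by (simp add: eqv_def)

lemma eqv_sym: "f \<approx> g \<Longrightarrow> g \<approx> f"
  unfolding eqv_def using rel_ideal_uminus by fastforce

lemma eqv_trans [trans]: "f \<approx> g \<Longrightarrow> g \<approx> h \<Longrightarrow> f \<approx> h"
  unfolding eqv_def using rel_ideal_add by fastforce

lemma eqv_add: "f \<approx> g \<Longrightarrow> f' \<approx> g' \<Longrightarrow> f + f' \<approx> g + g'"
  unfolding eqv_def using rel_ideal_add by (fastforce simp: algebra_simps)

lemma eqv_diff: "f \<approx> g \<Longrightarrow> f' \<approx> g' \<Longrightarrow> f - f' \<approx> g - g'"
  unfolding eqv_def using rel_ideal_diff by (fastforce simp: algebra_simps)

lemma eqv_scale: "f \<approx> g \<Longrightarrow> sc c f \<approx> sc c g"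
  unfolding eqv_def using rel_ideal_scale by (simp flip: right_diff_distrib)

lemma eqv_sum: "(\<And>a. a \<in> B \<Longrightarrow> f a \<approx> g a) \<Longrightarrow> sum f B \<approx> sum g B"
  by (induction B rule: infinite_finite_induct) (auto intro: eqv_add)

lemma eqv_mult_left: "a \<in> Fr \<Longrightarrow> f \<approx> g \<Longrightarrow> a * f \<approx> a * g"
  unfolding eqv_def using rel_ideal_mult_left by (simp flip: right_diff_distrib)

lemma eqv_mult_right: "a \<in> Fr \<Longrightarrow> f \<approx> g \<Longrightarrow> f * a \<approx> g * a"
  unfolding eqv_def using rel_ideal_mult_right by (simp flip: left_diff_distrib)

lemma eqv_zero_iff: "f \<approx> 0 \<longleftrightarrow> f \<in> rel_ideal"
  by (simp add: eqv_def)

lemma eqv_rel_ideal: "f \<approx> g \<Longrightarrow> f \<in> rel_ideal \<longleftrightarrow> g \<in> rel_ideal"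
  using eqv_trans eqv_sym by (metis eqv_zero_iff)

lemma eqv_V_V: "u \<in> verts G \<Longrightarrow> v \<in> verts G \<Longrightarrow> V u * V v \<approx> (if u = v then V u else 0)"
  and eqv_V_X: "e \<in> arcs G \<Longrightarrow> V (tail G e) * X e \<approx> X e"
  and eqv_X_V: "e \<in> arcs G \<Longrightarrow> X e * V (head G e) \<approx> X e"
  and eqv_V_Y: "e \<in> arcs G \<Longrightarrow> V (head G e) * Y e \<approx> Y e"
  and eqv_Y_V: "e \<in> arcs G \<Longrightarrow> Y e * V (tail G e) \<approx> Y e"
  and eqv_Y_X: "e \<in> arcs G \<Longrightarrow> f \<in> arcs G \<Longrightarrow> Y e * X f \<approx> (if e = f then V (head G e) else 0)"
  and eqv_V_sum: "v \<in> regular_verts G \<Longrightarrow> V v \<approx> (\<Sum>e\<in>out_arcs G v. X e * Y e)"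
  unfolding eqv_def by (rule subsetD[OF relations_in_rel_ideal], unfold lpa_relations_def Let_def, blast)+

definition cls :: "(('v, 'e) lpa_gen free_mon \<Rightarrow>\<^sub>0 'k) \<Rightarrow> (('v, 'e) lpa_gen free_mon \<Rightarrow>\<^sub>0 'k) set" where
  "cls f = alg_congruence A rel_ideal `` {f}"

lemma cls_eq: "f \<in> Fr \<Longrightarrow> cls f = {g \<in> Fr. f \<approx> g}"
  by (auto simp: cls_def alg_congruence_def eqv_def)

lemma cls_eq_iff: "f \<in> Fr \<Longrightarrow> g \<in> Fr \<Longrightarrow> cls f = cls g \<longleftrightarrow> f \<approx> g"
  unfolding cls_eq using eqv_sym eqv_trans by blast

lemma cls_eqI: "f \<approx> g \<Longrightarrow> f \<in> Fr \<Longrightarrow> g \<in> Fr \<Longrightarrow> cls f = cls g"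
  by (simp add: cls_eq_iff)

lemma L_carrier: "alg_carrier L = cls ` Fr"
  unfolding leavitt_path_algebra_def quotient_alg_def Let_def
  by (auto simp: quotient_def cls_def rel_ideal_def)

lemma L_zero [simp]: "alg_zero L = cls 0"
  unfolding leavitt_path_algebra_def quotient_alg_def Let_def by (simp add: cls_def rel_ideal_def)

text \<open>The operations of a quotient algebra are unions over representatives; on classes all
  members of such a union coincide.\<close>

lemma UN_cls:
  assumes "f \<in> Fr" "\<And>g. g \<in> Fr \<Longrightarrow> f \<approx> g \<Longrightarrow> h g = c"
  shows "(\<Union>g\<in>cls f. h g) = c"
  using assms by (auto simp: cls_eq intro!: bexI[of _ f])

lemma L_add [simp]: "f \<in> Fr \<Longrightarrow> g \<in> Fr \<Longrightarrow> alg_add L (cls f) (cls g) = cls (f + g)"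
  unfolding leavitt_path_algebra_def quotient_alg_def Let_def rel_ideal_def[symmetric] cls_def[symmetric]
  by (simp, intro UN_cls cls_eqI) (auto intro: eqv_add eqv_sym)

lemma L_mult [simp]: "f \<in> Fr \<Longrightarrow> g \<in> Fr \<Longrightarrow> alg_mult L (cls f) (cls g) = cls (f * g)"
  unfolding leavitt_path_algebra_def quotient_alg_def Let_def rel_ideal_def[symmetric] cls_def[symmetric]
  by (simp, intro UN_cls cls_eqI) (auto intro: eqv_trans[OF eqv_mult_left eqv_mult_right] eqv_sym)

lemma L_smult [simp]: "f \<in> Fr \<Longrightarrow> alg_smult L c (cls f) = cls (sc c f)"
  unfolding leavitt_path_algebra_def quotient_alg_def Let_def rel_ideal_def[symmetric] cls_def[symmetric]
  by (simp, intro UN_cls cls_eqI) (auto intro: eqv_scale eqv_sym)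

lemma L_diff [simp]: "f \<in> Fr \<Longrightarrow> g \<in> Fr \<Longrightarrow> alg_diff L (cls f) (cls g) = cls (f - g)"
  by (simp add: alg_diff_def single_uminus)

lemma minus_lie_simps [simp]:
  "alg_carrier (minus_lie L) = alg_carrier L" "alg_zero (minus_lie L) = alg_zero L"
  "alg_add (minus_lie L) = alg_add L" "alg_smult (minus_lie L) = alg_smult L"
  "alg_diff (minus_lie L) = alg_diff L" "alg_subspace (minus_lie L) = alg_subspace L"
  "alg_span (minus_lie L) = alg_span L"
  by (auto simp: minus_lie_def alg_diff_def alg_subspace_def alg_span_def fun_eq_iff)

lemma bracket [simp]: "f \<in> Fr \<Longrightarrow> g \<in> Fr \<Longrightarrow> alg_mult (minus_lie L) (cls f) (cls g) = cls (f * g - g * f)"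
  by (simp add: minus_lie_def)

lemma lie_algebra_minus_lie: "lie_algebra (minus_lie L)"
  unfolding lie_algebra_def minus_lie_simps L_carrier alg_subspace_def ball_simps(9)
  by (intro conjI ballI allI)
    ((simp add: algebra_simps single_add; fail) | (simp add: mult.assoc[symmetric] mult_single; fail) |
      (simp add: right_diff_distrib mult.assoc mult_scalar_left; fail))+

definition pullback where "pullback U = {f \<in> Fr. cls f \<in> U}"

text \<open>Subspaces of \<open>L\<close> correspond to the subspaces of the free algebra that
  contain \<open>rel_ideal\<close>, so questions about Lie ideals can be moved to
  representatives.\<close>

lemma pullback_props:
  assumes "alg_subspace L U"
  shows "fa.subspace (pullback U)" "rel_ideal \<subseteq> pullback U" "cls ` pullback U = U"
proof -
  have U: "U \<subseteq> cls ` Fr" "cls 0 \<in> U" using assms by (auto simp: alg_subspace_def L_carrier)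
  show "fa.subspace (pullback U)"
  proof (rule fa.subspaceI)
    fix f g assume "f \<in> pullback U" "g \<in> pullback U"
    then show "f + g \<in> pullback U"
      using assms unfolding alg_subspace_def pullback_def by (metis (mono_tags, lifting) Fr_add L_add mem_Collect_eq)
  next
    fix c f assume "f \<in> pullback U"
    then show "sc c f \<in> pullback U"
      using assms unfolding alg_subspace_def pullback_def by (metis (mono_tags, lifting) Fr_scale L_smult mem_Collect_eq)
  qed (use U in \<open>simp add: pullback_def\<close>)
  show "rel_ideal \<subseteq> pullback U"
  proof
    fix f assume "f \<in> rel_ideal"
    then have "cls f = cls 0" by (simp add: cls_eq_iff eqv_zero_iff)
    then show "f \<in> pullback U" using U(2) \<open>f \<in> rel_ideal\<close> by (simp add: pullback_def)
  qed
  show "cls ` pullback U = U" using U by (auto simp: pullback_def)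
qed

lemma subspace_image:
  assumes "fa.subspace U" "U \<subseteq> Fr"
  shows "alg_subspace L (cls ` U)"
proof -
  have "alg_add L (cls f) (cls g) \<in> cls ` U" if "f \<in> U" "g \<in> U" for f g
    using that assms fa.subspace_add[of U f g] by (subst L_add) auto
  moreover have "alg_smult L c (cls f) \<in> cls ` U" if "f \<in> U" for c f
    using that assms fa.subspace_scale[of U f c] by (subst L_smult) auto
  ultimately show ?thesis
    using assms fa.subspace_0[of U] unfolding alg_subspace_def L_carrier by auto
qed

lemma span_image:
  assumes "B \<subseteq> Fr"
  shows "alg_span L (cls ` B) = cls ` fa.span B"
proof
  have "fa.span B \<subseteq> Fr" using assms Fr_subspace by (rule fa.span_minimal)
  then show "alg_span L (cls ` B) \<subseteq> cls ` fa.span B"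
    unfolding alg_span_def using fa.span_superset[of B]
    by (intro Inter_lower) (auto intro!: subspace_image fa.subspace_span)
  show "cls ` fa.span B \<subseteq> alg_span L (cls ` B)"
    unfolding alg_span_def
  proof (intro Inter_greatest)
    fix U assume "U \<in> {U. alg_subspace L U \<and> cls ` B \<subseteq> U}"
    then have U: "alg_subspace L U" "cls ` B \<subseteq> U" by auto
    then have "B \<subseteq> pullback U" using assms by (auto simp: pullback_def)
    then have "fa.span B \<subseteq> pullback U" using pullback_props(1)[OF U(1)] by (rule fa.span_minimal)
    then show "cls ` fa.span B \<subseteq> U" by (auto simp: pullback_def)
  qed
qed

end

section \<open>Normal forms and the trace\<close>

text \<open>The triple \<open>(p, u, q)\<close> stands for the monomial \<open>pq\<^sup>*\<close>, where \<open>p\<close> and \<open>q\<close> are paths with range \<open>u\<close>.\<close>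

type_synonym ('v, 'e) monomial = "'e list \<times> 'v \<times> 'e list"

context leavitt
begin

text \<open>The range \<open>u\<close> is an argument because the empty list does not determine the
  vertex of a path of length 0.\<close>

definition start :: "'v \<Rightarrow> 'e list \<Rightarrow> 'v" where
  "start u p = (case p of [] \<Rightarrow> u | e # _ \<Rightarrow> tail G e)"

lemma start_simps [simp]: "start u [] = u" "start u (e # p) = tail G e"
  by (simp_all add: start_def)

lemma start_append [simp]: "start u (p @ q) = start (start u q) p"
  by (cases p) simp_all

lemma start_awalk: "awalk a p u \<Longrightarrow> start u p = a"
  by (cases p) (auto simp: awalk_simps)

text \<open>Left and right multiplication by a generator as in the Cohn path algebra, which is
  defined by all relations except \<open>v = \<Sum> ee^*\<close>. There the product of a generator
  and a monomial is a monomial or \<open>0\<close>, so words can be evaluated without sums.\<close>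

fun left_mult :: "('v, 'e) lpa_gen \<Rightarrow> ('v, 'e) monomial \<Rightarrow> ('v, 'e) monomial option" where
  "left_mult (Vertex v) (p, u, q) = (if start u p = v then Some (p, u, q) else None)"
| "left_mult (Edge e) (p, u, q) = (if start u p = head G e then Some (e # p, u, q) else None)"
| "left_mult (Ghost e) (p, u, q) = (case p of
     [] \<Rightarrow> if u = tail G e then Some ([], head G e, q @ [e]) else None
   | f # p' \<Rightarrow> if f = e then Some (p', u, q) else None)"

fun right_mult :: "('v, 'e) lpa_gen \<Rightarrow> ('v, 'e) monomial \<Rightarrow> ('v, 'e) monomial option" where
  "right_mult (Vertex v) (p, u, q) = (if start u q = v then Some (p, u, q) else None)"
| "right_mult (Ghost e) (p, u, q) = (if start u q = head G e then Some (p, u, e # q) else None)"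
| "right_mult (Edge e) (p, u, q) = (case q of
     [] \<Rightarrow> if u = tail G e then Some (p @ [e], head G e, []) else None
   | f # q' \<Rightarrow> if f = e then Some (p, u, q') else None)"

fun gen_monomial :: "('v, 'e) lpa_gen \<Rightarrow> ('v, 'e) monomial" where
  "gen_monomial (Vertex v) = ([], v, [])"
| "gen_monomial (Edge e) = ([e], head G e, [])"
| "gen_monomial (Ghost e) = ([], head G e, [e])"

text \<open>\<open>None\<close> is the monomial \<open>0\<close>; the value on the empty word is irrelevant.\<close>

fun nf :: "('v, 'e) lpa_gen list \<Rightarrow> ('v, 'e) monomial option" where
  "nf [] = None"
| "nf [g] = Some (gen_monomial g)"
| "nf (g # h # w) = Option.bind (nf (h # w)) (left_mult g)"

lemma nf_Cons: "w \<noteq> [] \<Longrightarrow> nf (g # w) = Option.bind (nf w) (left_mult g)"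
  by (cases w) auto

text \<open>Associativity for a monomial between two generators. \<open>nf\<close> evaluates words
  from the right; this allows letters to be appended at the right as well.\<close>

lemma left_right_mult_commute:
  "Option.bind (left_mult g m) (right_mult h) = Option.bind (right_mult h m) (left_mult g)"
  by (cases m; cases g; cases h) (auto split: list.splits)

lemma left_mult_gen_monomial: "left_mult h (gen_monomial g) = right_mult g (gen_monomial h)"
  by (cases g; cases h) (auto split: list.splits)

lemma nf_snoc: "w \<noteq> [] \<Longrightarrow> nf (w @ [g]) = Option.bind (nf w) (right_mult g)"
proof (induction w rule: list_nonempty_induct)
  case (single h)
  then show ?case by (simp add: left_mult_gen_monomial)
next
  case (cons h w)
  then show ?case
    by (simp add: nf_Cons Option.bind_assoc left_right_mult_commute)
qed

definition path_to :: "'v \<Rightarrow> 'e list \<Rightarrow> bool" where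
  "path_to u p \<longleftrightarrow> awalk (start u p) p u"

lemma path_to_Nil [simp]: "path_to u [] \<longleftrightarrow> u \<in> verts G"
  by (simp add: path_to_def awalk_simps)

lemma path_to_Cons [simp]: "path_to u (e # p) \<longleftrightarrow> e \<in> arcs G \<and> start u p = head G e \<and> path_to u p"
  using start_awalk[of "head G e" p u] by (auto simp: path_to_def awalk_simps)

lemma path_to_verts: "path_to u p \<Longrightarrow> u \<in> verts G" "path_to u p \<Longrightarrow> start u p \<in> verts G"
  by (auto simp: path_to_def awalk_last_in_verts awalk_hd_in_verts)

lemma path_to_append [simp]: "path_to u (p @ q) \<longleftrightarrow> path_to u q \<and> path_to (start u q) p"
  by (induction p) (auto dest: path_to_verts)

lemma path_to_arcs: "path_to u p \<Longrightarrow> e \<in> set p \<Longrightarrow> e \<in> arcs G"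
  by (auto simp add: path_to_def awalk_def)

lemma awalk_iff_path_to: "awalk a p u \<longleftrightarrow> path_to u p \<and> start u p = a"
  by (metis path_to_def start_awalk)

definition valid :: "('v, 'e) monomial \<Rightarrow> bool" where
  "valid m = (case m of (p, u, q) \<Rightarrow> path_to u p \<and> path_to u q)"

lemma valid_iff [simp]: "valid (p, u, q) \<longleftrightarrow> path_to u p \<and> path_to u q"
  by (simp add: valid_def)

lemma valid_left_mult:
  assumes "valid m" "g \<in> lpa_gens G" "left_mult g m = Some m'"
  shows "valid m'"
  using assms
  by (cases m; cases g) (auto simp: lpa_gens_def path_to_verts split: if_splits list.splits)

lemma valid_gen_monomial: "g \<in> lpa_gens G \<Longrightarrow> valid (gen_monomial g)"
  by (auto simp: lpa_gens_def)

lemma valid_nf: "set w \<subseteq> lpa_gens G \<Longrightarrow> nf w = Some m \<Longrightarrow> valid m"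
proof (induction w arbitrary: m)
  case (Cons g w)
  then show ?case
    by (cases "w = []") (auto simp: nf_Cons bind_eq_Some_conv valid_gen_monomial intro: valid_left_mult)
qed auto

text \<open>\<open>Some v\<close> records \<open>pp\<^sup>*\<close> with \<open>r(p) = v\<close>, and \<open>None\<close> records \<open>qtq\<^sup>*\<close> with a closed path \<open>t\<close> of
  positive length.\<close>

definition trace_class :: "('v, 'e) monomial \<Rightarrow> 'v option option" where
  "trace_class m = (case m of (p, u, q) \<Rightarrow>
     if start u p = start u q \<and> take (length q) p = q
     then Some (if length p = length q then Some u else None) else None)"

text \<open>The trace property for one generator. Moving an edge around a closed path rotates the
  path, which is why \<open>trace_class\<close> does not distinguish closed paths of positive
  length.\<close>

lemma trace_class_left_right:
  assumes "valid m"
  shows "Option.bind (left_mult g m) trace_class = Option.bind (right_mult g m) trace_class"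
proof -
  obtain p u q where m: "m = (p, u, q)" by (cases m) auto
  show ?thesis
  proof (cases g)
    case (Vertex v)
    then show ?thesis by (auto simp: m trace_class_def)
  next
    case (Edge e)
    then show ?thesis using assms
      by (cases q; cases p)
        (auto simp: m trace_class_def)
  next
    case (Ghost e)
    then show ?thesis using assms
      by (cases p; cases q)
        (auto simp: m trace_class_def take_Cons')
  qed
qed

text \<open>The letters of \<open>xs\<close> are moved one after another from the left end to the
  right end.\<close>

lemma trace_class_nf_rotate:
  assumes "xs \<noteq> []" "ys \<noteq> []" "set xs \<subseteq> lpa_gens G" "set ys \<subseteq> lpa_gens G"
  shows "Option.bind (nf (xs @ ys)) trace_class = Option.bind (nf (ys @ xs)) trace_class"
  using assms
proof (induction xs arbitrary: ys)
  case (Cons g xs)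
  have "Option.bind (nf ((g # xs) @ ys)) trace_class =
      Option.bind (nf (xs @ ys)) (\<lambda>m. Option.bind (left_mult g m) trace_class)"
    using Cons.prems by (simp add: nf_Cons Option.bind_assoc)
  also have "\<dots> = Option.bind (nf (xs @ ys)) (\<lambda>m. Option.bind (right_mult g m) trace_class)"
    using Cons.prems valid_nf[of "xs @ ys"]
    by (intro bind_option_cong refl trace_class_left_right) auto
  also have "\<dots> = Option.bind (nf (xs @ ys @ [g])) trace_class"
    using Cons.prems nf_snoc[of "xs @ ys" g] by (simp add: Option.bind_assoc)
  also have "\<dots> = Option.bind (nf (ys @ g # xs)) trace_class"
    using Cons.IH[of "ys @ [g]"] Cons.prems by (cases "xs = []") auto
  finally show ?case .
qed auto

text \<open>The letter \<open>Vertex u\<close> keeps the word nonempty, and the vertex recorded,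
  when both paths have length 0.\<close>

definition monomial :: "('v, 'e) monomial \<Rightarrow> ('v, 'e) lpa_gen free_mon \<Rightarrow>\<^sub>0 'k" where
  "monomial m = (case m of (p, u, q) \<Rightarrow> word (map Edge p @ Vertex u # map Ghost (rev q)))"

lemma Fr_monomial [simp]: "valid m \<Longrightarrow> monomial m \<in> Fr"
  by (auto simp: monomial_def lpa_gens_def path_to_verts path_to_arcs split: prod.splits)

lemma monomial_Cons: "monomial (e # p, u, q) = X e * monomial (p, u, q)"
  by (simp add: monomial_def free_gen_word word_mult)

lemma V_start_monomial:
  assumes "valid (p, u, q)"
  shows "V (start u p) * monomial (p, u, q) \<approx> monomial (p, u, q)"
proof (cases p)
  case Nil
  have u: "u \<in> verts G" using assms by (auto simp: path_to_verts)
  show ?thesis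
  proof (cases q rule: rev_cases)
    case Nil
    then show ?thesis using \<open>p = []\<close> u eqv_V_V[of u u] by (simp add: monomial_def free_gen_word)
  next
    case (snoc q' e)
    then have "monomial (p, u, q) = V u * word (map Ghost (rev q))"
      by (simp add: monomial_def free_gen_word word_mult \<open>p = []\<close>)
    moreover have "word (map Ghost (rev q)) \<in> Fr"
      using assms snoc by (auto simp: lpa_gens_def path_to_arcs)
    ultimately show ?thesis using u eqv_V_V[of u u] \<open>p = []\<close>
      by (auto simp: mult.assoc[symmetric] intro: eqv_mult_right)
  qed
next
  case (Cons e p')
  then have "e \<in> arcs G" "valid (p', u, q)" using assms by auto
  then show ?thesis using eqv_V_X[of e]
    by (auto simp: Cons monomial_Cons mult.assoc[symmetric] intro: eqv_mult_right)
qed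

abbreviation opt_monomial :: "('v, 'e) monomial option \<Rightarrow> ('v, 'e) lpa_gen free_mon \<Rightarrow>\<^sub>0 'k" where
  "opt_monomial mo \<equiv> (case mo of None \<Rightarrow> 0 | Some m \<Rightarrow> monomial m)"

lemma V_monomial:
  assumes "valid (p, u, q)" "v \<in> verts G"
  shows "V v * monomial (p, u, q) \<approx> (if start u p = v then monomial (p, u, q) else 0)"
proof -
  have s: "start u p \<in> verts G" using assms by (auto simp: path_to_verts)
  have "V v * monomial (p, u, q) \<approx> V v * (V (start u p) * monomial (p, u, q))"
    using assms by (intro eqv_mult_left eqv_sym[OF V_start_monomial]) auto
  also have "\<dots> \<approx> (if v = start u p then V v else 0) * monomial (p, u, q)"
    unfolding mult.assoc[symmetric] using assms s by (intro eqv_mult_right eqv_V_V) auto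
  also have "\<dots> \<approx> (if start u p = v then monomial (p, u, q) else 0)"
    using V_start_monomial[OF assms(1)] by auto
  finally show ?thesis .
qed

text \<open>Only relations other than the sum relation enter, so the rules of the Cohn path algebra
  remain correct in its quotient \<open>L\<close>.\<close>

lemma gen_mult_monomial:
  assumes m: "valid m" and g: "g \<in> lpa_gens G"
  shows "free_gen g * monomial m \<approx> opt_monomial (left_mult g m)"
proof -
  obtain p u q where mm: "m = (p, u, q)" by (cases m) auto
  have s: "start u p \<in> verts G" "u \<in> verts G"
    using m by (auto simp: mm path_to_verts)
  show ?thesis
  proof (cases g)
    case (Vertex v)
    then show ?thesis using V_monomial[of p u q v] m g by (auto simp: mm lpa_gens_def)
  next
    case (Edge e)
    then have e: "e \<in> arcs G" using g by (auto simp: lpa_gens_def)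
    have "X e * monomial m \<approx> (X e * V (head G e)) * monomial m"
      using m e by (intro eqv_mult_right eqv_sym[OF eqv_X_V]) auto
    also have "\<dots> \<approx> X e * (if start u p = head G e then monomial m else 0)"
      unfolding mult.assoc mm using m e by (intro eqv_mult_left V_monomial) (auto simp: mm)
    finally show ?thesis by (auto simp: Edge mm monomial_Cons)
  next
    case (Ghost e)
    then have e: "e \<in> arcs G" using g by (auto simp: lpa_gens_def)
    show ?thesis
    proof (cases p)
      case Nil
      have "Y e * monomial m \<approx> (Y e * V (tail G e)) * monomial m"
        using m e by (intro eqv_mult_right eqv_sym[OF eqv_Y_V]) auto
      also have "\<dots> \<approx> Y e * (if start u p = tail G e then monomial m else 0)"
        unfolding mult.assoc mm using m e by (intro eqv_mult_left V_monomial) (auto simp: mm)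
      finally have 1: "Y e * monomial m \<approx> Y e * (if u = tail G e then monomial m else 0)"
        by (simp add: Nil)
      show ?thesis
      proof (cases "u = tail G e")
        case True
        let ?q = "word (map Ghost (rev q)) :: ('v, 'e) lpa_gen free_mon \<Rightarrow>\<^sub>0 'k"
        have q: "?q \<in> Fr" if "q \<noteq> []" using m that by (auto simp: mm lpa_gens_def path_to_arcs)
        have mono: "monomial m = V u * ?q"
          by (simp add: mm Nil monomial_def free_gen_word word_mult)
        have "Y e * V u \<approx> V (head G e) * Y e"
          using eqv_Y_V[OF e] eqv_V_Y[OF e] True eqv_trans eqv_sym by metis
        then have "(Y e * V u) * ?q \<approx> (V (head G e) * Y e) * ?q"
          using q by (cases "q = []") (auto intro: eqv_mult_right simp: word_def simp flip: zero_free_mon_def)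
        then have "Y e * monomial m \<approx> monomial ([], head G e, q @ [e])"
          unfolding mono by (simp add: mult.assoc monomial_def free_gen_word word_mult)
        then show ?thesis using Ghost True by (simp add: mm Nil)
      next
        case False
        then show ?thesis using 1 Ghost by (simp add: mm Nil)
      qed
    next
      case (Cons f p')
      then have f: "f \<in> arcs G" and v: "valid (p', u, q)" and st: "start u p' = head G f"
        using m by (auto simp: mm Cons)
      have "Y e * monomial m = (Y e * X f) * monomial (p', u, q)"
        by (simp add: mm Cons monomial_Cons mult.assoc)
      also have "\<dots> \<approx> (if e = f then V (head G e) else 0) * monomial (p', u, q)"
        using v e f by (intro eqv_mult_right eqv_Y_X) auto
      also have "\<dots> \<approx> (if e = f then monomial (p', u, q) else 0)"
        using V_start_monomial[OF v] st by auto
      finally show ?thesis using Ghost by (auto simp: mm Cons)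
    qed
  qed
qed

lemma word_eqv_nf:
  assumes "w \<noteq> []" "set w \<subseteq> lpa_gens G"
  shows "word w \<approx> opt_monomial (nf w)"
  using assms
proof (induction w rule: list_nonempty_induct)
  case (single g)
  then show ?case
    using eqv_sym[OF eqv_X_V] eqv_sym[OF eqv_V_Y]
    by (cases g) (auto simp: monomial_def lpa_gens_def free_gen_word word_mult)
next
  case (cons g w)
  have "word (g # w) = free_gen g * word w" by (simp add: free_gen_word word_mult)
  also have "\<dots> \<approx> free_gen g * opt_monomial (nf w)"
    using cons by (intro eqv_mult_left) (auto simp: free_gen_word)
  also have "\<dots> \<approx> opt_monomial (nf (g # w))"
  proof (cases "nf w")
    case None
    then show ?thesis using cons by (simp add: nf_Cons)
  next
    case (Some m)
    then show ?thesis using cons valid_nf[OF _ Some] gen_mult_monomial[of m g] by (simp add: nf_Cons)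
  qed
  finally show ?case .
qed

section \<open>The trace and its values on the relation ideal\<close>

definition tr :: "(('v, 'e) lpa_gen free_mon \<Rightarrow>\<^sub>0 'k) \<Rightarrow> 'v option \<Rightarrow> 'k" where
  "tr f x = lin (\<lambda>w. if Option.bind (nf (letters w)) trace_class = Some x then 1 else 0) f"

text \<open>The trace descends to \<open>L\<close> only modulo this subspace; membership replaces
  the passage to a quotient space of values.\<close>

definition null_traces :: "('v option \<Rightarrow> 'k) set" where
  "null_traces = {h. h None = 0 \<and> (\<lambda>v. h (Some v)) \<in> cuntz_krieger_span G}"

lemma tr_add: "tr (f + g) = (\<lambda>x. tr f x + tr g x)"
  and tr_diff: "tr (f - g) = (\<lambda>x. tr f x - tr g x)"
  and tr_scale: "tr (sc c f) = (\<lambda>x. c * tr f x)"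
  and tr_zero: "tr 0 = (\<lambda>x. 0)"
  and tr_sum: "tr (sum h B) = (\<lambda>x. \<Sum>b\<in>B. tr (h b) x)"
  by (auto simp: tr_def lin_add lin_diff lin_scale lin_sum)

lemma tr_word: "tr (word w) = (\<lambda>x. if Option.bind (nf w) trace_class = Some x then 1 else 0)"
  by (auto simp: tr_def word_def)

lemma null_traces_add: "g \<in> null_traces \<Longrightarrow> h \<in> null_traces \<Longrightarrow> (\<lambda>x. g x + h x) \<in> null_traces"
  and null_traces_scale: "h \<in> null_traces \<Longrightarrow> (\<lambda>x. c * h x) \<in> null_traces"
  and null_traces_zero: "(\<lambda>x. 0) \<in> null_traces"
  using cuntz_krieger_span_add[OF wf_digraph_axioms] cuntz_krieger_span_scale cuntz_krieger_span_zero
  by (auto simp: null_traces_def)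

lemma tr_null_subspace: "fa.subspace {f. tr f \<in> null_traces}"
  by (rule fa.subspaceI) (auto simp: tr_add tr_scale tr_zero null_traces_add null_traces_scale null_traces_zero)

lemma tr_null_mult_subspace: "fa.subspace {a. tr (f * a) \<in> null_traces}"
  by (rule fa.subspaceI) (auto simp: distrib_left mult_scalar_left tr_add tr_scale tr_zero
      null_traces_add null_traces_scale null_traces_zero)

lemma tr_commute:
  assumes "f \<in> Fr" "g \<in> Fr"
  shows "tr (f * g) = tr (g * f)"
proof -
  have "Fr \<subseteq> {g. tr (word xs * g) = tr (g * word xs)}" if "xs \<noteq> []" "set xs \<subseteq> lpa_gens G" for xs
    using that by (intro Fr_subset_subspace fa.subspaceI)
      (auto simp: tr_add tr_scale tr_zero distrib_left distrib_right mult_scalar_left mult.assoc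
        tr_word word_mult trace_class_nf_rotate[of xs])
  then have "Fr \<subseteq> {f. tr (f * g) = tr (g * f)}"
    using assms by (intro Fr_subset_subspace fa.subspaceI)
      (auto simp: tr_add tr_scale tr_zero distrib_left distrib_right mult_scalar_left mult.assoc)
  then show ?thesis using assms by auto
qed

text \<open>Except for the sum relation, both sides of a relation have the same normal form,
  possibly \<open>0\<close>, also after multiplication by a word. For \<open>v - \<Sum> ee^*\<close>
  and \<open>nf a = Some (p, u, q)\<close>: if \<open>p\<close> begins with an edge from
  \<open>v\<close>, only the summand of that edge survives and cancels the term of \<open>v\<close>;
  if it begins elsewhere, all terms vanish. If \<open>p\<close> is empty, traces remain only for
  \<open>u = v\<close> and \<open>q = []\<close>, and they form the generator of the span at
  \<open>v\<close>.\<close>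

lemma tr_null_relation:
  assumes r: "r \<in> lpa_relations G" and a: "set a \<subseteq> lpa_gens G" "a \<noteq> []"
  shows "tr (r * word a) \<in> null_traces" "tr r \<in> null_traces"
proof -
  have *: "tr (r * word a) \<in> null_traces \<and> tr r \<in> null_traces"
    if "r = word w - word w'" "nf (w @ a) = nf (w' @ a)" "nf w = nf w'" for w w'
    using that by (simp add: left_diff_distrib word_mult tr_diff tr_word null_traces_zero)
  have **: "tr (r * word a) \<in> null_traces \<and> tr r \<in> null_traces"
    if "r = word w" "nf (w @ a) = None" "nf w = None" for w
    using that by (simp add: word_mult tr_word null_traces_zero)
  have nf2: "nf (g # a) = (case nf a of None \<Rightarrow> None | Some (p, u, q) \<Rightarrow> left_mult g (p, u, q))"
    "nf (g # h # a) = (case nf a of None \<Rightarrow> None | Some (p, u, q) \<Rightarrow> Option.bind (left_mult h (p, u, q)) (left_mult g))"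
    "free_gen g = word [g]" "word [g] * word [h] = word [g, h]" for g h
    using a by (auto simp: nf_Cons free_gen_word word_mult split: option.splits)
  have val: "valid m" if "nf a = Some m" for m using valid_nf that a by auto
  have "tr (r * word a) \<in> null_traces \<and> tr r \<in> null_traces"
    using r unfolding lpa_relations_def Let_def
  proof (elim UnE CollectE exE conjE)
    fix v v' assume r: "r = V v * V v' - (if v = v' then V v else 0)"
    show ?thesis
    proof (cases "v = v'")
      case True
      show ?thesis
        by (rule *[of "[Vertex v, Vertex v]" "[Vertex v]"]) (use a r True in \<open>auto simp: nf2 split: option.splits\<close>)
    next
      case False
      show ?thesis
        by (rule **[of "[Vertex v, Vertex v']"]) (use a r False in \<open>auto simp: nf2 split: option.splits\<close>)
    qed
  next
    fix e assume r: "r = V (tail G e) * X e - X e"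
    show ?thesis
      by (rule *[of "[Vertex (tail G e), Edge e]" "[Edge e]"]) (use a r in \<open>auto simp: nf2 split: list.splits option.splits\<close>)
  next
    fix e assume r: "r = X e * V (head G e) - X e"
    show ?thesis
      by (rule *[of "[Edge e, Vertex (head G e)]" "[Edge e]"]) (use a r in \<open>auto simp: nf2 split: list.splits option.splits\<close>)
  next
    fix e assume r: "r = V (head G e) * Y e - Y e"
    show ?thesis
      by (rule *[of "[Vertex (head G e), Ghost e]" "[Ghost e]"]) (use a r val in \<open>auto simp: nf2 split: list.splits option.splits\<close>)
  next
    fix e assume r: "r = Y e * V (tail G e) - Y e"
    show ?thesis
      by (rule *[of "[Ghost e, Vertex (tail G e)]" "[Ghost e]"]) (use a r in \<open>auto simp: nf2 split: list.splits option.splits\<close>)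
  next
    fix e f assume r: "r = Y e * X f - (if e = f then V (head G e) else 0)"
    show ?thesis
    proof (cases "e = f")
      case True
      show ?thesis
        by (rule *[of "[Ghost e, Edge e]" "[Vertex (head G e)]"]) (use a r True in \<open>auto simp: nf2 split: option.splits\<close>)
    next
      case False
      show ?thesis
        by (rule **[of "[Ghost e, Edge f]"]) (use a r False in \<open>auto simp: nf2 split: option.splits\<close>)
    qed
  next
    fix v assume r: "r = V v - (\<Sum>e\<in>out_arcs G v. X e * Y e)" and v: "v \<in> regular_verts G"
    have tr_r_word: "tr (r * word b) = (\<lambda>x. tr (word (Vertex v # b)) x - (\<Sum>e\<in>out_arcs G v. tr (word (Edge e # Ghost e # b)) x))" for b
      by (simp add: r left_diff_distrib sum_distrib_right tr_diff tr_sum free_gen_word word_mult)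
    \<comment> \<open>The empty word is the unit of the ambient algebra, so the formula for
      \<open>r * word b\<close> with \<open>b = []\<close> also computes
      \<open>tr r\<close>.\<close>
    have one: "word [] = (1 :: ('v, 'e) lpa_gen free_mon \<Rightarrow>\<^sub>0 'k)"
      by (simp add: word_def flip: zero_free_mon_def)
    have gen: "(\<lambda>x. (if Some v = x then 1 else 0) - (\<Sum>e\<in>out_arcs G v. if Some (head G e) = x then 1 else 0)) \<in> null_traces"
    proof -
      have "(\<lambda>x. (if v = x then 1 else 0) - (\<Sum>e\<in>out_arcs G v. if head G e = x then 1 else 0)) =
          (\<lambda>x. unit_fun v x - (\<Sum>e\<in>out_arcs G v. unit_fun (head G e) x) :: 'k)"
        by (intro ext arg_cong2[of _ _ _ _ minus] sum.cong) auto
      then show ?thesis using cuntz_krieger_span_generator[OF v, where 'k = 'k]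
        by (simp add: null_traces_def)
    qed
    have "tr r = tr (r * word [])" by (simp add: one)
    also have "\<dots> \<in> null_traces"
      unfolding tr_r_word using gen by (simp add: tr_word trace_class_def)
    finally have tr_r: "tr r \<in> null_traces" .
    have "tr (r * word a) \<in> null_traces"
    proof (cases "nf a")
      case None
      then show ?thesis unfolding tr_r_word using a by (simp add: tr_word nf_Cons null_traces_zero)
    next
      case (Some m)
      obtain p u q where m: "m = (p, u, q)" by (cases m) auto
      show ?thesis
      proof (cases p)
        case (Cons f p')
        then have f: "f \<in> arcs G" "start u p' = head G f"
          using val[OF Some] by (auto simp: m Cons)
        have nfs: "nf (Edge e # Ghost e # a) = (if e = f then nf a else None)"
          "nf (Vertex v # a) = (if f \<in> out_arcs G v then nf a else None)" for e
          using a Some f by (simp_all add: nf_Cons m Cons)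
        have "tr (word (Edge e # Ghost e # a)) x = (if e = f then tr (word a) x else 0)" for e x
          by (simp add: tr_word nfs del: nf.simps)
        moreover have "tr (word (Vertex v # a)) x = (if f \<in> out_arcs G v then tr (word a) x else 0)" for x
          by (simp add: tr_word nfs del: nf.simps)
        ultimately have "tr (r * word a) = (\<lambda>x. 0)"
          unfolding tr_r_word using regular_finite_out_arcs[OF v] by (simp add: sum.delta)
        then show ?thesis by (simp add: null_traces_zero)
      next
        case Nil
        have V: "nf (Vertex v # a) = (if u = v then Some ([], v, q) else None)"
          using a Some by (simp add: nf_Cons m Nil)
        have E: "nf (Edge e # Ghost e # a) = (if u = v then Some ([e], head G e, q @ [e]) else None)"
          if "e \<in> out_arcs G v" for e
          using a Some that by (auto simp add: nf_Cons m Nil)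
        have E': "tr (word (Edge e # Ghost e # a)) = (\<lambda>x. if u = v \<and> q = [] \<and> Some (head G e) = x then 1 else 0)"
          if "e \<in> out_arcs G v" for e
          unfolding tr_word E[OF that]
          by (auto simp: trace_class_def fun_eq_iff append_eq_Cons_conv take_Cons')
        have V': "tr (word (Vertex v # a)) = (\<lambda>x. if u = v \<and> q = [] \<and> Some v = x then 1 else 0)"
          unfolding tr_word V by (auto simp: trace_class_def fun_eq_iff)
        have "tr (r * word a) = (\<lambda>x. (if u = v \<and> q = [] \<and> Some v = x then 1 else 0) -
            (\<Sum>e\<in>out_arcs G v. if u = v \<and> q = [] \<and> Some (head G e) = x then 1 else 0))"
          unfolding tr_r_word V' by (intro ext arg_cong2[of _ _ _ _ minus] sum.cong) (simp_all only: E')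
        then show ?thesis using gen null_traces_zero by (cases "u = v \<and> q = []") (auto cong: if_cong)
      qed
    qed
    then show ?thesis using tr_r by simp
  qed
  then show "tr (r * word a) \<in> null_traces" "tr r \<in> null_traces" by auto
qed

lemma tr_rel_ideal:
  assumes "f \<in> rel_ideal"
  shows "tr f \<in> null_traces"
proof -
  \<comment> \<open>\<open>?N\<close> is a two-sided ideal because
    \<open>tr (a * f * b) = tr (f * b * a)\<close>. The condition on \<open>tr f\<close> is separate
    because \<open>Fr\<close> omits the constants.\<close>
  let ?N = "{f \<in> Fr. tr f \<in> null_traces \<and> (\<forall>a\<in>Fr. tr (f * a) \<in> null_traces)}"
  have "rel_ideal \<subseteq> ?N"
  proof (rule rel_ideal_minimal)
    show "fa.subspace ?N"
      by (rule fa.subspaceI) (auto simp: distrib_right mult.assoc tr_add tr_scale tr_zero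
        null_traces_add null_traces_scale null_traces_zero)
    show "a * f \<in> ?N" if a: "a \<in> Fr" and f: "f \<in> ?N" for a f
    proof -
      have "tr (a * f * b) \<in> null_traces" if "b \<in> Fr" for b
        using a f that tr_commute[of a "f * b"] by (auto simp: mult.assoc)
      then show ?thesis using a f tr_commute[of a f] by auto
    qed
    show "f * a \<in> ?N" if a: "a \<in> Fr" and f: "f \<in> ?N" for a f
      using a f by (auto simp: mult.assoc)
    show "lpa_relations G \<subseteq> ?N"
    proof
      fix r :: "('v, 'e) lpa_gen free_mon \<Rightarrow>\<^sub>0 'k" assume r: "r \<in> lpa_relations G"
      then have "Fr \<subseteq> {a. tr (r * a) \<in> null_traces}"
        using tr_null_relation(1)[OF r] by (intro Fr_subset_subspace tr_null_mult_subspace) auto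
      \<comment> \<open>\<open>tr_null_relation\<close> asks for a nonempty word as multiplier,
        which exists only if there is a generator.\<close>
      moreover have "tr r \<in> null_traces"
      proof (cases "lpa_gens G = {}")
        case True
        then have "Fr = {0}" using Fr_span_words by auto
        then show ?thesis using r relations_subset by (auto simp: tr_zero null_traces_zero)
      next
        case False
        then obtain g where "g \<in> lpa_gens G" by blast
        then show ?thesis using tr_null_relation(2)[OF r, of "[g]"] by auto
      qed
      ultimately show "r \<in> ?N" using r relations_subset by auto
    qed
  qed auto
  then show ?thesis using assms by auto
qed

end

section \<open>The commutator subspace\<close>

context leavitt
begin

lemma subspace_eqv_closed:
  assumes "fa.subspace U" "rel_ideal \<subseteq> U" "f \<approx> g"
  shows "f \<in> U \<longleftrightarrow> g \<in> U"
proof -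
  have "f - g \<in> U" "g - f \<in> U" using assms(2,3) eqv_sym[OF assms(3)] by (auto simp: eqv_def)
  then show ?thesis
    using fa.subspace_add[OF assms(1), of "f - g" g] fa.subspace_add[OF assms(1), of "g - f" f] by auto
qed

text \<open>The preimage of \<open>[L, L]\<close> in the free algebra.\<close>

definition comm_span :: "(('v, 'e) lpa_gen free_mon \<Rightarrow>\<^sub>0 'k) set" where
  "comm_span = fa.span ({a * b - b * a |a b. a \<in> Fr \<and> b \<in> Fr} \<union> rel_ideal)"

lemma comm_span_subspace: "fa.subspace comm_span"
  by (simp add: comm_span_def)

lemma rel_ideal_comm_span: "rel_ideal \<subseteq> comm_span"
  unfolding comm_span_def by (auto intro: fa.span_base)

lemma commutator_comm_span: "a \<in> Fr \<Longrightarrow> b \<in> Fr \<Longrightarrow> a * b - b * a \<in> comm_span"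
  unfolding comm_span_def by (auto intro!: fa.span_base)

lemma comm_span_subset: "comm_span \<subseteq> Fr"
  unfolding comm_span_def by (rule fa.span_minimal[OF _ Fr_subspace]) auto

lemma tr_comm_span: "f \<in> comm_span \<Longrightarrow> tr f \<in> null_traces"
proof -
  have "comm_span \<subseteq> {f. tr f \<in> null_traces}"
    unfolding comm_span_def
    by (rule fa.span_minimal[OF _ tr_null_subspace]) (auto simp: tr_diff tr_commute null_traces_zero tr_rel_ideal)
  then show "f \<in> comm_span \<Longrightarrow> tr f \<in> null_traces" by auto
qed

lemma tr_V: "tr (V u) = (\<lambda>x. if x = Some u then 1 else 0)"
  by (auto simp: free_gen_word tr_word trace_class_def)

lemma V_comm_span_unit_fun:
  assumes "V u \<in> comm_span"
  shows "(unit_fun u :: 'v \<Rightarrow> 'k) \<in> cuntz_krieger_span G"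
  using tr_comm_span[OF assms] by (simp add: tr_V null_traces_def)

lemma nf_path: "path_to u p \<Longrightarrow> p \<noteq> [] \<Longrightarrow> nf (map Edge p) = Some (p, u, [])"
  by (induction p rule: induct_list012) auto

text \<open>Preimages in the free algebra of those ideals of \<open>L\<close> that are
  subspaces.\<close>

definition is_ideal where
  "is_ideal U \<longleftrightarrow> fa.subspace U \<and> rel_ideal \<subseteq> U \<and> U \<subseteq> Fr \<and>
     (\<forall>u\<in>U. \<forall>a\<in>Fr. u * a \<in> U \<and> a * u \<in> U)"

lemma is_idealD:
  assumes "is_ideal U"
  shows "fa.subspace U" "rel_ideal \<subseteq> U" "U \<subseteq> Fr" "u \<in> U \<Longrightarrow> a \<in> Fr \<Longrightarrow> u * a \<in> U" "u \<in> U \<Longrightarrow> a \<in> Fr \<Longrightarrow> a * u \<in> U"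
    "f \<approx> g \<Longrightarrow> f \<in> U \<longleftrightarrow> g \<in> U"
  using assms subspace_eqv_closed[of U f g] by (auto simp: is_ideal_def)

lemma ideal_with_vertices:
  assumes U: "is_ideal U" and V: "\<And>v. v \<in> verts G \<Longrightarrow> V v \<in> U"
  shows "U = Fr"
proof
  note D = is_idealD[OF U]
  show "U \<subseteq> Fr" by (rule D(3))
  show "Fr \<subseteq> U"
  proof (rule Fr_subset_subalgebra[OF D(1)])
    show "f * g \<in> U" if "f \<in> U" "g \<in> U" for f g using that D by auto
    fix x assume x: "x \<in> lpa_gens G"
    show "free_gen x \<in> U"
    proof (cases x)
      case (Edge e)
      then have "e \<in> arcs G" using x by (auto simp: lpa_gens_def)
      then have "V (tail G e) * X e \<in> U" using V D by auto
      then show ?thesis using D(6)[OF eqv_V_X[OF \<open>e \<in> arcs G\<close>]] Edge by simp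
    next
      case (Ghost e)
      then have "e \<in> arcs G" using x by (auto simp: lpa_gens_def)
      then have "V (head G e) * Y e \<in> U" using V D by auto
      then show ?thesis using D(6)[OF eqv_V_Y[OF \<open>e \<in> arcs G\<close>]] Ghost by simp
    qed (use x V in \<open>auto simp: lpa_gens_def\<close>)
  qed
qed

end

section \<open>Consequences of the hypothesis that Lie ideals are ideals\<close>

locale lie_ideal_leavitt = leavitt G K for G :: "('v, 'e) pre_digraph" and K :: "'k::field itself" +
  assumes lie_ideals: "lie_ideal (minus_lie L) U \<Longrightarrow> ring_ideal L U"
    and nondegenerate: "arcs G \<noteq> {} \<or> (\<exists>u\<in>verts G. \<exists>v\<in>verts G. u \<noteq> v)"
begin

lemma lie_ideal_is_ideal:
  assumes U: "fa.subspace U" "rel_ideal \<subseteq> U" "U \<subseteq> Fr" and lie: "\<And>u x. u \<in> U \<Longrightarrow> x \<in> Fr \<Longrightarrow> u * x - x * u \<in> U"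
  shows "is_ideal U"
proof -
  have "lie_ideal (minus_lie L) (cls ` U)"
    unfolding lie_ideal_def minus_lie_simps L_carrier
  proof (intro conjI ballI subspace_image U)
    fix u x assume "u \<in> cls ` U" "x \<in> cls ` Fr"
    then obtain u' x' where "u' \<in> U" "x' \<in> Fr" "u = cls u'" "x = cls x'" by auto
    then show "alg_mult (minus_lie L) u x \<in> cls ` U" using lie U by auto
  qed
  then have ideal: "ring_ideal L (cls ` U)" by (rule lie_ideals)
  have "u * a \<in> U \<and> a * u \<in> U" if u: "u \<in> U" and a: "a \<in> Fr" for u a
  proof -
    have "u \<in> Fr" using u U by auto
    moreover have "alg_mult L (cls u) (cls a) \<in> cls ` U" "alg_mult L (cls a) (cls u) \<in> cls ` U"
      using ideal u a by (auto simp: ring_ideal_def L_carrier)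
    ultimately have "cls (u * a) \<in> cls ` U" "cls (a * u) \<in> cls ` U" using a by auto
    then obtain f g where fg: "f \<in> U" "g \<in> U" "cls (u * a) = cls f" "cls (a * u) = cls g" by auto
    then have "f \<in> Fr" "g \<in> Fr" using U by auto
    with fg have "u * a \<approx> f" "a * u \<approx> g" using \<open>u \<in> Fr\<close> a by (auto simp: cls_eq_iff)
    then show ?thesis using subspace_eqv_closed[OF U(1,2)] fg by blast
  qed
  then show ?thesis using U by (auto simp: is_ideal_def)
qed

lemma comm_span_superspace_ideal:
  assumes "fa.subspace U" "comm_span \<subseteq> U" "U \<subseteq> Fr"
  shows "is_ideal U"
proof (rule lie_ideal_is_ideal[OF assms(1) _ assms(3)])
  show "u * x - x * u \<in> U" if "u \<in> U" "x \<in> Fr" for u x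
    using commutator_comm_span[of u x] that assms by auto
qed (use assms rel_ideal_comm_span in auto)

lemma is_ideal_comm_span: "is_ideal comm_span"
  using comm_span_subspace comm_span_subset by (intro comm_span_superspace_ideal) auto

lemma insert_comm_span_ideal:
  assumes "f \<in> Fr"
  shows "is_ideal (fa.span (insert f comm_span))"
  using assms comm_span_subset fa.span_superset[of "insert f comm_span"]
  by (intro comm_span_superspace_ideal fa.span_minimal Fr_subspace fa.subspace_span) auto

lemma insert_comm_span_iff:
  "g \<in> fa.span (insert f comm_span) \<longleftrightarrow> (\<exists>k. g - sc k f \<in> comm_span)"
proof -
  have "fa.span comm_span = comm_span" using comm_span_subspace by simp
  from fa.span_breakdown_eq[of g f comm_span, unfolded this] show ?thesis .
qed

text \<open>The span of \<open>[L, L]\<close> and \<open>w = u + v\<close> is an ideal, so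
  \<open>u w = u\<close> is congruent to some \<open>k w\<close> modulo \<open>[L, L]\<close>. If
  \<open>k = 0\<close>, then \<open>u\<close> lies in \<open>[L, L]\<close>; otherwise
  multiplication by \<open>v\<close> puts \<open>k v\<close> there, because
  \<open>v u = 0\<close>.\<close>

lemma one_vertex_outside_comm_span:
  assumes "u \<in> verts G" "v \<in> verts G" "u \<noteq> v"
  shows "V u \<in> comm_span \<or> V v \<in> comm_span"
proof -
  note D = is_idealD[OF is_ideal_comm_span]
  let ?w = "V u + V v"
  have "?w \<in> fa.span (insert ?w comm_span)" by (simp add: fa.span_base)
  then have "V u * ?w \<in> fa.span (insert ?w comm_span)"
    using is_idealD(5)[OF insert_comm_span_ideal[of ?w]] assms by simp
  then obtain k where k: "V u * ?w - sc k ?w \<in> comm_span"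
    using insert_comm_span_iff by blast
  have 1: "V u * ?w \<approx> V u" "V v * ?w \<approx> V v" "V v * V u \<approx> 0"
    using eqv_add[OF eqv_V_V[of u u] eqv_V_V[of u v]] eqv_add[OF eqv_V_V[of v u] eqv_V_V[of v v]]
      eqv_V_V[of v u] assms by (auto simp: distrib_left)
  show ?thesis
  proof (cases "k = 0")
    case True
    then have "V u * ?w \<in> comm_span" using k by simp
    then show ?thesis using D(6)[OF 1(1)] by simp
  next
    case False
    have "V v * (V u * ?w) \<approx> 0"
      using eqv_mult_right[OF _ 1(3), of ?w] assms by (simp add: mult.assoc)
    then have "V v * (V u * ?w) - sc k (V v * ?w) \<approx> 0 - sc k (V v)"
      by (intro eqv_diff eqv_scale 1)
    moreover have "V v * (V u * ?w - sc k ?w) \<in> comm_span"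
      using D(5)[OF k] assms by simp
    ultimately have "0 - sc k (V v) \<in> comm_span"
      using D(6) by (simp add: right_diff_distrib mult_scalar_left)
    then have "sc (- inverse k) (0 - sc k (V v)) \<in> comm_span"
      by (rule fa.subspace_scale[OF D(1)])
    moreover have "sc (- inverse k) (0 - sc k (V v)) = V v"
      using False by (simp add: mult.assoc[symmetric] mult_single single_uminus)
    ultimately show ?thesis by simp
  qed
qed

lemma comm_span_codim:
  assumes "f \<in> Fr"
  shows "f \<in> comm_span \<or> (\<exists>k v. f - sc k (V v) \<in> comm_span)"
proof (cases "\<forall>v\<in>verts G. V v \<in> comm_span")
  case True
  then show ?thesis using ideal_with_vertices[OF is_ideal_comm_span] assms by auto
next
  case False
  then obtain v where v: "v \<in> verts G" "V v \<notin> comm_span" by auto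
  have "V u \<in> fa.span (insert (V v) comm_span)" if "u \<in> verts G" for u
    using that one_vertex_outside_comm_span[OF v(1) that] v(2) by (cases "u = v") (auto intro: fa.span_base)
  then have "fa.span (insert (V v) comm_span) = Fr"
    using v by (intro ideal_with_vertices insert_comm_span_ideal) auto
  then show ?thesis using assms insert_comm_span_iff by blast
qed

text \<open>The coordinate \<open>None\<close> of the trace vanishes on \<open>[L, L]\<close> and on
  vertices, hence everywhere, since \<open>[L, L]\<close> and at most one vertex span the algebra.
  On a closed path of positive length it is \<open>1\<close>.\<close>

lemma acyclic: "acyclic_graph G"
  unfolding acyclic_graph_def
proof clarify
  fix u p assume p: "awalk u p u" "1 \<le> length p"
  then have "p \<noteq> []" "path_to u p" "start u p = u" by (auto simp: awalk_iff_path_to)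
  then have "nf (map Edge p) = Some (p, u, [])" using nf_path by auto
  then have tr: "tr (word (map Edge p)) None = 1"
    using \<open>start u p = u\<close> \<open>p \<noteq> []\<close> by (simp add: tr_word trace_class_def)
  have "word (map Edge p) \<in> Fr"
    using \<open>p \<noteq> []\<close> \<open>path_to u p\<close> by (auto simp: lpa_gens_def path_to_arcs)
  then consider "word (map Edge p) \<in> comm_span" | k v where "word (map Edge p) - sc k (V v) \<in> comm_span"
    using comm_span_codim by blast
  then have "tr (word (map Edge p)) None = 0"
    by cases (auto dest!: tr_comm_span simp: null_traces_def tr_diff tr_scale tr_V)
  then show False using tr by simp
qed

lemma no_loop: "e \<in> arcs G \<Longrightarrow> tail G e \<noteq> head G e"
  using acyclic_closed_awalk[OF acyclic, of "tail G e" "[e]"] by (auto simp: awalk_simps)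

text \<open>\<open>e = [s(e), e]\<close>, since \<open>e s(e) = 0\<close> when \<open>e\<close> is
  not a loop.\<close>

lemma X_comm_span:
  assumes e: "e \<in> arcs G"
  shows "X e \<in> comm_span"
proof -
  have "X e * V (tail G e) \<approx> (X e * V (head G e)) * V (tail G e)"
    using e by (intro eqv_mult_right eqv_sym[OF eqv_X_V]) auto
  also have "\<dots> \<approx> X e * 0"
    unfolding mult.assoc using eqv_V_V[of "head G e" "tail G e"] no_loop[OF e] e
    by (intro eqv_mult_left) auto
  finally have "V (tail G e) * X e - X e * V (tail G e) \<approx> X e - 0"
    using eqv_V_X[OF e] by (intro eqv_diff) auto
  moreover have "V (tail G e) * X e - X e * V (tail G e) \<in> comm_span"
    using e by (intro commutator_comm_span) auto
  ultimately show ?thesis using is_idealD(6)[OF is_ideal_comm_span] by simp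
qed

lemma V_head_comm_span:
  assumes e: "e \<in> arcs G"
  shows "V (head G e) \<in> comm_span"
proof -
  have "Y e * X e \<in> comm_span"
    using is_idealD(5)[OF is_ideal_comm_span X_comm_span[OF e]] e by simp
  then show ?thesis using is_idealD(6)[OF is_ideal_comm_span eqv_Y_X[OF e e]] by simp
qed

text \<open>Membership forces regularity through the trace. Conversely \<open>[L, L]\<close> is an
  ideal containing all edges, hence also \<open>\<Sum> ee^*\<close>.\<close>

lemma V_comm_span_iff:
  assumes v: "v \<in> verts G"
  shows "V v \<in> comm_span \<longleftrightarrow> v \<in> regular_verts G"
proof
  assume "V v \<in> comm_span"
  then show "v \<in> regular_verts G"
    using unit_fun_span_regular(1)[OF acyclic v] V_comm_span_unit_fun by blast
next
  note D = is_idealD[OF is_ideal_comm_span]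
  assume v: "v \<in> regular_verts G"
  have "(\<Sum>e\<in>out_arcs G v. X e * Y e) \<in> comm_span"
    using X_comm_span D(4) by (intro fa.subspace_sum[OF D(1)]) auto
  then show "V v \<in> comm_span" using D(6)[OF eqv_V_sum[OF v]] by simp
qed

lemma nonregular_source:
  assumes "v \<in> verts G" "v \<notin> regular_verts G" "e \<in> arcs G"
  shows "head G e \<noteq> v"
  using V_head_comm_span[OF assms(3)] assms V_comm_span_iff by auto

lemma nonregular_unique:
  assumes "u \<in> verts G" "u \<notin> regular_verts G" "v \<in> verts G" "v \<notin> regular_verts G"
  shows "u = v"
  using one_vertex_outside_comm_span[of u v] V_comm_span_iff assms by auto

lemma regular_unit_fun: "u \<in> regular_verts G \<Longrightarrow> (unit_fun u :: 'v \<Rightarrow> 'k) \<in> cuntz_krieger_span G"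
  by (rule V_comm_span_unit_fun) (auto simp: V_comm_span_iff regular_verts_def)

lemma regular_verts_subset: "regular_verts G \<subseteq> verts G"
  by (auto simp: regular_verts_def)

lemma head_regular: "e \<in> arcs G \<Longrightarrow> head G e \<in> regular_verts G"
  using nonregular_source[of "head G e" e] by auto

lemma awalk_regular: "awalk u p w \<Longrightarrow> u \<in> regular_verts G \<Longrightarrow> w \<in> regular_verts G"
  by (cases p rule: rev_cases) (auto simp: awalk_simps awalk_append_ex head_regular)

text \<open>An edge has a regular range, and two distinct vertices cannot both be nonregular. Here
  \<open>nondegenerate\<close> enters: the graphs it excludes, the empty one and a single vertex
  without edges, have the algebras \<open>0\<close> and \<open>K\<close>, whose Lie ideals are
  ideals in every characteristic although they are finite-dimensional.\<close>

lemma regular_nonempty: "regular_verts G \<noteq> {}"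
  using nondegenerate head_regular nonregular_unique by blast

lemma CHAR_pos: "CHAR('k) > 0"
proof -
  obtain u where "u \<in> regular_verts G" using regular_nonempty by blast
  then show ?thesis
    using unit_fun_span_two_awalks(1)[OF acyclic _ regular_unit_fun[of u]] awalk_regular regular_verts_subset
    by blast
qed

text \<open>Parallel paths \<open>p\<close>, \<open>q\<close> followed by parallel paths
  \<open>r\<close>, \<open>s\<close> give \<open>pr\<close>, \<open>ps\<close> and
  \<open>qr\<close>. If \<open>ps = qr\<close>, one of \<open>p\<close> and \<open>q\<close> would
  be a prefix of the other.\<close>

lemma three_awalks:
  assumes u: "u \<in> regular_verts G"
  obtains w p1 p2 p3 where "awalk u p1 w" "awalk u p2 w" "awalk u p3 w" "distinct [p1, p2, p3]"
proof -
  have two: "\<exists>w p q. awalk u p w \<and> awalk u q w \<and> p \<noteq> q" if "u \<in> regular_verts G" for u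
    using that awalk_regular regular_verts_subset
    by (intro unit_fun_span_two_awalks(2)[OF acyclic _ regular_unit_fun]) auto
  obtain v p q where 1: "awalk u p v" "awalk u q v" "p \<noteq> q" using two[OF u] by blast
  then obtain w r s where 2: "awalk v r w" "awalk v s w" "r \<noteq> s" using two awalk_regular u by meson
  have "p @ s \<noteq> q @ r"
  proof
    assume "p @ s = q @ r"
    then obtain t where "p = q @ t \<or> q = p @ t" by (auto simp: append_eq_append_conv2)
    then show False using acyclic_parallel_awalks[OF acyclic] 1 by fastforce
  qed
  then show thesis using that[of "p @ r" w "p @ s" "q @ r"] 1 2
    by (auto simp: awalk_append_ex)
qed

end

section \<open>The three types of graphs\<close>

lemma acyclic_map:
  assumes "acyclic r" "\<And>x y. (x, y) \<in> r' \<Longrightarrow> (f x, f y) \<in> r"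
  shows "acyclic r'"
proof (rule acyclicI, clarify)
  fix x assume "(x, x) \<in> r'\<^sup>+"
  have "(x, y) \<in> r'\<^sup>+ \<Longrightarrow> (f x, f y) \<in> r\<^sup>+" for y
    by (induction rule: trancl_induct) (auto intro: assms(2) trancl_into_trancl)
  then show False using assms(1) \<open>(x, x) \<in> r'\<^sup>+\<close> by (auto simp: acyclic_def)
qed

context lie_ideal_leavitt
begin

lemma graph_type1I:
  assumes "verts G \<subseteq> regular_verts G"
  shows "graph_type1 CHAR('k) G"
  unfolding graph_type1_def
  using assms regular_unit_fun by (intro p_commutator_graphI acyclic) auto

text \<open>Deleting an isolated vertex changes neither the edges nor the regular vertices, so the
  two spans are the same set of functions.\<close>

lemma graph_type2I:
  assumes v: "v \<in> verts G" "isolated_vertex G v"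
  shows "graph_type2 CHAR('k) G"
proof -
  have [simp]: "arcs (del_vert v) = arcs G" "tail (del_vert v) = tail G" "head (del_vert v) = head G"
    using v by (auto simp: isolated_vertex_def del_vert_def)
  have vs: "verts (del_vert v) = verts G - {v}" by (simp add: del_vert_def)
  have [simp]: "out_arcs (del_vert v) = out_arcs G" by (auto simp: out_arcs_def)
  have nr: "v \<notin> regular_verts G" using v by (auto simp: regular_verts_def isolated_vertex_def)
  have reg: "regular_verts (del_vert v) = regular_verts G"
    using nr by (auto simp: regular_verts_def infinite_emitter_def vs)
  have wf: "wf_digraph (del_vert v)" by (rule wf_digraph_del_vert)
  have "acyclic_graph (del_vert v)"
    using acyclic wf_digraph.acyclic_graph_iff[OF wf] acyclic_graph_iff
    by (simp add: arcs_ends_def arc_to_ends_def)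
  moreover have "(cuntz_krieger_span (del_vert v) :: ('v \<Rightarrow> 'k) set) = cuntz_krieger_span G"
    unfolding cuntz_krieger_span_def reg by simp
  moreover have "u \<in> regular_verts G" if "u \<in> verts (del_vert v)" for u
    using that nonregular_unique[OF v(1) nr, of u] vs by auto
  ultimately have "p_commutator_graph CHAR('k) (del_vert v)"
    by (intro wf_digraph.p_commutator_graphI[OF wf]) (auto intro: regular_unit_fun)
  then show ?thesis using v by (auto simp: graph_type2_def)
qed

text \<open>The vertices other than \<open>v\<close> are exactly the regular ones and form
  \<open>H\<close>. For \<open>w \<in> H\<close> a representation of \<open>unit_fun w\<close> over
  \<open>G\<close> is supported in \<open>H\<close>, so it lifts to the porcupine graph with
  coefficient \<open>0\<close> on the new vertices. A new vertex emits a single edge, into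
  \<open>H\<close>, so its unit function differs from one of these by a generator of the
  span.\<close>

lemma graph_type3I:
  assumes v: "v \<in> verts G" "infinite_emitter G v"
  shows "graph_type3 CHAR('k) G"
proof -
  define H where "H = verts G - {v}"
  let ?P = "porcupine G H v"
  have nr: "v \<notin> regular_verts G" using v by (auto simp: regular_verts_def)
  have src: "head G e \<noteq> v" if "e \<in> arcs G" for e using nonregular_source[OF v(1) nr that] .
  have H: "H = regular_verts G"
    using nonregular_unique[OF v(1) nr] nr regular_verts_subset by (auto simp: H_def)
  have headH: "head G e \<in> H" if "e \<in> arcs G" for e using head_regular[OF that] H by simp
  have P: "verts ?P = Inl ` H \<union> Inr ` out_arcs G v"
    "arcs ?P = Inl ` {e \<in> arcs G. tail G e \<in> H} \<union> Inr ` out_arcs G v"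
    "tail ?P = case_sum (\<lambda>e. Inl (tail G e)) Inr"
    "head ?P = case_sum (\<lambda>e. Inl (head G e)) (\<lambda>e. Inl (head G e))"
    by (simp_all add: porcupine_def)
  have wf: "wf_digraph ?P"
    by unfold_locales (auto simp: P headH)
  have ac: "acyclic_graph ?P"
    unfolding wf_digraph.acyclic_graph_iff[OF wf]
  proof (rule acyclic_map)
    show "acyclic (arcs_ends G)" using acyclic acyclic_graph_iff by simp
    fix x y assume "(x, y) \<in> arcs_ends ?P"
    \<comment> \<open>Collapsing all new vertices to \<open>v\<close> maps edges to edges.\<close>
    then show "(case_sum id (\<lambda>_. v) x, case_sum id (\<lambda>_. v) y) \<in> arcs_ends G"
      by (auto simp: arcs_ends_def arc_to_ends_def P)
  qed
  have out_Inl: "out_arcs ?P (Inl w) = Inl ` out_arcs G w" if "w \<in> H" for w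
    using that by (auto simp: out_arcs_def P)
  have reg_Inl: "Inl w \<in> regular_verts ?P" if "w \<in> H" for w
  proof -
    have "out_arcs G w \<noteq> {}" "finite (out_arcs G w)"
      using that by (auto simp: H regular_verts_def infinite_emitter_def)
    then show ?thesis
      unfolding regular_verts_def infinite_emitter_def using that out_Inl[OF that] by (simp add: P)
  qed
  have out_Inr: "out_arcs ?P (Inr e) = {Inr e}" if "e \<in> out_arcs G v" for e
    using that by (auto simp: out_arcs_def P)
  have span_Inl: "(unit_fun (Inl w) :: 'v + 'e \<Rightarrow> 'k) \<in> cuntz_krieger_span ?P" if w: "w \<in> H" for w
  proof -
    obtain S and c :: "'v \<Rightarrow> 'k" where S: "finite S" "S \<subseteq> regular_verts G" "\<forall>v. v \<notin> S \<longrightarrow> c v = 0"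
      and c: "\<And>x. unit_fun w x = (\<Sum>e\<in>{e \<in> arcs G. tail G e \<in> S \<and> head G e = x}. c (tail G e)) - c x"
      using regular_unit_fun[of w] w H unfolding cuntz_krieger_span_def by blast
    have SH: "S \<subseteq> H" using S H by simp
    have "unit_fun (Inl w) x = (\<Sum>a\<in>{a \<in> arcs ?P. tail ?P a \<in> Inl ` S \<and> head ?P a = x}.
        case_sum c (\<lambda>_. 0) (tail ?P a)) - case_sum c (\<lambda>_. 0) x" for x
    proof (cases x)
      case (Inl y)
      have "{a \<in> arcs ?P. tail ?P a \<in> Inl ` S \<and> head ?P a = x} =
          Inl ` {e \<in> arcs G. tail G e \<in> S \<and> head G e = y}"
        using SH by (auto simp: P Inl)
      then show ?thesis using c[of y] by (simp add: sum.reindex Inl P)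
    next
      case (Inr e)
      then have no_arcs: "{a \<in> arcs ?P. tail ?P a \<in> Inl ` S \<and> head ?P a = x} = {}" by (auto simp: P)
      show ?thesis unfolding no_arcs by (simp add: Inr)
    qed
    moreover have "Inl ` S \<subseteq> regular_verts ?P" using reg_Inl SH by auto
    moreover have "\<forall>x. x \<notin> Inl ` S \<longrightarrow> case_sum c (\<lambda>_. 0) x = 0"
      using S(3) by (auto split: sum.splits)
    ultimately show ?thesis unfolding cuntz_krieger_span_def using S(1) by blast
  qed
  have span_Inr: "(unit_fun (Inr e) :: 'v + 'e \<Rightarrow> 'k) \<in> cuntz_krieger_span ?P" if e: "e \<in> out_arcs G v" for e
  proof -
    have "Inr e \<in> regular_verts ?P"
      using e by (auto simp: regular_verts_def infinite_emitter_def out_Inr P)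
    from cuntz_krieger_span_generator[OF this, where 'k = 'k]
    have "(\<lambda>x. unit_fun (Inr e) x - unit_fun (Inl (head G e)) x :: 'k) \<in> cuntz_krieger_span ?P"
      by (simp add: out_Inr[OF e] P)
    from cuntz_krieger_span_add[OF wf this span_Inl[of "head G e"]] show ?thesis
      using e head_regular H by auto
  qed
  have "p_commutator_graph CHAR('k) ?P"
    by (rule wf_digraph.p_commutator_graphI[OF wf ac]) (auto simp: P(1) span_Inl span_Inr)
  moreover have "hereditary G H"
    unfolding hereditary_def using awalk_regular H regular_verts_subset by auto
  moreover have "saturated G H" unfolding saturated_def H by auto
  moreover have "source_vertex G v" using src by (auto simp: source_vertex_def in_arcs_def)
  moreover have "\<forall>u\<in>verts G. infinite_emitter G u \<longrightarrow> u = v"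
    using nonregular_unique[OF _ _ v(1) nr] by (auto simp: regular_verts_def)
  moreover have "verts G = H \<union> {v}" "v \<notin> H" using v by (auto simp: H_def)
  moreover have "H \<noteq> {}" using H regular_nonempty by simp
  ultimately show ?thesis unfolding graph_type3_def using v(2) by blast
qed

lemma graph_types:
  "graph_type1 CHAR('k) G \<or> graph_type2 CHAR('k) G \<or> graph_type3 CHAR('k) G"
proof (cases "verts G \<subseteq> regular_verts G")
  case False
  then obtain v where v: "v \<in> verts G" "v \<notin> regular_verts G" by auto
  then have "in_arcs G v = {}" using nonregular_source by (auto simp: in_arcs_def)
  then have "isolated_vertex G v \<or> infinite_emitter G v"
    using v by (auto simp: regular_verts_def isolated_vertex_def)
  then show ?thesis using graph_type2I graph_type3I v by blast
qed (use graph_type1I in blast)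

end

section \<open>Local finiteness\<close>

context leavitt
begin

lemma span_Un_rel_ideal_cls:
  assumes "B \<subseteq> Fr" "f \<in> fa.span (B \<union> rel_ideal)"
  shows "cls f \<in> cls ` fa.span B"
proof -
  have span_rel_ideal: "fa.span rel_ideal = rel_ideal" using rel_ideal_subspace by simp
  obtain b i where bi: "b \<in> fa.span B" "i \<in> rel_ideal" "f = b + i"
    using assms(2) unfolding fa.span_Un span_rel_ideal by blast
  moreover have "b \<in> Fr" using bi fa.span_minimal[OF assms(1) Fr_subspace] by auto
  ultimately have "cls f = cls b" by (intro cls_eqI) (auto simp: eqv_def)
  then show ?thesis using bi by blast
qed

lemma span_eqv:
  assumes "f \<approx> g" "g \<in> fa.span (B \<union> rel_ideal)"
  shows "f \<in> fa.span (B \<union> rel_ideal)"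
proof -
  have "rel_ideal \<subseteq> fa.span (B \<union> rel_ideal)" by (auto intro: fa.span_base)
  then show ?thesis using assms subspace_eqv_closed[OF fa.subspace_span] by blast
qed

lemma span_subalgebra:
  assumes B: "B \<subseteq> Fr" "finite B" and mult: "\<And>a b. a \<in> B \<Longrightarrow> b \<in> B \<Longrightarrow> a * b \<in> fa.span (B \<union> rel_ideal)"
  shows "lie_subalgebra (minus_lie L) (cls ` fa.span B)" "alg_fin_dim (minus_lie L) (cls ` fa.span B)"
proof -
  let ?U = "fa.span (B \<union> rel_ideal)"
  have sub: "fa.span B \<subseteq> Fr" using B(1) Fr_subspace by (rule fa.span_minimal)
  have 1: "fa.span B \<subseteq> {x. a * x \<in> ?U}" if "a \<in> B" for a
    by (rule fa.span_minimal)
      (auto simp: mult that distrib_left mult_scalar_left intro!: fa.subspaceI fa.span_add fa.span_scale fa.span_zero)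
  have "fa.span B \<subseteq> {a. \<forall>x\<in>fa.span B. a * x \<in> ?U}"
    by (rule fa.span_minimal)
      (use 1 in \<open>auto simp: distrib_right mult.assoc intro!: fa.subspaceI fa.span_add fa.span_scale fa.span_zero\<close>)
  then have prod: "a * b - b * a \<in> ?U" if "a \<in> fa.span B" "b \<in> fa.span B" for a b
    using that by (auto intro!: fa.span_diff)
  show "lie_subalgebra (minus_lie L) (cls ` fa.span B)"
    unfolding lie_subalgebra_def minus_lie_simps
  proof (intro conjI ballI subspace_image fa.subspace_span sub)
    fix x y assume "x \<in> cls ` fa.span B" "y \<in> cls ` fa.span B"
    then obtain a b where ab: "a \<in> fa.span B" "b \<in> fa.span B" "x = cls a" "y = cls b" by auto
    then show "alg_mult (minus_lie L) x y \<in> cls ` fa.span B"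
      using sub span_Un_rel_ideal_cls[OF B(1) prod[of a b]] by (auto simp: subsetD)
  qed
  show "alg_fin_dim (minus_lie L) (cls ` fa.span B)"
    unfolding alg_fin_dim_def minus_lie_simps
    using B span_image[OF B(1)] fa.span_superset[of B] by (intro exI[of _ "cls ` B"]) auto
qed

definition monomials_over :: "'e set \<Rightarrow> 'v set \<Rightarrow> ('v, 'e) monomial set" where
  "monomials_over A0 V0 = {(p, u, q). valid (p, u, q) \<and> set p \<union> set q \<subseteq> A0 \<and> u \<in> V0}"

lemma finite_monomials_over:
  assumes "acyclic_graph G" "finite A0" "finite V0"
  shows "finite (monomials_over A0 V0)"
proof -
  let ?P = "{p. set p \<subseteq> A0 \<and> (\<exists>u v. awalk u p v)}"
  have "finite (?P \<times> V0 \<times> ?P)" using acyclic_finite_awalks[OF assms(1,2)] assms(3) by simp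
  then show ?thesis
    by (rule rev_finite_subset) (auto simp: monomials_over_def path_to_def)
qed

lemma nf_monomials_over:
  assumes "head G ` A0 \<subseteq> V0" "set w \<subseteq> lpa_gens G"
    "set w \<subseteq> Vertex ` V0 \<union> Edge ` A0 \<union> Ghost ` A0" "nf w = Some m"
  shows "m \<in> monomials_over A0 V0"
proof -
  have "set p \<union> set q \<subseteq> A0 \<and> u \<in> V0" if "nf w = Some (p, u, q)" for p u q
    using assms(1,3) that
  proof (induction w arbitrary: p u q)
    case (Cons g w)
    show ?case
    proof (cases "w = []")
      case True
      then show ?thesis using Cons by auto
    next
      case False
      then obtain p' u' q' where m: "nf w = Some (p', u', q')" "left_mult g (p', u', q') = Some (p, u, q)"
        using Cons.prems(3) by (auto simp: nf_Cons bind_eq_Some_conv)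
      then have "set p' \<union> set q' \<subseteq> A0 \<and> u' \<in> V0" using Cons by auto
      then show ?thesis using m(2) Cons.prems by (cases g) (auto split: if_splits list.splits)
    qed
  qed simp
  moreover have "valid m" using valid_nf assms by auto
  ultimately show ?thesis using assms(4) by (cases m) (auto simp: monomials_over_def)
qed

lemma word_span_monomials_over:
  assumes "head G ` A0 \<subseteq> V0" "w \<noteq> []" "set w \<subseteq> lpa_gens G"
    "set w \<subseteq> Vertex ` V0 \<union> Edge ` A0 \<union> Ghost ` A0"
  shows "word w \<in> fa.span (monomial ` monomials_over A0 V0 \<union> rel_ideal)"
  using word_eqv_nf[OF assms(2,3)]
proof (rule span_eqv)
  show "opt_monomial (nf w) \<in> fa.span (monomial ` monomials_over A0 V0 \<union> rel_ideal)"
    using nf_monomials_over[OF assms(1,3,4)] by (cases "nf w") (auto intro: fa.span_base fa.span_zero)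
qed

text \<open>Finitely many elements involve finitely many generators. Over finitely many edges and
  vertices there are only finitely many monomials, since paths in an acyclic graph repeat no edge,
  and these monomials span a subalgebra because the normal form of a product is again one of them or
  \<open>0\<close>.\<close>

lemma lie_locally_finite_minus_lie:
  assumes ac: "acyclic_graph G"
  shows "lie_locally_finite (minus_lie L)"
  unfolding lie_locally_finite_def minus_lie_simps L_carrier
proof (intro allI impI, elim conjE)
  fix Z assume Z: "finite Z" "Z \<subseteq> cls ` Fr"
  then obtain R where R: "finite R" "R \<subseteq> Fr" "Z = cls ` R" by (meson finite_subset_image)
  define \<Gamma> where "\<Gamma> = (\<Union>f\<in>R. \<Union>w\<in>Poly_Mapping.keys f. set (letters w))"
  have \<Gamma>: "finite \<Gamma>" "\<Gamma> \<subseteq> lpa_gens G" using R by (auto simp: \<Gamma>_def Fr_eq)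
  define A0 where "A0 = {e. Edge e \<in> \<Gamma> \<or> Ghost e \<in> \<Gamma>}"
  \<comment> \<open>Passing to normal forms introduces ranges of edges as middle vertices, so the
    heads of \<open>A0\<close> have to be included.\<close>
  define V0 where "V0 = {v. Vertex v \<in> \<Gamma>} \<union> head G ` A0"
  have "finite {e. Edge e \<in> \<Gamma>}" "finite {e. Ghost e \<in> \<Gamma>}" "finite {v. Vertex v \<in> \<Gamma>}"
    using finite_vimageI[OF \<Gamma>(1), of Edge] finite_vimageI[OF \<Gamma>(1), of Ghost] finite_vimageI[OF \<Gamma>(1), of Vertex]
    by (auto simp: vimage_def inj_on_def)
  then have fin: "finite A0" "finite V0" by (auto simp: A0_def V0_def)
  have arcs: "A0 \<subseteq> arcs G" "V0 \<subseteq> verts G" and \<Gamma>_sub: "\<Gamma> \<subseteq> Vertex ` V0 \<union> Edge ` A0 \<union> Ghost ` A0"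
    using \<Gamma>(2) by (auto simp: A0_def V0_def lpa_gens_def)
  have heads: "head G ` A0 \<subseteq> V0" by (simp add: V0_def)
  let ?B = "monomial ` monomials_over A0 V0"
  have B: "?B \<subseteq> Fr" by (auto simp: monomials_over_def)
  have finB: "finite ?B" using finite_monomials_over[OF ac fin] by simp
  have "a * b \<in> fa.span (?B \<union> rel_ideal)" if "a \<in> ?B" "b \<in> ?B" for a b
  proof -
    have "\<exists>w. a = word w \<and> w \<noteq> [] \<and> set w \<subseteq> lpa_gens G \<and> set w \<subseteq> Vertex ` V0 \<union> Edge ` A0 \<union> Ghost ` A0"
      if aB: "a \<in> ?B" for a
    proof -
      obtain m where m0: "m \<in> monomials_over A0 V0" "a = monomial m" using aB by blast
      obtain p u q where "m = (p, u, q)" by (cases m)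
      with m0 have m: "(p, u, q) \<in> monomials_over A0 V0" "a = monomial (p, u, q)" by simp_all
      then have "set p \<subseteq> A0" "set q \<subseteq> A0" "u \<in> V0" by (auto simp: monomials_over_def)
      then show ?thesis using arcs m(2)
        by (intro exI[of _ "map Edge p @ Vertex u # map Ghost (rev q)"]) (auto simp: monomial_def lpa_gens_def)
    qed
    from this[OF that(1)] this[OF that(2)] obtain w w' where
      w: "a = word w" "w \<noteq> []" "set w \<subseteq> lpa_gens G" "set w \<subseteq> Vertex ` V0 \<union> Edge ` A0 \<union> Ghost ` A0"
      "b = word w'" "set w' \<subseteq> lpa_gens G" "set w' \<subseteq> Vertex ` V0 \<union> Edge ` A0 \<union> Ghost ` A0" by blast
    then show ?thesis
      using word_span_monomials_over[OF heads, of "w @ w'"] by (simp add: word_mult)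
  qed
  note sub = span_subalgebra[OF B finB this]
  have "Z \<subseteq> cls ` fa.span ?B"
  proof
    fix z assume "z \<in> Z"
    then obtain f where f: "f \<in> R" "z = cls f" using R by auto
    have "(\<Sum>w\<in>Poly_Mapping.keys f. Poly_Mapping.single w (Poly_Mapping.lookup f w)) \<in> fa.span (?B \<union> rel_ideal)"
    proof (rule fa.span_sum)
      fix w assume w: "w \<in> Poly_Mapping.keys f"
      obtain xs where xs: "w = Free_Mon xs" by (cases w) auto
      have "xs \<noteq> []" using w f R by (force simp: Fr_eq xs zero_free_mon_def)
      moreover have "set xs \<subseteq> \<Gamma>" using w f by (force simp: \<Gamma>_def xs)
      ultimately have "word xs \<in> fa.span (?B \<union> rel_ideal)"
        using \<Gamma>(2) \<Gamma>_sub by (intro word_span_monomials_over heads) auto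
      then have "sc (Poly_Mapping.lookup f w) (word xs) \<in> fa.span (?B \<union> rel_ideal)" by (rule fa.span_scale)
      then show "Poly_Mapping.single w (Poly_Mapping.lookup f w) \<in> fa.span (?B \<union> rel_ideal)"
        by (simp add: word_def mult_single xs)
    qed
    then have "f \<in> fa.span (?B \<union> rel_ideal)" by (simp only: poly_mapping_sum_single)
    then show "z \<in> cls ` fa.span ?B" using span_Un_rel_ideal_cls[OF B] f by simp
  qed
  then show "\<exists>S. lie_subalgebra (minus_lie L) S \<and> alg_fin_dim (minus_lie L) S \<and> Z \<subseteq> S"
    using sub by blast
qed

section \<open>The action on infinite paths\<close>

definition infinite_path :: "(nat \<Rightarrow> 'e) \<Rightarrow> bool" where
  "infinite_path x \<longleftrightarrow> (\<forall>n. x n \<in> arcs G \<and> head G (x n) = tail G (x (Suc n)))"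

text \<open>The action underlying a Chen module: edges are prepended, ghost edges delete the first
  edge. The sequences need not be paths; the test on \<open>x 1\<close> makes \<open>Edge e\<close>
  and \<open>Ghost e\<close> mutually inverse partial maps on all sequences.\<close>

fun gen_act :: "('v, 'e) lpa_gen \<Rightarrow> (nat \<Rightarrow> 'e) \<Rightarrow> (nat \<Rightarrow> 'e) option" where
  "gen_act (Vertex v) x = (if tail G (x 0) = v then Some x else None)"
| "gen_act (Edge e) x = (if head G e = tail G (x 0) then Some (case_nat e x) else None)"
| "gen_act (Ghost e) x = (if x 0 = e \<and> head G e = tail G (x 1) then Some (\<lambda>n. x (Suc n)) else None)"

definition word_act :: "('v, 'e) lpa_gen list \<Rightarrow> (nat \<Rightarrow> 'e) \<Rightarrow> (nat \<Rightarrow> 'e) option" where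
  "word_act w x = foldr (\<lambda>g y. Option.bind y (gen_act g)) w (Some x)"

lemma word_act_simps [simp]:
  "word_act [] x = Some x" "word_act (g # w) x = Option.bind (word_act w x) (gen_act g)"
  by (simp_all add: word_act_def)

lemma word_act_append: "word_act (w @ w') x = Option.bind (word_act w' x) (word_act w)"
  by (induction w) (auto simp: Option.bind_assoc)

text \<open>The entry in row \<open>x\<close> and column \<open>y\<close> of the matrix by which
  \<open>f\<close> acts on the free vector space on sequences.\<close>

definition coeff :: "(nat \<Rightarrow> 'e) \<Rightarrow> (nat \<Rightarrow> 'e) \<Rightarrow> (('v, 'e) lpa_gen free_mon \<Rightarrow>\<^sub>0 'k) \<Rightarrow> 'k" where
  "coeff x y = lin (\<lambda>w. if word_act (letters w) y = Some x then 1 else 0)"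

lemma coeff_simps:
  "coeff x y (f + g) = coeff x y f + coeff x y g" "coeff x y (f - g) = coeff x y f - coeff x y g"
  "coeff x y (sc c f) = c * coeff x y f" "coeff x y 0 = 0" "coeff x y (sum h B) = (\<Sum>b\<in>B. coeff x y (h b))"
  "coeff x y (word w) = (if word_act w y = Some x then 1 else 0)"
  by (simp_all add: coeff_def lin_add lin_diff lin_scale lin_sum word_def)

lemma coeff_mult_gen:
  "coeff x y (f * free_gen g) = (case gen_act g y of None \<Rightarrow> 0 | Some y' \<Rightarrow> coeff x y' f)"
proof -
  have "coeff x y (f * free_gen g) = lin (\<lambda>w. if Option.bind (gen_act g y) (word_act (letters w)) = Some x then 1 else 0) f"
    by (simp add: coeff_def free_gen_def lin_mult_single plus_free_mon_def word_act_append)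
  then show ?thesis by (cases "gen_act g y") (auto simp: coeff_def lin_def)
qed

fun gen_act_inv :: "('v, 'e) lpa_gen \<Rightarrow> (nat \<Rightarrow> 'e) \<Rightarrow> (nat \<Rightarrow> 'e) option" where
  "gen_act_inv (Vertex v) x = gen_act (Vertex v) x"
| "gen_act_inv (Edge e) x = gen_act (Ghost e) x"
| "gen_act_inv (Ghost e) x = gen_act (Edge e) x"

lemma gen_act_inv: "gen_act g z = Some x \<longleftrightarrow> gen_act_inv g x = Some z"
proof -
  have case_nat: "case_nat e y = y' \<longleftrightarrow> y' 0 = e \<and> (\<lambda>n. y' (Suc n)) = y" for e and y y' :: "nat \<Rightarrow> 'e"
  proof
    assume *: "y' 0 = e \<and> (\<lambda>n. y' (Suc n)) = y"
    show "case_nat e y = y'"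
    proof
      fix n show "case_nat e y n = y' n" using * by (cases n) auto
    qed
  qed auto
  show ?thesis by (cases g) (auto simp: case_nat)
qed

text \<open>Generators act as partial injections, so multiplication from the left moves the row
  index along the inverse map.\<close>

lemma coeff_gen_mult:
  "coeff x y (free_gen g * f) = (case gen_act_inv g x of None \<Rightarrow> 0 | Some x' \<Rightarrow> coeff x' y f)"
proof -
  have "coeff x y (free_gen g * f) =
      lin (\<lambda>w. if \<exists>z. word_act (letters w) y = Some z \<and> gen_act_inv g x = Some z then 1 else 0) f"
    by (simp add: coeff_def free_gen_def lin_single_mult plus_free_mon_def bind_eq_Some_conv gen_act_inv)
  then show ?thesis by (cases "gen_act_inv g x") (auto simp: coeff_def lin_def)
qed

lemma infinite_path_gen_act:
  "infinite_path y \<Longrightarrow> g \<in> lpa_gens G \<Longrightarrow> gen_act g y = Some y' \<Longrightarrow> infinite_path y'"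
  by (cases g) (auto simp: infinite_path_def lpa_gens_def split: if_splits nat.splits)

text \<open>Only columns are restricted to infinite paths: right multiplication moves the column
  index to another infinite path, and left multiplication moves only the row index, which is
  arbitrary.\<close>

definition annihilator where
  "annihilator = {f \<in> Fr. \<forall>x y. infinite_path y \<longrightarrow> coeff x y f = 0}"

lemma annihilator_subspace: "fa.subspace annihilator"
  by (rule fa.subspaceI) (auto simp: annihilator_def coeff_simps)

lemma annihilator_relations: "lpa_relations G \<subseteq> annihilator"
proof
  fix r :: "('v, 'e) lpa_gen free_mon \<Rightarrow>\<^sub>0 'k" assume r: "r \<in> lpa_relations G"
  have "coeff x y r = 0" if y: "infinite_path y" for x y
    using r unfolding lpa_relations_def Let_def
  proof (elim UnE CollectE exE conjE)
    fix v assume r: "r = V v - (\<Sum>e\<in>out_arcs G v. X e * Y e)" and v: "v \<in> regular_verts G"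
    have y0: "y 0 \<in> arcs G" "head G (y 0) = tail G (y (Suc 0))" using y by (auto simp: infinite_path_def)
    \<comment> \<open>Only the product \<open>ee^*\<close> for the first edge of \<open>y\<close>
      does not annihilate \<open>y\<close>, and it fixes \<open>y\<close>, as does the vertex where
      \<open>y\<close> starts.\<close>
    have *: "word_act [Edge e, Ghost e] y = (if e = y 0 then Some y else None)" for e
      using y0(2) by (auto simp: fun_eq_iff split: nat.splits)
    have "(\<Sum>e\<in>out_arcs G v. coeff x y (word [Edge e, Ghost e])) =
        (\<Sum>e\<in>out_arcs G v. if e = y 0 then (if y = x then 1 else 0) else 0)"
      unfolding coeff_simps * by (intro sum.cong) auto
    also have "\<dots> = coeff x y (word [Vertex v])"
      using regular_finite_out_arcs[OF v] y0(1) by (auto simp: coeff_simps)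
    finally show "coeff x y r = 0" by (simp add: r coeff_simps(2,5) free_gen_word word_mult)
  qed (auto simp: free_gen_word word_mult coeff_simps split: nat.splits)
  then show "r \<in> annihilator" using r relations_subset by (auto simp: annihilator_def)
qed

lemma rel_ideal_annihilator: "rel_ideal \<subseteq> annihilator"
proof (rule rel_ideal_minimal[OF _ annihilator_subspace _ _ annihilator_relations])
  show "annihilator \<subseteq> Fr" by (auto simp: annihilator_def)
  note ss = annihilator_subspace
  have fx: "free_gen g \<in> Fr" if "g \<in> lpa_gens G" for g using that by (simp add: free_gen_word)
  have "Fr \<subseteq> {a \<in> Fr. \<forall>f\<in>annihilator. a * f \<in> annihilator}"
  proof (rule Fr_subset_subalgebra)
    show "free_gen g \<in> {a \<in> Fr. \<forall>f\<in>annihilator. a * f \<in> annihilator}" if g: "g \<in> lpa_gens G" for g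
      using fx[OF g] by (auto simp: annihilator_def coeff_gen_mult split: option.splits)
  qed (auto simp: distrib_right mult.assoc fa.subspace_0[OF ss]
      intro!: fa.subspaceI fa.subspace_add[OF ss] fa.subspace_scale[OF ss])
  then show "a * f \<in> annihilator" if "a \<in> Fr" "f \<in> annihilator" for a f using that by auto
  have "Fr \<subseteq> {a \<in> Fr. \<forall>f\<in>annihilator. f * a \<in> annihilator}"
  proof (rule Fr_subset_subalgebra)
    show "free_gen g \<in> {a \<in> Fr. \<forall>f\<in>annihilator. f * a \<in> annihilator}" if g: "g \<in> lpa_gens G" for g
      using fx[OF g] infinite_path_gen_act[OF _ g]
      by (auto simp: annihilator_def coeff_mult_gen split: option.splits)
    show "a * b \<in> {a \<in> Fr. \<forall>f\<in>annihilator. f * a \<in> annihilator}"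
      if "a \<in> {a \<in> Fr. \<forall>f\<in>annihilator. f * a \<in> annihilator}"
        "b \<in> {a \<in> Fr. \<forall>f\<in>annihilator. f * a \<in> annihilator}" for a b
      using that by (auto simp flip: mult.assoc)
  qed (auto simp: distrib_left mult_scalar_left fa.subspace_0[OF ss]
      intro!: fa.subspaceI fa.subspace_add[OF ss] fa.subspace_scale[OF ss])
  then show "f * a \<in> annihilator" if "a \<in> Fr" "f \<in> annihilator" for a f using that by auto
qed

lemma V_not_rel_ideal:
  assumes "infinite_path y" "tail G (y 0) = u"
  shows "V u \<notin> rel_ideal"
proof
  assume "V u \<in> rel_ideal"
  then have "coeff y y (V u) = 0" using rel_ideal_annihilator assms(1) by (auto simp: annihilator_def)
  then show False using assms by (simp add: free_gen_word coeff_simps)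
qed

text \<open>Each generator \<open>x\<close> satisfies \<open>x = x v\<close> for a single vertex
  \<open>v\<close>, and annihilation from the right passes to sums and left multiples.\<close>

lemma finite_right_support:
  "f \<in> Fr \<Longrightarrow> finite {u \<in> verts G. f * V u \<notin> rel_ideal}"
proof -
  let ?U = "{f \<in> Fr. finite {u \<in> verts G. f * V u \<notin> rel_ideal}}"
  have "Fr \<subseteq> ?U"
  proof (rule Fr_subset_subalgebra)
    show "fa.subspace ?U"
    proof (rule fa.subspaceI)
      show "f + g \<in> ?U" if "f \<in> ?U" "g \<in> ?U" for f g
      proof -
        have "{u \<in> verts G. (f + g) * V u \<notin> rel_ideal} \<subseteq> {u \<in> verts G. f * V u \<notin> rel_ideal} \<union> {u \<in> verts G. g * V u \<notin> rel_ideal}"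
          by (auto simp: distrib_right)
        then show ?thesis using that by (auto intro: finite_subset)
      qed
      show "sc c f \<in> ?U" if "f \<in> ?U" for c f
      proof -
        have "{u \<in> verts G. sc c f * V u \<notin> rel_ideal} \<subseteq> {u \<in> verts G. f * V u \<notin> rel_ideal}"
          by (auto simp: mult.assoc)
        then show ?thesis using that by (auto intro: finite_subset)
      qed
    qed simp
    show "f * g \<in> ?U" if "f \<in> ?U" "g \<in> ?U" for f g
    proof -
      have "{u \<in> verts G. f * g * V u \<notin> rel_ideal} \<subseteq> {u \<in> verts G. g * V u \<notin> rel_ideal}"
        using that by (auto simp: mult.assoc)
      then show ?thesis using that by (auto intro: finite_subset)
    qed
    fix x assume x: "x \<in> lpa_gens G"
    have "\<exists>v\<in>verts G. free_gen x * V v \<approx> free_gen x"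
    proof (cases x)
      case (Vertex v)
      then show ?thesis using x eqv_V_V[of v v] by (auto simp: lpa_gens_def)
    next
      case (Edge e)
      then show ?thesis using x by (intro bexI[of _ "head G e"]) (auto simp: lpa_gens_def eqv_X_V)
    next
      case (Ghost e)
      then show ?thesis using x by (intro bexI[of _ "tail G e"]) (auto simp: lpa_gens_def eqv_Y_V)
    qed
    then obtain v where v: "v \<in> verts G" "free_gen x * V v \<approx> free_gen x" by auto
    have fx: "free_gen x \<in> Fr" using x by (simp add: free_gen_word)
    have "free_gen x * V u \<in> rel_ideal" if u: "u \<in> verts G" "u \<noteq> v" for u
    proof -
      have "free_gen x * V u \<approx> free_gen x * V v * V u"
        using u v by (intro eqv_mult_right eqv_sym[OF v(2)]) auto
      also have "\<dots> \<approx> free_gen x * 0"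
        unfolding mult.assoc using eqv_V_V[of v u] u v fx by (intro eqv_mult_left) auto
      finally show ?thesis by (simp add: eqv_zero_iff)
    qed
    then have "{u \<in> verts G. free_gen x * V u \<notin> rel_ideal} \<subseteq> {v}" by auto
    then show "free_gen x \<in> ?U" using fx by (auto intro: finite_subset)
  qed
  then show "f \<in> Fr \<Longrightarrow> finite {u \<in> verts G. f * V u \<notin> rel_ideal}" by auto
qed

text \<open>A finite spanning set is annihilated from the right by some nonzero vertex
  \<open>u\<close>, hence so is \<open>u\<close> itself, although \<open>u u = u\<close>.\<close>

lemma infinite_dimensional:
  assumes "infinite {u \<in> verts G. V u \<notin> rel_ideal}"
  shows "\<not> alg_fin_dim (minus_lie L) (alg_carrier (minus_lie L))"
proof
  assume "alg_fin_dim (minus_lie L) (alg_carrier (minus_lie L))"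
  then obtain B where B: "finite B" "B \<subseteq> cls ` Fr" "alg_span L B = cls ` Fr"
    unfolding alg_fin_dim_def minus_lie_simps L_carrier by blast
  then obtain R where R: "finite R" "R \<subseteq> Fr" "B = cls ` R" by (meson finite_subset_image)
  have "finite (\<Union>f\<in>R. {u \<in> verts G. f * V u \<notin> rel_ideal})" using R finite_right_support by blast
  then obtain u where u: "u \<in> verts G" "V u \<notin> rel_ideal" "\<And>f. f \<in> R \<Longrightarrow> f * V u \<in> rel_ideal"
  proof -
    have "\<not> {u \<in> verts G. V u \<notin> rel_ideal} \<subseteq> (\<Union>f\<in>R. {u \<in> verts G. f * V u \<notin> rel_ideal})"
      using assms \<open>finite (\<Union>f\<in>R. _ f)\<close> finite_subset by blast
    then show thesis using that by blast
  qed
  have "fa.span R \<subseteq> {f \<in> Fr. f * V u \<in> rel_ideal}"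
    using R u by (intro fa.span_minimal fa.subspaceI) (auto simp: distrib_right mult.assoc)
  moreover have "cls (V u) \<in> cls ` fa.span R" using B R u span_image[OF R(2)] by auto
  ultimately obtain f where f: "f \<in> Fr" "f * V u \<in> rel_ideal" "cls (V u) = cls f" by auto
  then have "V u * V u \<approx> f * V u" using u by (intro eqv_mult_right) (auto simp: cls_eq_iff)
  then have "V u * V u \<in> rel_ideal" using f eqv_rel_ideal by blast
  then show False using eqv_V_V[OF u(1) u(1)] eqv_rel_ideal u(2) by auto
qed

end

section \<open>Regular vertices are nonzero and infinite in number\<close>

context lie_ideal_leavitt
begin

text \<open>The range of every edge is regular, so from \<open>u\<close> chosen edges can be
  followed forever.\<close>

lemma regular_V_not_rel_ideal:
  assumes u: "u \<in> regular_verts G"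
  shows "V u \<notin> rel_ideal"
proof -
  have "\<exists>e. e \<in> arcs G \<and> tail G e = u" if "u \<in> regular_verts G" for u
    using that by (auto simp: regular_verts_def out_arcs_def)
  then obtain nxt where nxt: "\<And>u. u \<in> regular_verts G \<Longrightarrow> nxt u \<in> arcs G \<and> tail G (nxt u) = u" by metis
  define vx where "vx n = ((\<lambda>u. head G (nxt u)) ^^ n) u" for n
  have vx: "vx n \<in> regular_verts G" for n
    by (induction n) (auto simp: vx_def u nxt head_regular)
  have "vx (Suc n) = head G (nxt (vx n))" for n by (simp add: vx_def)
  then have "infinite_path (\<lambda>n. nxt (vx n))"
    unfolding infinite_path_def using nxt[OF vx] by metis
  then show ?thesis by (rule V_not_rel_ideal) (simp add: vx_def nxt u)
qed

lemma infinite_regular_verts: "infinite (regular_verts G)"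
proof
  assume fin: "finite (regular_verts G)"
  have "\<exists>e. e \<in> arcs G \<and> tail G e = u" if "u \<in> regular_verts G" for u
    using that by (auto simp: regular_verts_def out_arcs_def)
  then obtain nxt where nxt: "\<And>u. u \<in> regular_verts G \<Longrightarrow> nxt u \<in> arcs G \<and> tail G (nxt u) = u" by metis
  have "regular_verts G = {}"
    by (rule acyclic_forward_empty[OF acyclic, of "nxt ` regular_verts G"]) (use fin nxt head_regular in auto)
  then show False using regular_nonempty by simp
qed

lemma minus_lie_infinite_dimensional: "\<not> alg_fin_dim (minus_lie L) (alg_carrier (minus_lie L))"
proof (rule infinite_dimensional)
  show "infinite {u \<in> verts G. V u \<notin> rel_ideal}"
    by (rule infinite_super[OF _ infinite_regular_verts]) (use regular_V_not_rel_ideal regular_verts_subset in auto)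
qed

end

section \<open>Products of monomials\<close>

context leavitt
begin

lemma nf_Vertex_Ghosts:
  "path_to u q \<Longrightarrow> nf (Vertex u # map Ghost (rev q)) = Some ([], u, q)"
proof -
  have "path_to u q \<Longrightarrow> nf (Vertex u # map Ghost q') = Some ([], u, rev q')" if "q' = rev q" for q'
    using that
  proof (induction q' arbitrary: q rule: rev_induct)
    case (snoc e q')
    then have "rev (q' @ [e]) = q" by simp
    then have "q = e # rev q'" by simp
    with snoc.prems snoc.IH[of "rev q'"] have "nf (Vertex u # map Ghost q') = Some ([], u, rev q')"
      "start u (rev q') = head G e" by auto
    then show ?case using nf_snoc[of "Vertex u # map Ghost q'" "Ghost e"] by simp
  qed simp
  from this[OF refl] show "path_to u q \<Longrightarrow> nf (Vertex u # map Ghost (rev q)) = Some ([], u, q)" by simp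
qed

lemma nf_Edges:
  assumes "nf w = Some ([], u, s)" "path_to u p"
  shows "nf (map Edge p @ w) = Some (p, u, s)"
proof -
  have "w \<noteq> []" using assms(1) by auto
  then show ?thesis using assms(2) by (induction p) (auto simp: nf_Cons assms(1))
qed

lemma nf_Ghosts_prefix:
  assumes "nf w = Some (q @ t, u, s)"
  shows "nf (map Ghost (rev q) @ w) = Some (t, u, s)"
  using assms
proof (induction q arbitrary: w)
  case (Cons e q)
  have "w \<noteq> []" using Cons.prems by auto
  then have "nf (Ghost e # w) = Some (q @ t, u, s)" using Cons.prems by (simp add: nf_Cons)
  from Cons.IH[OF this] show ?case by simp
qed simp

lemma nf_append_None: "w \<noteq> [] \<Longrightarrow> nf w = None \<Longrightarrow> nf (w' @ w) = None"
  by (induction w') (auto simp: nf_Cons)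

text \<open>Two paths that are not prefixes of each other differ at a first pair of edges
  \<open>e\<close>, \<open>f\<close>, and there \<open>e^* f = 0\<close>.\<close>

lemma nf_Ghosts_not_prefix:
  assumes "nf w = Some (r, u, s)" "\<nexists>t. r = q @ t" "\<nexists>t. q = r @ t"
  shows "nf (map Ghost (rev q) @ w) = None"
  using assms
proof (induction q arbitrary: w r)
  case (Cons e q)
  have w: "w \<noteq> []" using Cons.prems by auto
  then obtain f r' where r: "r = f # r'" using Cons.prems by (cases r) auto
  show ?case
  proof (cases "f = e")
    case True
    then have "nf (Ghost e # w) = Some (r', u, s)" using Cons.prems w by (simp add: nf_Cons r)
    from Cons.IH[OF this] show ?thesis using Cons.prems True by (simp add: r)
  next
    case False
    then have "nf (Ghost e # w) = None" using Cons.prems w by (simp add: nf_Cons r)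
    then show ?thesis using nf_append_None[of "Ghost e # w" "map Ghost (rev q)"] by simp
  qed
qed simp

definition monomial_word :: "('v, 'e) monomial \<Rightarrow> ('v, 'e) lpa_gen list" where
  "monomial_word m = (case m of (p, u, q) \<Rightarrow> map Edge p @ Vertex u # map Ghost (rev q))"

lemma monomial_word: "monomial m = word (monomial_word m)"
  by (auto simp: monomial_def monomial_word_def split: prod.splits)

lemma nf_monomial_word: "valid m \<Longrightarrow> nf (monomial_word m) = Some m"
  by (cases m) (auto simp: monomial_word_def intro!: nf_Edges nf_Vertex_Ghosts)

lemma monomial_word_gens: "valid m \<Longrightarrow> monomial_word m \<noteq> [] \<and> set (monomial_word m) \<subseteq> lpa_gens G"
  using Fr_monomial[of m] by (simp add: monomial_word)

lemma monomial_mult: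
  assumes "valid (p, u, q)" "valid (q, u, s)"
  shows "monomial (p, u, q) * monomial (q, u, s) \<approx> monomial (p, u, s)"
proof -
  let ?w = "monomial_word (p, u, q) @ monomial_word (q, u, s)"
  have "nf (map Ghost (rev q) @ monomial_word (q, u, s)) = Some ([], u, s)"
    using nf_Ghosts_prefix[of _ q "[]"] nf_monomial_word[OF assms(2)] by simp
  then have "nf (Vertex u # map Ghost (rev q) @ monomial_word (q, u, s)) = Some ([], u, s)"
    using monomial_word_gens[OF assms(2)] by (simp add: nf_Cons)
  then have "nf ?w = Some (p, u, s)"
    using nf_Edges assms(1) by (auto simp: monomial_word_def[of "(p, u, q)"])
  then show ?thesis
    using word_eqv_nf[of ?w] monomial_word_gens assms by (simp add: monomial_word word_mult)
qed

lemma monomial_mult_orthogonal: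
  assumes "valid (p, u, q)" "valid (r, u', s)" "\<nexists>t. r = q @ t" "\<nexists>t. q = r @ t"
  shows "monomial (p, u, q) * monomial (r, u', s) \<in> rel_ideal"
proof -
  let ?w = "monomial_word (p, u, q) @ monomial_word (r, u', s)"
  have "nf (map Ghost (rev q) @ monomial_word (r, u', s)) = None"
    using nf_Ghosts_not_prefix assms nf_monomial_word by blast
  then have "nf ?w = None"
    using monomial_word_gens[OF assms(2)]
      nf_append_None[of "map Ghost (rev q) @ monomial_word (r, u', s)" "map Edge p @ [Vertex u]"]
    by (simp add: monomial_word_def[of "(p, u, q)"])
  then show ?thesis
    using word_eqv_nf[of ?w] monomial_word_gens[OF assms(1)] monomial_word_gens[OF assms(2)]
    by (simp add: monomial_word word_mult eqv_zero_iff)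
qed

lemma monomial_mult_gen:
  assumes "valid m" "g \<in> lpa_gens G"
  shows "monomial m * free_gen g \<approx> opt_monomial (right_mult g m)"
  using word_eqv_nf[of "monomial_word m @ [g]"] monomial_word_gens[OF assms(1)] assms
  by (simp add: nf_snoc nf_monomial_word monomial_word free_gen_word word_mult)

lemma monomial_vertex: "monomial ([], u, []) = V u"
  by (simp add: monomial_def free_gen_word)

lemma alg_span_base: "x \<in> B \<Longrightarrow> x \<in> alg_span L B"
  by (auto simp: alg_span_def)

section \<open>Ideals containing a regular vertex\<close>

text \<open>A filtration by the length of the ghost part. Right multiplication by an edge lowers it
  by one, which drives the induction in \<open>ideal_contains_regular_vertex\<close>.\<close>

definition ghost_span :: "nat \<Rightarrow> (('v, 'e) lpa_gen free_mon \<Rightarrow>\<^sub>0 'k) set" where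
  "ghost_span n = fa.span (monomial ` {(p, u, q). valid (p, u, q) \<and> length q \<le> n} \<union> rel_ideal)"

lemma ghost_span_mono: "m \<le> n \<Longrightarrow> ghost_span m \<subseteq> ghost_span n"
  unfolding ghost_span_def by (rule fa.span_mono) auto

lemma ghost_span_exhaust:
  assumes "f \<in> Fr"
  obtains n where "f \<in> ghost_span n"
proof -
  have "Fr \<subseteq> (\<Union>n. ghost_span n)"
  proof (rule Fr_subset_subspace)
    show "fa.subspace (\<Union>n. ghost_span n)"
    proof (rule fa.subspaceI)
      show "0 \<in> (\<Union>n. ghost_span n)" by (auto simp: ghost_span_def fa.span_zero)
      show "f + g \<in> (\<Union>n. ghost_span n)" if fg: "f \<in> (\<Union>n. ghost_span n)" "g \<in> (\<Union>n. ghost_span n)" for f g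
      proof -
        obtain m n where "f \<in> ghost_span m" "g \<in> ghost_span n" using fg by blast
        then have "f \<in> ghost_span (max m n)" "g \<in> ghost_span (max m n)"
          using ghost_span_mono[of m "max m n"] ghost_span_mono[of n "max m n"] by auto
        then have "f + g \<in> ghost_span (max m n)" by (auto simp: ghost_span_def intro: fa.span_add)
        then show ?thesis by blast
      qed
    qed (auto simp: ghost_span_def intro: fa.span_scale)
    fix xs :: "('v, 'e) lpa_gen list" assume xs: "xs \<noteq> []" "set xs \<subseteq> lpa_gens G"
    have "opt_monomial (nf xs) \<in> (\<Union>n. ghost_span n)"
    proof (cases "nf xs")
      case None
      then show ?thesis by (auto simp: ghost_span_def fa.span_zero)
    next
      case (Some m)
      then obtain p u q where m: "m = (p, u, q)" "valid (p, u, q)" using valid_nf[OF xs(2)] by (cases m) auto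
      then have "monomial m \<in> ghost_span (length q)" unfolding ghost_span_def by (intro fa.span_base) auto
      then show ?thesis using Some by auto
    qed
    then show "word xs \<in> (\<Union>n. ghost_span n)"
      using span_eqv[OF word_eqv_nf[OF xs]] by (auto simp: ghost_span_def)
  qed
  then show thesis using assms that by auto
qed

lemma ghost_span_Suc_mult:
  assumes e: "e \<in> arcs G" and f: "f \<in> ghost_span (Suc n)"
  shows "f * X e \<in> ghost_span n"
proof -
  have "ghost_span (Suc n) \<subseteq> {f. f * X e \<in> ghost_span n}"
    unfolding ghost_span_def[of "Suc n"]
  proof (rule fa.span_minimal)
    show "fa.subspace {f. f * X e \<in> ghost_span n}"
      by (rule fa.subspaceI)
        (auto simp: ghost_span_def distrib_right mult.assoc intro: fa.span_add fa.span_scale fa.span_zero)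
    have "monomial (p, u, q) * X e \<in> ghost_span n" if m: "valid (p, u, q)" "length q \<le> Suc n" for p u q
    proof -
      have v: "valid m" if "right_mult (Edge e) (p, u, q) = Some m" for m
        using m that e by (auto split: list.splits if_splits)
      have "opt_monomial (right_mult (Edge e) (p, u, q)) \<in> ghost_span n"
      proof (cases "right_mult (Edge e) (p, u, q)")
        case None
        then show ?thesis by (simp add: ghost_span_def fa.span_zero del: right_mult.simps)
      next
        case (Some m')
        then obtain p' u' q' where "m' = (p', u', q')" "length q' \<le> n"
          using m(2) by (auto split: list.splits if_splits)
        then have "monomial m' \<in> ghost_span n"
          unfolding ghost_span_def using v[OF Some] by (intro fa.span_base) auto
        then show ?thesis using Some by (simp del: right_mult.simps)
      qed
      then show ?thesis
        using span_eqv[OF monomial_mult_gen[of "(p, u, q)" "Edge e"]] m e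
        by (auto simp: ghost_span_def lpa_gens_def)
    qed
    moreover have "f * X e \<in> ghost_span n" if "f \<in> rel_ideal" for f
      using that e by (auto simp: ghost_span_def intro: fa.span_base)
    ultimately show "monomial ` {(p, u, q). valid (p, u, q) \<and> length q \<le> Suc n} \<union> rel_ideal \<subseteq> {f. f * X e \<in> ghost_span n}"
      by auto
  qed
  then show ?thesis using f by auto
qed

lemma ghost_span_0_mult:
  assumes u: "u \<in> verts G" and f: "f \<in> ghost_span 0"
  shows "f * V u \<in> fa.span (monomial ` {(p, u, []) |p. path_to u p} \<union> rel_ideal)" (is "_ \<in> ?S")
proof -
  have "ghost_span 0 \<subseteq> {f. f * V u \<in> ?S}"
    unfolding ghost_span_def
  proof (rule fa.span_minimal)
    show "fa.subspace {f. f * V u \<in> ?S}"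
      by (rule fa.subspaceI)
        (auto simp: distrib_right mult.assoc intro: fa.span_add fa.span_scale fa.span_zero)
    have "monomial (p, w, []) * V u \<in> ?S" if m: "path_to w p" "w \<in> verts G" for p w
    proof (rule span_eqv)
      show "monomial (p, w, []) * V u \<approx> opt_monomial (right_mult (Vertex u) (p, w, []))"
        using m u by (intro monomial_mult_gen) (auto simp: lpa_gens_def)
      show "opt_monomial (right_mult (Vertex u) (p, w, [])) \<in> ?S"
        using m by (auto intro!: fa.span_base fa.span_zero)
    qed
    moreover have "f * V u \<in> ?S" if "f \<in> rel_ideal" for f
      using that u by (auto intro: fa.span_base)
    ultimately show "monomial ` {(p, u, q). valid (p, u, q) \<and> length q \<le> 0} \<union> rel_ideal \<subseteq> {f. f * V u \<in> ?S}"
      by (auto dest: path_to_verts)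
  qed
  then show ?thesis using f by auto
qed

text \<open>Multiplication on the left by the adjoint of a shortest occurring path isolates a vertex, since
  in an acyclic graph distinct paths with a common range and source are not prefixes of each other.\<close>

lemma ideal_vertex_of_paths:
  assumes ac: "acyclic_graph G" and J: "is_ideal J" and u: "u \<in> verts G"
    and s: "s \<in> J" "s \<noteq> 0" "s \<in> fa.span (monomial ` {(p, u, []) |p. path_to u p})"
  shows "V u \<in> J"
proof -
  note D = is_idealD[OF J]
  let ?m = "\<lambda>p. monomial (p, u, [])"
  have im: "monomial ` {(p, u, []) |p. path_to u p} = ?m ` {p. path_to u p}" by auto
  obtain t c where t: "finite t" "t \<subseteq> ?m ` {p. path_to u p}" "s = (\<Sum>a\<in>t. sc (c a) a)"
    using s(3) unfolding im fa.span_explicit by auto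
  obtain P0 where P0: "P0 \<subseteq> {p. path_to u p}" "inj_on ?m P0" "t = ?m ` P0"
    using t(2) by (meson subset_image_inj)
  then have fin0: "finite P0" using t(1) finite_imageD by blast
  \<comment> \<open>Discarding zero coefficients ensures that a shortest path of \<open>P\<close>
    has an invertible coefficient.\<close>
  define P where "P = {p \<in> P0. c (?m p) \<noteq> 0}"
  have P: "finite P" "\<And>p. p \<in> P \<Longrightarrow> path_to u p" using fin0 P0 by (auto simp: P_def)
  have "s = (\<Sum>p\<in>P0. sc (c (?m p)) (?m p))" using t(3) P0 by (simp add: sum.reindex)
  also have "\<dots> = (\<Sum>p\<in>P. sc (c (?m p)) (?m p))"
    unfolding P_def by (rule sum.mono_neutral_right) (use fin0 in auto)
  finally have sum: "s = \<dots>" .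
  then have "P \<noteq> {}" using s(2) by auto
  then obtain p1 where p1: "p1 \<in> P" "\<And>p. p \<in> P \<Longrightarrow> length p1 \<le> length p"
    using ex_has_least_nat[of "\<lambda>p. p \<in> P" _ length] by auto
  have v1: "valid ([], u, p1)" using P(2)[OF p1(1)] u by simp
  have other: "monomial ([], u, p1) * ?m p \<in> rel_ideal" if p: "p \<in> P" "p \<noteq> p1" for p
  proof (cases "p1 = []")
    \<comment> \<open>The empty path is a prefix of every \<open>p\<close>. The product vanishes
      here because \<open>p\<close> does not start at \<open>u\<close>, as a closed path would be
      empty.\<close>
    case True
    have "start u p \<noteq> u" using P(2)[OF p(1)] p(2) True acyclic_closed_awalk[OF ac, of u p]
      by (auto simp: awalk_iff_path_to)
    then show ?thesis using True V_monomial[of p u "[]" u] u P(2)[OF p(1)]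
      by (auto simp: monomial_vertex eqv_zero_iff)
  next
    case False
    have "\<nexists>t. p = p1 @ t"
    proof
      assume "\<exists>t. p = p1 @ t"
      then obtain t where t: "p = p1 @ t" by blast
      then have "awalk (start u p1) p1 u" "awalk (start u p1) (p1 @ t) u"
        using P(2)[OF p1(1)] P(2)[OF p(1)] False by (cases p1; auto simp: awalk_iff_path_to simp del: path_to_append)+
      then show False using acyclic_parallel_awalks[OF ac] t p(2) by auto
    qed
    moreover have "\<nexists>t. p1 = p @ t" using p1(2)[OF p(1)] p(2) by auto
    ultimately show ?thesis using v1 P(2)[OF p(1)] u by (intro monomial_mult_orthogonal) auto
  qed
  have "monomial ([], u, p1) * s = (\<Sum>p\<in>P. sc (c (?m p)) (monomial ([], u, p1) * ?m p))"
    by (simp add: sum sum_distrib_left mult_scalar_left)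
  also have "\<dots> \<approx> (\<Sum>p\<in>P. if p = p1 then sc (c (?m p1)) (V u) else 0)"
  proof (rule eqv_sum)
    fix p assume p: "p \<in> P"
    show "sc (c (?m p)) (monomial ([], u, p1) * ?m p) \<approx> (if p = p1 then sc (c (?m p1)) (V u) else 0)"
      using other[OF p] monomial_mult[of "[]" u p1 "[]"] v1 P(2)[OF p] u
      by (auto simp: monomial_vertex eqv_zero_iff intro!: eqv_scale)
  qed
  also have "(\<Sum>p\<in>P. if p = p1 then sc (c (?m p1)) (V u) else 0) = sc (c (?m p1)) (V u)"
    using P(1) p1(1) by simp
  finally have "sc (c (?m p1)) (V u) \<in> J" using D(5)[OF s(1)] D(6) v1 by (metis Fr_monomial)
  then have "sc (inverse (c (?m p1))) (sc (c (?m p1)) (V u)) \<in> J" by (rule fa.subspace_scale[OF D(1)])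
  moreover have "c (?m p1) \<noteq> 0" using p1(1) by (simp add: P_def)
  ultimately show ?thesis by (simp add: mult.assoc[symmetric] mult_single)
qed

end

context lie_ideal_leavitt
begin

text \<open>\<open>f u = \<Sum> f e e^*\<close> over the edges from \<open>u\<close>, so some
  \<open>f e\<close> is nonzero; it lies in \<open>J\<close>, has shorter ghost parts and is not
  annihilated by the regular vertex \<open>r(e)\<close>. Without ghost parts, \<open>f u\<close> is
  a combination of paths, from which a vertex can be isolated.\<close>

lemma ideal_contains_regular_vertex:
  assumes J: "is_ideal J" and f: "f \<in> J" and u: "u \<in> regular_verts G" and nz: "f * V u \<notin> rel_ideal"
  shows "\<exists>w\<in>regular_verts G. V w \<in> J"
proof -
  note D = is_idealD[OF J]
  have "f \<in> Fr" using f D(3) by auto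
  then obtain n where "f \<in> ghost_span n" using ghost_span_exhaust by blast
  then show ?thesis using f u nz
  proof (induction n arbitrary: f u)
    case 0
    have uv: "u \<in> verts G" using 0 regular_verts_subset by auto
    let ?B = "monomial ` {(p, u, []) |p. path_to u p}"
    have span_rel_ideal: "fa.span rel_ideal = rel_ideal" using rel_ideal_subspace by simp
    obtain s i where si: "s \<in> fa.span ?B" "i \<in> rel_ideal" "f * V u = s + i"
      using ghost_span_0_mult[OF uv 0(1)] unfolding fa.span_Un span_rel_ideal by blast
    then have "f * V u \<approx> s" by (simp add: eqv_def)
    moreover have "f * V u \<in> J" using D(4)[OF 0(2)] uv by simp
    ultimately have "s \<in> J" "s \<noteq> 0" using D(6) 0(4) eqv_zero_iff by auto
    then show ?case using ideal_vertex_of_paths[OF acyclic J uv] si(1) 0(3) by blast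
  next
    case (Suc n)
    have fF: "f \<in> Fr" using Suc.prems D(3) by auto
    have "f * V u \<approx> f * (\<Sum>e\<in>out_arcs G u. X e * Y e)"
      using Suc.prems fF by (intro eqv_mult_left eqv_V_sum)
    from eqv_rel_ideal[OF this] have "(\<Sum>e\<in>out_arcs G u. f * X e * Y e) \<notin> rel_ideal"
      using Suc.prems(4) by (simp add: sum_distrib_left mult.assoc)
    then have "\<not> (\<forall>e\<in>out_arcs G u. f * X e * Y e \<in> rel_ideal)"
      by (metis (no_types, lifting) fa.subspace_sum[OF rel_ideal_subspace])
    then obtain e where e: "e \<in> out_arcs G u" "f * X e * Y e \<notin> rel_ideal" by blast
    then have ea: "e \<in> arcs G" by simp
    have "f * X e \<notin> rel_ideal" using e ea by auto
    moreover have "f * X e * V (head G e) \<approx> f * X e"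
      using eqv_mult_left[OF fF eqv_X_V[OF ea]] by (simp add: mult.assoc)
    ultimately have "f * X e * V (head G e) \<notin> rel_ideal" using eqv_rel_ideal by blast
    then show ?case
      using Suc.IH[of "f * X e" "head G e"] ghost_span_Suc_mult[OF ea Suc.prems(1)] D(4)[OF Suc.prems(2)]
        head_regular[OF ea] ea by simp
  qed
qed

text \<open>Three paths \<open>p\<^sub>1, p\<^sub>2, p\<^sub>3\<close> with common source and range \<open>w\<close> give matrix units
  \<open>p\<^sub>i w p\<^sub>j\<^sup>*\<close>, and the off-diagonal ones generate a perfect Lie algebra in every characteristic.\<close>

lemma vertex_not_locally_solvable:
  assumes J: "is_ideal J" and u: "u \<in> regular_verts G" "V u \<in> J"
  shows "\<not> lie_locally_solvable (minus_lie L) (cls ` J)"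
proof
  assume solv: "lie_locally_solvable (minus_lie L) (cls ` J)"
  note D = is_idealD[OF J]
  obtain w p1 p2 p3 where p: "awalk u p1 w" "awalk u p2 w" "awalk u p3 w" "distinct [p1, p2, p3]"
    using three_awalks[OF u(1)] .
  define P where "P = {p1, p2, p3}"
  have w: "w \<in> regular_verts G" "w \<in> verts G" using awalk_regular[OF p(1) u(1)] regular_verts_subset by auto
  have P: "path_to w p" "start w p = u" if "p \<in> P" for p
    using that p by (auto simp: P_def awalk_iff_path_to)
  define E where "E p q = monomial (p, w, q)" for p q
  have valid: "valid (p, w, q)" if "p \<in> P" "q \<in> P" for p q using that P by auto
  have E_Fr: "E p q \<in> Fr" if "p \<in> P" "q \<in> P" for p q
    using valid[OF that] unfolding E_def by (rule Fr_monomial)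
  have same: "E p q * E q s \<approx> E p s" if "p \<in> P" "q \<in> P" "s \<in> P" for p q s
    unfolding E_def by (rule monomial_mult) (use that valid in auto)
  have prefix: "q = r" if "q \<in> P" "r \<in> P" "r = q @ t" for q r t
    using that P acyclic_parallel_awalks[OF acyclic, of u q w t]
    by (auto simp: awalk_iff_path_to simp del: path_to_append start_append)
  have orth: "E p q * E r s \<in> rel_ideal" if "p \<in> P" "q \<in> P" "r \<in> P" "s \<in> P" "q \<noteq> r" for p q r s
    unfolding E_def using that valid prefix by (intro monomial_mult_orthogonal) blast+
  have E_J: "E p q \<in> J" if "p \<in> P" "q \<in> P" for p q
  proof -
    have "V u * E p q \<approx> E p q"
      using V_start_monomial[OF valid[OF that]] P[OF that(1)] by (simp add: E_def)
    then show ?thesis using D(4)[OF u(2) E_Fr[OF that]] D(6) by blast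
  qed
  have E_not_rel_ideal: "E p q \<notin> rel_ideal" if "p \<in> P" "q \<in> P" for p q
  proof
    assume "E p q \<in> rel_ideal"
    \<comment> \<open>Multiplying \<open>p w q^*\<close> by \<open>p^*\<close> from the left and by
      \<open>q\<close> from the right gives \<open>w\<close>, which is nonzero because
      \<open>w\<close> is regular.\<close>
    then have "monomial ([], w, p) * E p q * monomial (q, w, []) \<in> rel_ideal"
      using P that w by (intro rel_ideal_mult_right rel_ideal_mult_left Fr_monomial) auto
    moreover have "monomial ([], w, p) * E p q * monomial (q, w, []) \<approx> monomial ([], w, q) * monomial (q, w, [])"
      unfolding E_def using P that w by (intro eqv_mult_right monomial_mult Fr_monomial) auto
    moreover have "monomial ([], w, q) * monomial (q, w, []) \<approx> monomial ([], w, [])"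
      using P that w by (intro monomial_mult) auto
    ultimately have "V w \<in> rel_ideal" using eqv_rel_ideal by (metis monomial_vertex)
    then show False using regular_V_not_rel_ideal w by blast
  qed
  define B where "B = (\<lambda>(p, q). E p q) ` (P \<times> P)"
  have B: "B \<subseteq> Fr" "finite B" "B \<subseteq> J" using E_Fr E_J by (auto simp: B_def P_def)
  have "a * b \<in> fa.span (B \<union> rel_ideal)" if "a \<in> B" "b \<in> B" for a b
  proof -
    obtain p q r s where ab: "a = E p q" "b = E r s" "p \<in> P" "q \<in> P" "r \<in> P" "s \<in> P"
      using \<open>a \<in> B\<close> \<open>b \<in> B\<close> by (auto simp: B_def)
    show ?thesis
    proof (cases "q = r")
      case True
      have "E p s \<in> fa.span (B \<union> rel_ideal)" using ab by (intro fa.span_base) (auto simp: B_def)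
      then show ?thesis using span_eqv[OF same[of p q s]] ab True by auto
    next
      case False
      then show ?thesis using orth ab by (auto intro: fa.span_base)
    qed
  qed
  note T = span_subalgebra[OF B(1,2) this]
  have "cls ` fa.span B \<subseteq> cls ` J" using fa.span_minimal[OF B(3) D(1)] by auto
  then have "lie_solvable (minus_lie L) (cls ` fa.span B)"
    using solv T unfolding lie_locally_solvable_def by blast
  then obtain n where n: "(lie_derived (minus_lie L) ^^ n) (cls ` fa.span B) = {cls 0}"
    by (auto simp: lie_solvable_def)
  have "cls (E p q) \<in> (lie_derived (minus_lie L) ^^ n) (cls ` fa.span B)"
    if "p \<in> P" "q \<in> P" "p \<noteq> q" for p q n
    using that
  proof (induction n arbitrary: p q)
    case 0
    then show ?case by (auto simp: B_def intro!: imageI fa.span_base)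
  next
    case (Suc n)
    \<comment> \<open>The third path gives \<open>E p q = [E p r, E r q]\<close>: the opposite
      product vanishes because \<open>p \<noteq> q\<close>. So the off-diagonal units survive in
      every derived algebra.\<close>
    obtain r where r: "r \<in> P" "r \<noteq> p" "r \<noteq> q" using p(4) by (auto simp: P_def)
    let ?S = "(lie_derived (minus_lie L) ^^ n) (cls ` fa.span B)"
    have in_S: "cls (E p r) \<in> ?S" "cls (E r q) \<in> ?S" using Suc r by auto
    have "E r q * E p r \<approx> 0" using orth Suc.prems r by (simp add: eqv_zero_iff)
    then have "E p r * E r q - E r q * E p r \<approx> E p q - 0"
      using same Suc.prems r by (intro eqv_diff) auto
    then have "alg_mult (minus_lie L) (cls (E p r)) (cls (E r q)) = cls (E p q)"
      using E_Fr Suc.prems r by (simp add: cls_eq_iff)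
    then have "cls (E p q) \<in> {alg_mult (minus_lie L) x y |x y. x \<in> ?S \<and> y \<in> ?S}" using in_S by force
    then have "cls (E p q) \<in> lie_derived (minus_lie L) ?S"
      unfolding lie_derived_def minus_lie_simps by (rule alg_span_base)
    then show ?case by simp
  qed
  then have "cls (E p1 p2) \<in> {cls 0}" using n p(4) by (metis P_def distinct_length_2_or_more insert_iff)
  then have "E p1 p2 \<in> rel_ideal" using E_Fr by (simp add: cls_eq_iff eqv_zero_iff P_def)
  then show False using E_not_rel_ideal by (simp add: P_def)
qed

end

section \<open>The locally solvable radical\<close>

context leavitt
begin

lemma eqv_X_at_head: "e \<in> arcs G \<Longrightarrow> X e \<approx> X e * V (head G e)"
  and eqv_Y_at_tail: "e \<in> arcs G \<Longrightarrow> Y e \<approx> Y e * V (tail G e)"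
  by (auto intro: eqv_sym[OF eqv_X_V] eqv_sym[OF eqv_Y_V])

lemma V_X_other:
  assumes "e \<in> arcs G" "u \<in> verts G" "u \<noteq> tail G e"
  shows "V u * X e \<in> rel_ideal"
proof -
  have "V u * X e \<approx> V u * V (tail G e) * X e"
    unfolding mult.assoc using assms by (intro eqv_mult_left eqv_sym[OF eqv_V_X]) auto
  also have "\<dots> \<approx> 0 * X e" using eqv_V_V[of u "tail G e"] assms by (intro eqv_mult_right) auto
  finally show ?thesis by (simp add: eqv_zero_iff)
qed

text \<open>For an infinite emitter no relation makes \<open>v\<close> a sum of elements
  \<open>ee^*\<close>; these elements, for growing \<open>B\<close>, measure the defect.\<close>

definition source_complement :: "'v \<Rightarrow> 'e set \<Rightarrow> ('v, 'e) lpa_gen free_mon \<Rightarrow>\<^sub>0 'k" where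
  "source_complement v B = V v - (\<Sum>e\<in>B. X e * Y e)"

text \<open>As no edge enters \<open>v\<close>, every generator eventually acts on these elements as
  a scalar: \<open>v\<close> as \<open>1\<close>, the ghost of an edge from \<open>v\<close> as
  \<open>0\<close> once that edge lies in \<open>B\<close>, and all other generators as
  \<open>0\<close>. This passes to linear combinations and products.\<close>

lemma mult_source_complement:
  assumes v: "v \<in> verts G" "in_arcs G v = {}" and f: "f \<in> Fr"
  shows "\<exists>k B0. finite B0 \<and> B0 \<subseteq> out_arcs G v \<and> (\<forall>B. finite B \<longrightarrow> B0 \<subseteq> B \<longrightarrow> B \<subseteq> out_arcs G v \<longrightarrow>
    f * source_complement v B \<approx> sc k (source_complement v B))"
proof -
  let ?Q = "source_complement v"
  \<comment> \<open>Validity for all larger \<open>B\<close> allows the bounds of two elements to be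
    joined.\<close>
  define good where "good f k B0 \<longleftrightarrow> finite B0 \<and> B0 \<subseteq> out_arcs G v \<and>
    (\<forall>B. finite B \<longrightarrow> B0 \<subseteq> B \<longrightarrow> B \<subseteq> out_arcs G v \<longrightarrow> f * ?Q B \<approx> sc k (?Q B))" for f k B0
  have goodI: "good f k B0" if "finite B0" "B0 \<subseteq> out_arcs G v"
    "\<And>B. finite B \<Longrightarrow> B0 \<subseteq> B \<Longrightarrow> B \<subseteq> out_arcs G v \<Longrightarrow> f * ?Q B \<approx> sc k (?Q B)" for f k B0
    using that by (simp add: good_def)
  have goodD: "finite B0" "B0 \<subseteq> out_arcs G v"
    "finite B \<Longrightarrow> B0 \<subseteq> B \<Longrightarrow> B \<subseteq> out_arcs G v \<Longrightarrow> f * ?Q B \<approx> sc k (?Q B)"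
    if "good f k B0" for f k B0 B
    using that by (simp_all add: good_def)
  let ?U = "{f \<in> Fr. \<exists>k B0. good f k B0}"
  have Q_Fr: "?Q B \<in> Fr" if "B \<subseteq> out_arcs G v" for B
    unfolding source_complement_def using that v by (intro Fr_diff Fr_sum Fr_mult) auto
  have V_other: "V u * ?Q B \<approx> 0" if u: "u \<in> verts G" "u \<noteq> v" and B: "B \<subseteq> out_arcs G v" for u B
  proof -
    have "(\<Sum>e\<in>B. V u * X e * Y e) \<approx> (\<Sum>e\<in>B. 0)"
      using u B V_X_other by (intro eqv_sum) (auto simp: eqv_zero_iff)
    then have "V u * V v - (\<Sum>e\<in>B. V u * X e * Y e) \<approx> 0 - 0"
      using eqv_V_V[of u v] u v by (intro eqv_diff) auto
    then show ?thesis by (simp add: source_complement_def right_diff_distrib sum_distrib_left mult.assoc)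
  qed
  have other: "good f 0 {}" if f: "f \<in> Fr" and u: "u \<in> verts G" "u \<noteq> v" "f \<approx> f * V u" for f u
  proof -
    have "f * ?Q B \<approx> sc 0 (?Q B)" if B: "B \<subseteq> out_arcs G v" for B
    proof -
      have "f * ?Q B \<approx> f * V u * ?Q B" using u(3) Q_Fr[OF B] by (intro eqv_mult_right)
      also have "\<dots> \<approx> f * 0" unfolding mult.assoc by (intro eqv_mult_left f V_other u B)
      finally show ?thesis by simp
    qed
    then show ?thesis by (intro goodI) auto
  qed
  have "Fr \<subseteq> ?U"
  proof (rule Fr_subset_subalgebra)
    show "fa.subspace ?U"
    proof (rule fa.subspaceI)
      have "good 0 0 {}" by (rule goodI) auto
      then show "0 \<in> ?U" by auto
      show "f + g \<in> ?U" if fg: "f \<in> ?U" "g \<in> ?U" for f g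
      proof -
        obtain k B1 l B2 where 1: "good f k B1" and 2: "good g l B2" using fg by blast
        have "(f + g) * ?Q B \<approx> sc (k + l) (?Q B)"
          if B: "finite B" "B1 \<union> B2 \<subseteq> B" "B \<subseteq> out_arcs G v" for B
          unfolding distrib_right single_add using goodD(3)[OF 1, of B] goodD(3)[OF 2, of B] B
          by (intro eqv_add) simp_all
        then have "good (f + g) (k + l) (B1 \<union> B2)"
          using goodD(1,2)[OF 1] goodD(1,2)[OF 2] by (intro goodI) auto
        moreover have "f + g \<in> Fr" using fg by simp
        ultimately show ?thesis by blast
      qed
      show "sc c f \<in> ?U" if fU: "f \<in> ?U" for c f
      proof -
        obtain k B1 where 1: "good f k B1" using fU by blast
        have "sc c f * ?Q B \<approx> sc (c * k) (?Q B)"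
          if B: "finite B" "B1 \<subseteq> B" "B \<subseteq> out_arcs G v" for B
        proof -
          have "f * ?Q B \<approx> sc k (?Q B)" using goodD(3)[OF 1] B by simp
          from eqv_scale[OF this, of c] show ?thesis by (simp add: mult.assoc[symmetric] mult_single)
        qed
        then have "good (sc c f) (c * k) B1" using goodD(1,2)[OF 1] by (intro goodI)
        moreover have "sc c f \<in> Fr" using fU by simp
        ultimately show ?thesis by blast
      qed
    qed
    show "f * g \<in> ?U" if fg: "f \<in> ?U" "g \<in> ?U" for f g
    proof -
      obtain k B1 l B2 where 1: "good f k B1" and 2: "good g l B2" using fg by blast
      have "f * g * ?Q B \<approx> sc (l * k) (?Q B)"
        if B: "finite B" "B1 \<union> B2 \<subseteq> B" "B \<subseteq> out_arcs G v" for B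
      proof -
        have "f * g * ?Q B \<approx> f * sc l (?Q B)"
          unfolding mult.assoc using fg goodD(3)[OF 2, of B] B by (intro eqv_mult_left) auto
        also have "f * sc l (?Q B) = sc l (f * ?Q B)" by (rule mult_scalar_left)
        also have "\<dots> \<approx> sc l (sc k (?Q B))" using goodD(3)[OF 1, of B] B by (intro eqv_scale) auto
        finally show ?thesis by (simp add: mult.assoc[symmetric] mult_single)
      qed
      then have "good (f * g) (l * k) (B1 \<union> B2)"
        using goodD(1,2)[OF 1] goodD(1,2)[OF 2] by (intro goodI) auto
      moreover have "f * g \<in> Fr" using fg by simp
      ultimately show ?thesis by blast
    qed
    fix x assume x: "x \<in> lpa_gens G"
    then have fx: "free_gen x \<in> Fr" by (simp add: free_gen_word)
    have "\<exists>k B0. good (free_gen x) k B0"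
    proof (cases x)
      case (Vertex u)
      then have u: "u \<in> verts G" using x by (auto simp: lpa_gens_def)
      show ?thesis
      proof (cases "u = v")
        case True
        have "V v * ?Q B \<approx> sc 1 (?Q B)" if B: "B \<subseteq> out_arcs G v" for B
        proof -
          have "(\<Sum>e\<in>B. V v * X e * Y e) \<approx> (\<Sum>e\<in>B. X e * Y e)"
          proof (intro eqv_sum eqv_mult_right)
            fix e assume "e \<in> B"
            then have "e \<in> arcs G" "tail G e = v" using B by auto
            then show "V v * X e \<approx> X e" "Y e \<in> Fr" using eqv_V_X[of e] by auto
          qed
          then have "V v * V v - (\<Sum>e\<in>B. V v * X e * Y e) \<approx> V v - (\<Sum>e\<in>B. X e * Y e)"
            using eqv_V_V[of v v] v by (intro eqv_diff) auto
          then show ?thesis by (simp add: source_complement_def right_diff_distrib sum_distrib_left mult.assoc)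
        qed
        then show ?thesis using Vertex True by (intro exI[of _ 1] exI[of _ "{}"] goodI) auto
      next
        case False
        then have "good (V u) 0 {}"
          using u eqv_sym[OF eqv_V_V[of u u]] by (intro other[of _ u]) auto
        then show ?thesis using Vertex by auto
      qed
    next
      case (Edge e)
      then have e: "e \<in> arcs G" using x by (auto simp: lpa_gens_def)
      then have "head G e \<noteq> v" using v(2) by (auto simp: in_arcs_def)
      then have "good (X e) 0 {}" using e by (intro other[OF _ _ _ eqv_X_at_head[OF e]]) auto
      then show ?thesis using Edge by auto
    next
      case (Ghost e)
      then have e: "e \<in> arcs G" using x by (auto simp: lpa_gens_def)
      show ?thesis
      proof (cases "tail G e = v")
        case False
        then have "good (Y e) 0 {}" using e by (intro other[OF _ _ _ eqv_Y_at_tail[OF e]]) auto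
        then show ?thesis using Ghost by auto
      next
        case True
        have "Y e * ?Q B \<approx> sc 0 (?Q B)" if B: "finite B" "{e} \<subseteq> B" "B \<subseteq> out_arcs G v" for B
        proof -
          have "(\<Sum>e'\<in>B. Y e * X e' * Y e') \<approx> (\<Sum>e'\<in>B. if e = e' then Y e else 0)"
          proof (rule eqv_sum)
            fix e' assume "e' \<in> B"
            then have e': "e' \<in> arcs G" using B by auto
            have "Y e * X e' * Y e' \<approx> (if e = e' then V (head G e) else 0) * Y e'"
              using e' by (intro eqv_mult_right eqv_Y_X e) auto
            then show "Y e * X e' * Y e' \<approx> (if e = e' then Y e else 0)"
              using eqv_trans eqv_V_Y[OF e] by (cases "e = e'") auto
          qed
          also have "(\<Sum>e'\<in>B. if e = e' then Y e else 0) = Y e" using B by simp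
          finally have "Y e * V v - (\<Sum>e'\<in>B. Y e * X e' * Y e') \<approx> Y e - Y e"
            using eqv_Y_V[OF e] True by (intro eqv_diff) auto
          then show ?thesis
            by (simp add: source_complement_def right_diff_distrib sum_distrib_left mult.assoc)
        qed
        then have "good (Y e) 0 {e}" using True e by (intro goodI) auto
        then show ?thesis using Ghost by auto
      qed
    qed
    then show "free_gen x \<in> ?U" using fx by blast
  qed
  then show ?thesis using f unfolding good_def by blast
qed

text \<open>Finite sums of vertices are local units. Validity for all larger \<open>S'\<close>
  allows bounds to be joined and a prescribed vertex to be inserted.\<close>

lemma eqv_sum_right_units:
  assumes "f \<in> Fr"
  shows "\<exists>S. finite S \<and> S \<subseteq> verts G \<and> (\<forall>S'. finite S' \<longrightarrow> S \<subseteq> S' \<longrightarrow> S' \<subseteq> verts G \<longrightarrow> f \<approx> (\<Sum>u\<in>S'. f * V u))"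
proof -
  define good where "good f S \<longleftrightarrow> finite S \<and> S \<subseteq> verts G \<and>
    (\<forall>S'. finite S' \<longrightarrow> S \<subseteq> S' \<longrightarrow> S' \<subseteq> verts G \<longrightarrow> f \<approx> (\<Sum>u\<in>S'. f * V u))" for f S
  have goodI: "good f S" if "finite S" "S \<subseteq> verts G"
    "\<And>S'. finite S' \<Longrightarrow> S \<subseteq> S' \<Longrightarrow> S' \<subseteq> verts G \<Longrightarrow> f \<approx> (\<Sum>u\<in>S'. f * V u)" for f S
    using that by (simp add: good_def)
  have goodD: "finite S" "S \<subseteq> verts G"
    "finite S' \<Longrightarrow> S \<subseteq> S' \<Longrightarrow> S' \<subseteq> verts G \<Longrightarrow> f \<approx> (\<Sum>u\<in>S'. f * V u)"
    if "good f S" for f S S'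
    using that by (simp_all add: good_def)
  let ?U = "{f \<in> Fr. \<exists>S. good f S}"
  have "Fr \<subseteq> ?U"
  proof (rule Fr_subset_subalgebra)
    show "fa.subspace ?U"
    proof (rule fa.subspaceI)
      show "f + g \<in> ?U" if fg: "f \<in> ?U" "g \<in> ?U" for f g
      proof -
        obtain S1 S2 where 1: "good f S1" and 2: "good g S2" using fg by blast
        have "f + g \<approx> (\<Sum>u\<in>S'. (f + g) * V u)"
          if "finite S'" "S1 \<union> S2 \<subseteq> S'" "S' \<subseteq> verts G" for S'
          unfolding distrib_right sum.distrib using goodD(3)[OF 1, of S'] goodD(3)[OF 2, of S'] that
          by (intro eqv_add) simp_all
        then have "good (f + g) (S1 \<union> S2)"
          using goodD(1,2)[OF 1] goodD(1,2)[OF 2] by (intro goodI) auto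
        moreover have "f + g \<in> Fr" using fg by simp
        ultimately show ?thesis by blast
      qed
      show "sc c f \<in> ?U" if fU: "f \<in> ?U" for c f
      proof -
        obtain S where S: "good f S" using fU by blast
        have "sc c f \<approx> (\<Sum>u\<in>S'. sc c f * V u)" if "finite S'" "S \<subseteq> S'" "S' \<subseteq> verts G" for S'
        proof -
          have "f \<approx> (\<Sum>u\<in>S'. f * V u)" using goodD(3)[OF S] that by blast
          from eqv_scale[OF this, of c] show ?thesis by (simp add: sum_distrib_left mult.assoc)
        qed
        then have "good (sc c f) S" using goodD(1,2)[OF S] by (intro goodI)
        moreover have "sc c f \<in> Fr" using fU by simp
        ultimately show ?thesis by blast
      qed
    next
      have "good 0 {}" by (rule goodI) auto
      then show "0 \<in> ?U" by auto
    qed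
    show "f * g \<in> ?U" if fg: "f \<in> ?U" "g \<in> ?U" for f g
    proof -
      obtain S where S: "good g S" using fg by blast
      have "f * g \<approx> (\<Sum>u\<in>S'. f * g * V u)" if "finite S'" "S \<subseteq> S'" "S' \<subseteq> verts G" for S'
      proof -
        have "g \<approx> (\<Sum>u\<in>S'. g * V u)" using goodD(3)[OF S] that by blast
        from eqv_mult_left[OF _ this, of f] fg show ?thesis by (simp add: sum_distrib_left mult.assoc)
      qed
      then have "good (f * g) S" using goodD(1,2)[OF S] by (intro goodI)
      moreover have "f * g \<in> Fr" using fg by simp
      ultimately show ?thesis by blast
    qed
    fix x assume x: "x \<in> lpa_gens G"
    then have fx: "free_gen x \<in> Fr" by (simp add: free_gen_word)
    have "\<exists>v\<in>verts G. free_gen x \<approx> free_gen x * V v"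
    proof (cases x)
      case (Vertex v)
      then show ?thesis using x eqv_sym[OF eqv_V_V[of v v]] by (auto simp: lpa_gens_def)
    next
      case (Edge e)
      then show ?thesis using x by (intro bexI[of _ "head G e"]) (auto simp: lpa_gens_def eqv_X_at_head)
    next
      case (Ghost e)
      then show ?thesis using x by (intro bexI[of _ "tail G e"]) (auto simp: lpa_gens_def eqv_Y_at_tail)
    qed
    then obtain v where v: "v \<in> verts G" "free_gen x \<approx> free_gen x * V v" by auto
    have "free_gen x \<approx> (\<Sum>u\<in>S'. free_gen x * V u)" if S': "finite S'" "{v} \<subseteq> S'" "S' \<subseteq> verts G" for S'
    proof -
      have "(\<Sum>u\<in>S'. free_gen x * V u) \<approx> (\<Sum>u\<in>S'. if v = u then free_gen x else 0)"
      proof (rule eqv_sum)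
        fix u assume "u \<in> S'"
        then have u: "u \<in> verts G" using S' by auto
        have "free_gen x * V u \<approx> free_gen x * V v * V u" by (intro eqv_mult_right v) (use u in auto)
        also have "\<dots> \<approx> free_gen x * (if v = u then V v else 0)"
          unfolding mult.assoc by (intro eqv_mult_left fx eqv_V_V v u)
        finally show "free_gen x * V u \<approx> (if v = u then free_gen x else 0)"
          using eqv_trans[OF _ eqv_sym[OF v(2)]] by (cases "v = u") auto
      qed
      then show ?thesis using S' eqv_sym by simp
    qed
    then have "good (free_gen x) {v}" using v by (intro goodI) auto
    then show "free_gen x \<in> ?U" using fx by blast
  qed
  then show ?thesis using assms unfolding good_def by blast
qed

text \<open>Every generator other than \<open>v\<close> is annihilated by \<open>v\<close> on both
  sides. The common \<open>k\<close> in the two products makes \<open>v\<close> central.\<close>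

lemma isolated_central:
  assumes v: "v \<in> verts G" "isolated_vertex G v" and f: "f \<in> Fr"
  shows "\<exists>k. f * V v \<approx> sc k (V v) \<and> V v * f \<approx> sc k (V v)"
proof -
  let ?U = "{f \<in> Fr. \<exists>k. f * V v \<approx> sc k (V v) \<and> V v * f \<approx> sc k (V v)}"
  have ends: "tail G e \<noteq> v" "head G e \<noteq> v" if "e \<in> arcs G" for e
    using v(2) that by (auto simp: isolated_vertex_def)
  have VV: "V u * V v \<approx> 0" "V v * V u \<approx> 0" if "u \<in> verts G" "u \<noteq> v" for u
    using eqv_V_V[of u v] eqv_V_V[of v u] that v by auto
  have zero: "a * b \<approx> 0" if "a \<approx> a * V u" "V u * b \<approx> 0" "a \<in> Fr" "b \<in> Fr" for a b u
  proof -
    have "a * b \<approx> a * V u * b" by (intro eqv_mult_right that)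
    also have "\<dots> \<approx> a * 0" unfolding mult.assoc by (intro eqv_mult_left that)
    finally show ?thesis by simp
  qed
  have zero': "a * b \<approx> 0" if "b \<approx> V u * b" "a * V u \<approx> 0" "a \<in> Fr" "b \<in> Fr" for a b u
  proof -
    have "a * b \<approx> a * (V u * b)" by (intro eqv_mult_left that)
    also have "\<dots> \<approx> 0 * b" unfolding mult.assoc[symmetric] by (intro eqv_mult_right that)
    finally show ?thesis by simp
  qed
  have "Fr \<subseteq> ?U"
  proof (rule Fr_subset_subalgebra)
    show "fa.subspace ?U"
    proof (rule fa.subspaceI)
      show "0 \<in> ?U" by (auto intro!: exI[of _ "0::'k"])
      show "f + g \<in> ?U" if fg: "f \<in> ?U" "g \<in> ?U" for f g
      proof -
        obtain k l where "f * V v \<approx> sc k (V v)" "V v * f \<approx> sc k (V v)" "g * V v \<approx> sc l (V v)" "V v * g \<approx> sc l (V v)"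
          using fg by blast
        then have "(f + g) * V v \<approx> sc (k + l) (V v)" "V v * (f + g) \<approx> sc (k + l) (V v)"
          by (auto simp: distrib_left distrib_right single_add intro!: eqv_add)
        then show ?thesis using fg by auto
      qed
      show "sc c f \<in> ?U" if f: "f \<in> ?U" for c f
      proof -
        obtain k where "f * V v \<approx> sc k (V v)" "V v * f \<approx> sc k (V v)" using f by blast
        then have "sc c (f * V v) \<approx> sc c (sc k (V v))" "sc c (V v * f) \<approx> sc c (sc k (V v))"
          by (blast intro: eqv_scale)+
        moreover have "sc c f * V v = sc c (f * V v)" by (rule mult.assoc)
        moreover have "V v * sc c f = sc c (V v * f)" by (rule mult_scalar_left)
        moreover have "sc c (sc k (V v)) = sc (c * k) (V v)" by simp
        ultimately have "sc c f * V v \<approx> sc (c * k) (V v)" "V v * sc c f \<approx> sc (c * k) (V v)"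
          by (simp_all only:)
        then show ?thesis using f by auto
      qed
    qed
    show "f * g \<in> ?U" if fg: "f \<in> ?U" "g \<in> ?U" for f g
    proof -
      obtain k l where kl: "f * V v \<approx> sc k (V v)" "V v * f \<approx> sc k (V v)" "g * V v \<approx> sc l (V v)" "V v * g \<approx> sc l (V v)"
        using fg by blast
      have "f * g * V v \<approx> f * sc l (V v)" unfolding mult.assoc using fg kl by (intro eqv_mult_left) auto
      also have "f * sc l (V v) = sc l (f * V v)" by (rule mult_scalar_left)
      also have "\<dots> \<approx> sc l (sc k (V v))" by (intro eqv_scale kl)
      finally have 1: "f * g * V v \<approx> sc (k * l) (V v)"
        by (simp add: mult.assoc[symmetric] mult_single mult.commute[of k])
      have "V v * (f * g) \<approx> sc k (V v) * g"
        unfolding mult.assoc[symmetric] using fg kl by (intro eqv_mult_right) auto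
      also have "sc k (V v) * g = sc k (V v * g)" by (rule mult.assoc)
      also have "\<dots> \<approx> sc k (sc l (V v))" by (intro eqv_scale kl)
      finally have "V v * (f * g) \<approx> sc (k * l) (V v)" by (simp add: mult.assoc[symmetric] mult_single)
      then show ?thesis using fg 1 by auto
    qed
    fix x assume x: "x \<in> lpa_gens G"
    then have fx: "free_gen x \<in> Fr" by (simp add: free_gen_word)
    consider "x = Vertex v" | "free_gen x * V v \<approx> 0" "V v * free_gen x \<approx> 0"
    proof (cases x)
      case (Vertex u)
      then show thesis using x that VV[of u] by (cases "u = v") (auto simp: lpa_gens_def)
    next
      case (Edge e)
      then have e: "e \<in> arcs G" using x by (auto simp: lpa_gens_def)
      show thesis
        using that(2) zero[OF eqv_X_at_head[OF e], of "V v"] zero'[OF eqv_sym[OF eqv_V_X[OF e]], of "V v"]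
          VV[of "head G e"] VV[of "tail G e"] ends[OF e] e v Edge by auto
    next
      case (Ghost e)
      then have e: "e \<in> arcs G" using x by (auto simp: lpa_gens_def)
      show thesis
        using that(2) zero[OF eqv_Y_at_tail[OF e], of "V v"] zero'[OF eqv_sym[OF eqv_V_Y[OF e]], of "V v"]
          VV[of "head G e"] VV[of "tail G e"] ends[OF e] e v Ghost by auto
    qed
    then have "\<exists>k. free_gen x * V v \<approx> sc k (V v) \<and> V v * free_gen x \<approx> sc k (V v)"
    proof cases
      case 1
      then show ?thesis using eqv_V_V[of v v] v by (intro exI[of _ 1]) auto
    next
      case 2
      then show ?thesis by (intro exI[of _ 0]) auto
    qed
    then show "free_gen x \<in> ?U" using fx by blast
  qed
  then show ?thesis using f by blast
qed

end

section \<open>Locally solvable ideals when all Lie ideals are ideals\<close>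

context lie_ideal_leavitt
begin

text \<open>\<open>f u = 0\<close> for regular \<open>u\<close>, so local units give
  \<open>f = f v\<close> if there is a nonregular vertex \<open>v\<close>, which is then unique, and
  \<open>f = 0\<close> otherwise. For isolated \<open>v\<close> the product \<open>f v\<close> is a
  multiple of \<open>v\<close>. For an infinite emitter, \<open>f e = f e r(e) = 0\<close> for all
  edges from \<open>v\<close>, so \<open>f\<close> equals its product with
  \<open>source_complement v B\<close>, which is a multiple \<open>k\<close> of that element; it
  remains to show \<open>k = 0\<close>.\<close>

lemma ideal_without_regular_vertex:
  assumes J: "is_ideal J" and no: "\<And>w. w \<in> regular_verts G \<Longrightarrow> V w \<notin> J" and f: "f \<in> J"
  shows "(\<nexists>v. v \<in> verts G \<and> isolated_vertex G v) \<Longrightarrow> f \<in> rel_ideal"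
    and "v \<in> verts G \<Longrightarrow> isolated_vertex G v \<Longrightarrow> \<exists>k. f \<approx> sc k (V v)"
proof -
  note D = is_idealD[OF J]
  have zero: "g * V u \<in> rel_ideal" if "g \<in> J" "u \<in> regular_verts G" for g u
    using ideal_contains_regular_vertex[OF J that] no by blast
  have fF: "f \<in> Fr" using D(3) f by auto
  obtain S where S: "finite S" "S \<subseteq> verts G"
    "\<And>S'. finite S' \<Longrightarrow> S \<subseteq> S' \<Longrightarrow> S' \<subseteq> verts G \<Longrightarrow> f \<approx> (\<Sum>u\<in>S'. f * V u)"
    using eqv_sum_right_units[OF fF] by blast
  have right: "f \<approx> f * V v" if v: "v \<in> verts G" "v \<notin> regular_verts G" for v
  proof -
    have "f \<approx> (\<Sum>u\<in>insert v S. f * V u)" by (rule S(3)) (use S(1,2) v in auto)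
    also have "\<dots> \<approx> (\<Sum>u\<in>insert v S. if u = v then f * V v else 0)"
    proof (rule eqv_sum)
      fix u assume "u \<in> insert v S"
      then have "u = v \<or> u \<in> regular_verts G" using S(2) v(1) nonregular_unique[OF v, of u] by auto
      then show "f * V u \<approx> (if u = v then f * V v else 0)" using zero[OF f] v by (auto simp: eqv_zero_iff)
    qed
    also have "(\<Sum>u\<in>insert v S. if u = v then f * V v else 0) = f * V v" using S(1) by simp
    finally show ?thesis .
  qed
  show "\<exists>k. f \<approx> sc k (V v)" if v: "v \<in> verts G" "isolated_vertex G v" for v
  proof -
    have "v \<notin> regular_verts G" using v by (auto simp: regular_verts_def isolated_vertex_def)
    then show ?thesis using right v isolated_central[OF v fF] eqv_trans by blast
  qed
  assume no_iso: "\<nexists>v. v \<in> verts G \<and> isolated_vertex G v"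
  show "f \<in> rel_ideal"
  proof (cases "verts G \<subseteq> regular_verts G")
    case True
    have "(\<Sum>u\<in>S. f * V u) \<in> rel_ideal"
      using zero[OF f] S(2) True by (intro fa.subspace_sum[OF rel_ideal_subspace]) auto
    then show ?thesis using eqv_rel_ideal[OF S(3)[OF S(1) order_refl S(2)]] by simp
  next
    case False
    then obtain v where v: "v \<in> verts G" "v \<notin> regular_verts G" by auto
    then have src: "in_arcs G v = {}" using nonregular_source by (auto simp: in_arcs_def)
    then have inf: "infinite (out_arcs G v)"
      using v no_iso by (auto simp: regular_verts_def isolated_vertex_def infinite_emitter_def)
    have fX: "f * X e \<in> rel_ideal" if e: "e \<in> out_arcs G v" for e
    proof -
      have ea: "e \<in> arcs G" using e by simp
      have "f * X e \<in> J" using D(4)[OF f] ea by simp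
      then have "f * X e * V (head G e) \<in> rel_ideal" using zero head_regular[OF ea] by blast
      then show ?thesis using eqv_rel_ideal[OF eqv_mult_left[OF fF eqv_X_V[OF ea]]] by (simp add: mult.assoc)
    qed
    obtain k B where B: "finite B" "B \<subseteq> out_arcs G v"
      "f * source_complement v B \<approx> sc k (source_complement v B)"
      using mult_source_complement[OF v(1) src fF] by blast
    have "(\<Sum>e\<in>B. f * X e * Y e) \<in> rel_ideal"
    proof (rule fa.subspace_sum[OF rel_ideal_subspace])
      fix e assume "e \<in> B"
      then have "e \<in> out_arcs G v" using B(2) by blast
      then show "f * X e * Y e \<in> rel_ideal" using fX[of e] rel_ideal_mult_right[of "Y e" "f * X e"] by simp
    qed
    then have "f * source_complement v B \<approx> f * V v"
      by (simp add: source_complement_def right_diff_distrib sum_distrib_left mult.assoc eqv_def)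
    then have fk: "f \<approx> sc k (source_complement v B)"
      using right[OF v] B(3) eqv_trans eqv_sym by blast
    have "k = 0"
    proof (rule ccontr)
      assume k: "k \<noteq> 0"
      \<comment> \<open>Right multiplication by an edge \<open>e\<close> outside \<open>B\<close>
        turns \<open>source_complement v B\<close> into \<open>e\<close>, so \<open>k e = 0\<close>,
        while \<open>e^* e\<close> is the nonzero vertex \<open>r(e)\<close>.\<close>
      obtain e where e: "e \<in> out_arcs G v" "e \<notin> B" using inf B(1) by (meson finite_subset subsetI)
      then have ea: "e \<in> arcs G" "tail G e = v" by auto
      have "(\<Sum>e'\<in>B. X e' * (Y e' * X e)) \<in> rel_ideal"
      proof (rule fa.subspace_sum[OF rel_ideal_subspace])
        fix e' assume e': "e' \<in> B"
        then have "e' \<in> arcs G" "e' \<noteq> e" using B e by auto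
        then show "X e' * (Y e' * X e) \<in> rel_ideal" using eqv_Y_X[of e' e] ea by (auto simp: eqv_zero_iff)
      qed
      then have "V v * X e - (\<Sum>e'\<in>B. X e' * (Y e' * X e)) \<approx> X e - 0"
        using eqv_V_X[OF ea(1)] ea by (intro eqv_diff) (auto simp: eqv_zero_iff)
      then have "source_complement v B * X e \<approx> X e"
        by (simp add: source_complement_def left_diff_distrib sum_distrib_right mult.assoc)
      then have "sc k (source_complement v B) * X e \<approx> sc k (X e)"
        unfolding mult.assoc by (rule eqv_scale)
      moreover have "f * X e \<approx> sc k (source_complement v B) * X e"
        using fk ea by (intro eqv_mult_right) auto
      ultimately have "sc k (X e) \<in> rel_ideal" using fX[OF e(1)] eqv_rel_ideal eqv_trans by blast
      then have "sc (inverse k) (sc k (X e)) \<in> rel_ideal" by (rule rel_ideal_scale)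
      then have "X e \<in> rel_ideal" using k by (simp add: mult.assoc[symmetric] mult_single)
      then have "Y e * X e \<in> rel_ideal" using ea by simp
      then have "V (head G e) \<in> rel_ideal" using eqv_rel_ideal[OF eqv_Y_X[OF ea(1) ea(1)]] by simp
      then show False using regular_V_not_rel_ideal head_regular ea by blast
    qed
    then show ?thesis using fk by (simp add: eqv_zero_iff)
  qed
qed

lemma solvable_lie_ideal:
  assumes J: "lie_ideal (minus_lie L) J" "lie_locally_solvable (minus_lie L) J"
  shows "is_ideal (pullback J)" "cls ` pullback J = J" "\<And>w. w \<in> regular_verts G \<Longrightarrow> V w \<notin> pullback J"
proof -
  have sub: "alg_subspace L J" using J(1) by (simp add: lie_ideal_def)
  note pb = pullback_props[OF sub]
  show "cls ` pullback J = J" by (rule pb(3))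
  show ideal: "is_ideal (pullback J)"
  proof (rule lie_ideal_is_ideal[OF pb(1,2)])
    show "pullback J \<subseteq> Fr" by (auto simp: pullback_def)
    show "u * x - x * u \<in> pullback J" if "u \<in> pullback J" "x \<in> Fr" for u x
    proof -
      have "u \<in> Fr" "cls u \<in> J" using that by (auto simp: pullback_def)
      moreover have "alg_mult (minus_lie L) (cls u) (cls x) \<in> J"
        using J(1) that by (auto simp: lie_ideal_def L_carrier pullback_def)
      ultimately show ?thesis using that by (simp add: pullback_def)
    qed
  qed
  show "V w \<notin> pullback J" if "w \<in> regular_verts G" for w
    using vertex_not_locally_solvable[OF ideal that] J(2) pb(3) by auto
qed

lemma alg_span_subset:
  assumes "fa.subspace U" "U \<subseteq> Fr" "B \<subseteq> cls ` U"
  shows "alg_span L B \<subseteq> cls ` U"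
  unfolding alg_span_def using assms subspace_image by (intro Inter_lower) auto

lemma zero_alg_span: "cls 0 \<in> alg_span L B"
  unfolding alg_span_def by (auto simp: alg_subspace_def)

lemma radical_zero:
  assumes "\<nexists>v. v \<in> verts G \<and> isolated_vertex G v"
  shows "locally_solvable_radical (minus_lie L) = {cls 0}"
proof -
  have "J \<subseteq> cls ` {0}" if J: "lie_ideal (minus_lie L) J" "lie_locally_solvable (minus_lie L) J" for J
  proof -
    note S = solvable_lie_ideal[OF J]
    have "f \<approx> 0" "f \<in> Fr" if "f \<in> pullback J" for f
      using ideal_without_regular_vertex(1)[OF S(1,3) that] assms is_idealD(3)[OF S(1)] that
      by (auto simp: eqv_zero_iff)
    then have "cls ` pullback J \<subseteq> cls ` {0}" using cls_eq_iff by fastforce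
    then show ?thesis using S(2) by simp
  qed
  then have "alg_span L (\<Union>{J. lie_ideal (minus_lie L) J \<and> lie_locally_solvable (minus_lie L) J}) \<subseteq> cls ` {0}"
    by (intro alg_span_subset) (auto simp: fa.subspace_single_0)
  then show ?thesis
    unfolding locally_solvable_radical_def minus_lie_simps using zero_alg_span by blast
qed

text \<open>\<open>K v\<close> is central, hence a locally solvable ideal. Conversely a locally
  solvable ideal contains no regular vertex and therefore lies in \<open>K v\<close>.\<close>

lemma radical_isolated:
  assumes v: "v \<in> verts G" "isolated_vertex G v"
  shows "locally_solvable_radical (minus_lie L) = range (\<lambda>k. cls (sc k (V v)))" (is "_ = ?Z")
proof
  let ?U = "range (\<lambda>k. sc k (V v))"
  have U: "fa.subspace ?U"
  proof (rule fa.subspaceI)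
    show "0 \<in> ?U" by (auto intro: image_eqI[of _ _ "0::'k"])
    show "f + g \<in> ?U" if fg: "f \<in> ?U" "g \<in> ?U" for f g
    proof -
      obtain k l where "f = sc k (V v)" "g = sc l (V v)" using fg by auto
      then have "f + g = sc (k + l) (V v)" by (simp add: single_add distrib_right)
      then show ?thesis by blast
    qed
    show "sc c f \<in> ?U" if fU: "f \<in> ?U" for c f
    proof -
      obtain k where "f = sc k (V v)" using fU by auto
      then have "sc c f = sc (c * k) (V v)" by (simp add: mult.assoc[symmetric] mult_single)
      then show ?thesis by blast
    qed
  qed
  have UF: "?U \<subseteq> Fr" using v by auto
  have Z: "?Z = cls ` ?U" by auto
  have "J \<subseteq> ?Z" if J: "lie_ideal (minus_lie L) J" "lie_locally_solvable (minus_lie L) J" for J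
  proof -
    note S = solvable_lie_ideal[OF J]
    have "cls f \<in> ?Z" if f: "f \<in> pullback J" for f
    proof -
      obtain k where "f \<approx> sc k (V v)"
        using ideal_without_regular_vertex(2)[OF S(1,3) f v] by blast
      then have "cls f = cls (sc k (V v))"
        using is_idealD(3)[OF S(1)] f v by (intro cls_eqI) auto
      then show ?thesis by blast
    qed
    then have "cls ` pullback J \<subseteq> ?Z" by blast
    then show ?thesis by (simp only: S(2))
  qed
  then show "locally_solvable_radical (minus_lie L) \<subseteq> ?Z"
    unfolding locally_solvable_radical_def minus_lie_simps Z using U UF by (intro alg_span_subset) auto
  have central: "alg_mult (minus_lie L) (cls (sc k (V v))) (cls f) = cls 0" if f: "f \<in> Fr" for k f
  proof -
    obtain l where "f * V v \<approx> sc l (V v)" "V v * f \<approx> sc l (V v)" using isolated_central[OF v f] by blast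
    then have "sc k (V v * f) - sc k (f * V v) \<approx> sc k (sc l (V v)) - sc k (sc l (V v))"
      by (intro eqv_diff eqv_scale)
    moreover have "sc k (V v) * f = sc k (V v * f)" by (rule mult.assoc)
    moreover have "f * sc k (V v) = sc k (f * V v)" by (rule mult_scalar_left)
    ultimately have "sc k (V v) * f - f * sc k (V v) \<approx> 0" by (simp only: diff_self)
    then have "cls (sc k (V v) * f - f * sc k (V v)) = cls 0" using f v by (intro cls_eqI) auto
    then show ?thesis using f v by simp
  qed
  have Z0: "cls 0 \<in> ?Z" by (auto intro: image_eqI[of _ _ "0::'k"])
  have "lie_ideal (minus_lie L) ?Z"
    unfolding lie_ideal_def minus_lie_simps L_carrier
  proof (intro conjI ballI)
    show "alg_subspace L ?Z" unfolding Z by (rule subspace_image[OF U UF])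
    show "alg_mult (minus_lie L) u x \<in> ?Z" if "u \<in> ?Z" "x \<in> cls ` Fr" for u x
      using that central Z0 by auto
  qed
  moreover have "lie_locally_solvable (minus_lie L) ?Z"
    unfolding lie_locally_solvable_def
  proof (intro allI impI, elim conjE)
    fix T assume T: "T \<subseteq> ?Z"
    have "alg_mult (minus_lie L) x y = cls 0" if xy: "x \<in> T" "y \<in> T" for x y
    proof -
      obtain k l where "x = cls (sc k (V v))" "y = cls (sc l (V v))" using xy T by blast
      then show ?thesis using central[of "sc l (V v)" k] v by simp
    qed
    then have "{alg_mult (minus_lie L) x y |x y. x \<in> T \<and> y \<in> T} \<subseteq> cls ` {0}" by auto
    then have "alg_span L {alg_mult (minus_lie L) x y |x y. x \<in> T \<and> y \<in> T} \<subseteq> cls ` {0}"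
      by (intro alg_span_subset) (auto simp: fa.subspace_single_0)
    then have "lie_derived (minus_lie L) T = {cls 0}"
      unfolding lie_derived_def minus_lie_simps using zero_alg_span by blast
    then show "lie_solvable (minus_lie L) T"
      unfolding lie_solvable_def by (intro exI[of _ 1]) simp
  qed
  ultimately show "?Z \<subseteq> locally_solvable_radical (minus_lie L)"
    unfolding locally_solvable_radical_def minus_lie_simps by (intro subsetI alg_span_base UnionI) auto
qed

lemma radical_isolated_isomorphic:
  assumes v: "v \<in> verts G" "isolated_vertex G v"
  shows "alg_isomorphic
    ((minus_lie L)\<lparr>alg_carrier := locally_solvable_radical (minus_lie L)\<rparr>)
    (one_dim_abelian_lie :: ('k, 'k) kalgebra)"
proof -
  have "v \<notin> regular_verts G" using v by (auto simp: regular_verts_def isolated_vertex_def)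
  \<comment> \<open>No infinite path starts at an isolated vertex; that \<open>v\<close> is nonzero
    comes from the trace, through \<open>v \<notin> [L, L]\<close>.\<close>
  then have "V v \<notin> rel_ideal" using V_comm_span_iff[OF v(1)] rel_ideal_comm_span by auto
  define \<psi> where "\<psi> k = cls (sc k (V v))" for k
  have rad: "locally_solvable_radical (minus_lie L) = range \<psi>"
    using radical_isolated[OF v] by (simp add: \<psi>_def[abs_def])
  have inj: "inj \<psi>"
  proof (rule injI)
    fix k l assume "\<psi> k = \<psi> l"
    then have "sc k (V v) - sc l (V v) \<in> rel_ideal" using v by (simp add: \<psi>_def cls_eq_iff eqv_def)
    then have "sc (k - l) (V v) \<in> rel_ideal"
      by (simp add: single_diff left_diff_distrib)
    then have rel_ideal: "sc (inverse (k - l)) (sc (k - l) (V v)) \<in> rel_ideal" by (rule rel_ideal_scale)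
    show "k = l"
    proof (rule ccontr)
      assume "k \<noteq> l"
      then have "sc (inverse (k - l)) (sc (k - l) (V v)) = V v"
        by (simp add: mult.assoc[symmetric] mult_single)
      then show False using \<open>V v \<notin> rel_ideal\<close> rel_ideal by simp
    qed
  qed
  have "sc k (V v) * sc l (V v) = sc (l * k) (V v * V v)" for k l
    by (subst mult_scalar_left) (simp add: mult.assoc[symmetric] mult_single)
  then have "alg_mult (minus_lie L) (\<psi> k) (\<psi> l) = \<psi> 0" for k l
    using v by (simp add: \<psi>_def mult.commute[of k l])
  moreover have "alg_add L (\<psi> k) (\<psi> l) = \<psi> (k + l)" "alg_smult L c (\<psi> k) = \<psi> (c * k)" for k l c
    using v by (simp_all add: \<psi>_def single_add distrib_right mult.assoc[symmetric] mult_single)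
  ultimately have hom: "alg_add L (\<psi> k) (\<psi> l) = \<psi> (k + l)" "alg_smult L c (\<psi> k) = \<psi> (c * k)"
    "alg_mult (minus_lie L) (\<psi> k) (\<psi> l) = \<psi> 0" for k l c
    by blast+
  show ?thesis
    unfolding alg_isomorphic_def rad
  proof (intro exI[of _ "inv \<psi>"] conjI ballI allI)
    show "bij_betw (inv \<psi>) (alg_carrier (minus_lie L\<lparr>alg_carrier := range \<psi>\<rparr>))
        (alg_carrier (one_dim_abelian_lie :: ('k, 'k) kalgebra))"
      using bij_betw_inv_into[of \<psi> UNIV "range \<psi>"] inj by (simp add: one_dim_abelian_lie_def bij_betw_def)
  qed (use inj hom in \<open>auto simp: one_dim_abelian_lie_def minus_lie_def[of L]\<close>)
qed

end

theorem theorem4p10: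
  fixes E :: "('v, 'e) pre_digraph"
    and L :: "('v, 'e, 'k::field) lpa"
  assumes E: "wf_digraph E"
    and L: "L = leavitt_path_algebra E"
    and nondegenerate: "arcs E \<noteq> {} \<or> (\<exists>u\<in>verts E. \<exists>v\<in>verts E. u \<noteq> v)"
    and lie_ideals: "\<forall>U. lie_ideal (minus_lie L) U \<longrightarrow> ring_ideal L U"
  shows "CHAR('k) > 0 \<and>
    (graph_type1 CHAR('k) E \<or> graph_type2 CHAR('k) E \<or> graph_type3 CHAR('k) E) \<and>
    lie_algebra (minus_lie L) \<and> lie_locally_finite (minus_lie L) \<and>
    \<not> alg_fin_dim (minus_lie L) (alg_carrier (minus_lie L)) \<and>
    (graph_type1 CHAR('k) E \<or> graph_type3 CHAR('k) E \<longrightarrow>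
       locally_solvable_radical (minus_lie L) = {alg_zero L}) \<and>
    (graph_type2 CHAR('k) E \<longrightarrow>
       alg_isomorphic
         ((minus_lie L)\<lparr>alg_carrier := locally_solvable_radical (minus_lie L)\<rparr>)
         (one_dim_abelian_lie :: ('k, 'k) kalgebra))"
proof -
  interpret lie_ideal_leavitt E "TYPE('k)"
    using E lie_ideals nondegenerate unfolding L
    by (intro lie_ideal_leavitt.intro leavitt.intro lie_ideal_leavitt_axioms.intro) auto
  \<comment> \<open>The radical depends only on the existence of an isolated vertex. Under
    \<open>graph_type3\<close> such a vertex would be nonregular and so coincide with the infinite
    emitter.\<close>
  have "\<nexists>v. v \<in> verts E \<and> isolated_vertex E v" if "graph_type1 CHAR('k) E \<or> graph_type3 CHAR('k) E"
    using that
  proof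
    assume "graph_type1 CHAR('k) E"
    then show ?thesis
      by (auto simp: graph_type1_def p_commutator_graph_def regular_verts_def isolated_vertex_def)
  next
    assume "graph_type3 CHAR('k) E"
    then obtain v where v: "v \<in> verts E" "infinite_emitter E v" unfolding graph_type3_def by auto
    show ?thesis
    proof
      assume "\<exists>w. w \<in> verts E \<and> isolated_vertex E w"
      then obtain w where w: "w \<in> verts E" "isolated_vertex E w" by blast
      then have "w = v"
        using v by (intro nonregular_unique) (auto simp: regular_verts_def isolated_vertex_def)
      then show False using v w by (auto simp: infinite_emitter_def isolated_vertex_def)
    qed
  qed
  then have "locally_solvable_radical (minus_lie L) = {alg_zero L}"
    if "graph_type1 CHAR('k) E \<or> graph_type3 CHAR('k) E"
    using that radical_zero unfolding L by simp
  moreover have "alg_isomorphic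
         ((minus_lie L)\<lparr>alg_carrier := locally_solvable_radical (minus_lie L)\<rparr>)
         (one_dim_abelian_lie :: ('k, 'k) kalgebra)"
    if "graph_type2 CHAR('k) E"
    using that radical_isolated_isomorphic unfolding L graph_type2_def by blast
  ultimately show ?thesis
    using CHAR_pos graph_types lie_algebra_minus_lie lie_locally_finite_minus_lie[OF acyclic]
      minus_lie_infinite_dimensional
    unfolding L by blast
qed

end
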